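(* Let $\pi$ be a set of primes and $(B,+,\circ)$ a finite skew brace. If both $(B,\circ)$ and $(B\ast B,+)$ have normal Hall $\pi$-subgroups $P$ and $P_1$, respectively, then $P$ is a Hall $\pi$-sub-skew brace of $B$.
   Context: A skew (left) brace is a triple $(B,+,\circ)$ where $(B,+)$ and $(B,\circ)$ are (not necessarily abelian) groups with $a\circ(b+c)=a\circ b-a+a\circ c$ for all $a,b,c\in B$. Put $a\ast b=-a+a\circ b-b$, and let $B\ast B$ be the subgroup of $(B,+)$ generated by all $a\ast b$ with $a,b\in B$. A sub-skew brace of $B$ is a subset that is a subgroup of both $(B,+)$ and $(B,\circ)$. For a set of primes $\pi$, a $\pi$-number is a positive integer all of whose prime divisors lie in $\pi$. A Hall $\pi$-subgroup of a finite group (resp. a Hall $\pi$-sub-skew brace of a finite skew brace) is a subgroup (resp. sub-skew brace) whose order is the largest $\pi$-number dividing the order of the group (resp. skew brace). "Normal" in the claim means that $P$ is normal in $(B,\circ)$ and $P_1$ is normal in $(B\ast B,+)$. *)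

theory Defs
  imports "HOL-Algebra.Algebra" "HOL-Computational_Algebra.Primes"
begin

text \<open>
  A skew brace reuses the signature of rings: \<open>\<oplus>\<close> is the additive operation, and \<open>\<otimes>\<close>
  is the operation written \<open>\<circ>\<close> in the literature. Thus \<open>(B, +)\<close> is \<open>add_monoid B\<close> and
  \<open>(B, \<circ>)\<close> is \<open>B\<close> itself viewed as a monoid. Neither group needs to be abelian.
\<close>

locale skew_brace = add: group "add_monoid B" + group B
  for B :: "('a, 'b) ring_scheme" (structure) +
  assumes brace_distrib:
    "\<lbrakk>a \<in> carrier B; b \<in> carrier B; c \<in> carrier B\<rbrakk>
      \<Longrightarrow> a \<otimes> (b \<oplus> c) = ((a \<otimes> b) \<ominus> a) \<oplus> (a \<otimes> c)"

definition brace_star :: "('a, 'b) ring_scheme \<Rightarrow> 'a \<Rightarrow> 'a \<Rightarrow> 'a" where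
  "brace_star B a b = ((\<ominus>\<^bsub>B\<^esub> a) \<oplus>\<^bsub>B\<^esub> (a \<otimes>\<^bsub>B\<^esub> b)) \<ominus>\<^bsub>B\<^esub> b"

definition star_square :: "('a, 'b) ring_scheme \<Rightarrow> 'a set" where
  "star_square B =
    generate (add_monoid B) {brace_star B a b | a b. a \<in> carrier B \<and> b \<in> carrier B}"

definition sub_skew_brace :: "'a set \<Rightarrow> ('a, 'b) ring_scheme \<Rightarrow> bool" where
  "sub_skew_brace H B \<longleftrightarrow> subgroup H (add_monoid B) \<and> subgroup H B"

text \<open>The unqualified name \<open>prime\<close> would denote the notion of primality in monoids of HOL-Algebra.\<close>

definition pi_number :: "nat set \<Rightarrow> nat \<Rightarrow> bool" where
  "pi_number \<pi> n \<longleftrightarrow> n > 0 \<and> (\<forall>p. Factorial_Ring.prime p \<and> p dvd n \<longrightarrow> p \<in> \<pi>)"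

text \<open>For \<open>n > 0\<close> the set below is finite and contains 1, so the maximum is meaningful.\<close>

definition pi_part :: "nat set \<Rightarrow> nat \<Rightarrow> nat" where
  "pi_part \<pi> n = Max {d. pi_number \<pi> d \<and> d dvd n}"

definition hall_subgroup :: "nat set \<Rightarrow> 'a set \<Rightarrow> ('a, 'b) monoid_scheme \<Rightarrow> bool" where
  "hall_subgroup \<pi> H G \<longleftrightarrow> subgroup H G \<and> card H = pi_part \<pi> (order G)"

definition hall_sub_skew_brace :: "nat set \<Rightarrow> 'a set \<Rightarrow> ('a, 'b) ring_scheme \<Rightarrow> bool" where
  "hall_sub_skew_brace \<pi> H B \<longleftrightarrow> sub_skew_brace H B \<and> card H = pi_part \<pi> (order B)"

end

theory Submission
  imports Defs
begin

text \<open>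
  Let \<open>\<lambda>\<^sub>a b = -a + a \<circ> b\<close>; this is an action of \<open>(B, \<circ>)\<close> on \<open>(B, +)\<close> by automorphisms, and
  \<open>a * b = \<lambda>\<^sub>a b - b\<close>. Since \<open>a + b = a \<circ> \<lambda>\<^sub>a\<^sup>-\<^sup>1 b\<close>, the subgroup \<open>P\<close> of \<open>(B, \<circ>)\<close> is closed under
  addition as soon as it is invariant under \<open>\<lambda>\<^sub>a\<close> for \<open>a \<in> P\<close>. The set \<open>D = B * B\<close> is an ideal. Being a
  normal Hall subgroup, \<open>P\<^sub>1\<close> consists of the elements of \<open>D\<close> killed by its order, so every additive
  automorphism that preserves \<open>D\<close> preserves \<open>P\<^sub>1\<close>; counting then gives \<open>P\<^sub>1 = P \<inter> D\<close>, and \<open>P\<^sub>1\<close> is an ideal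
  too. What has to be shown is \<open>\<lambda>\<^sub>c a - a \<in> P\<^sub>1\<close> for all \<open>a, c \<in> P\<close>
  (\<open>lam_trivial_modulo_ideal\<close>): modulo \<open>P\<^sub>1\<close>, the group \<open>P\<close> acts trivially on itself.

  Modulo \<open>P\<^sub>1\<close> the order of \<open>D\<close> is prime to that of \<open>P\<close>, and \<open>P\<close> and \<open>D\<close> commute in \<open>(B, \<circ>)\<close>. In the semidirect
  product \<open>G\<close> of \<open>(B, +)\<close> by \<open>(B, \<circ>)\<close>, divided by \<open>P\<^sub>1 \<times> P\<^sub>1\<close>, consider the two copies \<open>i a = (a, a)\<close> and
  \<open>j c = (0, c)\<close> of \<open>P\<close> and the normal subgroup \<open>M\<close> that is the image of \<open>D \<times> D\<close>. Then
  \<open>i(a)\<^sup>-\<^sup>1 j(c) i(a) = j(a\<^sup>-\<^sup>1 c a)\<close> holds modulo \<open>M\<close>, and it holds exactly iff \<open>\<lambda>\<^sub>c a - a \<in> P\<^sub>1\<close>. The two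
  copies \<open>{(d, d)}\<close> and \<open>{(0, d)}\<close> of \<open>D\<close> centralize \<open>i(P)\<close> and \<open>j(P)\<close> respectively, and their product is \<open>M\<close>.

  So the theorem is about a normal subgroup \<open>M\<close> of order prime to that of \<open>P\<close> which is a product of a
  subset centralizing \<open>i(P)\<close> and a subset centralizing \<open>j(P)\<close>
  (\<open>coprime_factorization_conj_by\<close>). By Schur and Zassenhaus there is a complement \<open>K\<close> of \<open>M\<close> in
  \<open>M i(P) j(P)\<close>, and in \<open>K\<close> the lifts \<open>\<alpha> a\<close> of \<open>i a\<close> and \<open>\<phi> c\<close> of \<open>j c\<close> satisfy the wanted relation. If \<open>\<alpha> a\<close>
  is an \<open>M\<close>-conjugate of \<open>i a\<close> and \<open>\<phi>\<close> is on \<open>C \<le> P\<close> an \<open>M\<close>-conjugate of \<open>j\<close>, then the factorization of \<open>M\<close>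
  provides a single conjugating element for both (\<open>align_both\<close>), and the relation for \<open>\<alpha>\<close> and \<open>\<phi>\<close> becomes
  one for \<open>i\<close> and \<open>j\<close>. The first condition holds when \<open>a\<close> has prime power order.

  The second condition, for \<open>C = P\<close>, is the conjugacy half of the Schur-Zassenhaus theorem, which for
  a general pair of coprime groups depends on the Feit-Thompson theorem. Here it follows from the
  factorization of \<open>M\<close> by induction on the subgroup \<open>C\<close> (\<open>aligned_step\<close>). Suppose it holds for all proper
  subgroups of \<open>P\<close> but not for \<open>P\<close>. A normal maximal subgroup of \<open>P\<close> is excluded by a Sylow-type argument.
  If the relation held for all \<open>a\<close> of prime power order, then aligning \<open>a\<close> and a maximal subgroup
  \<open>V\<close> that it does not normalize would align all of \<open>P\<close>. Otherwise there is an \<open>a\<close> for which the \<open>c\<close> that satisfy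
  the relation form a proper subgroup \<open>H\<close>; \<open>H\<close> is maximal and contains \<open>V\<^sub>1 \<inter> V\<^sub>2\<close> for all maximal
  \<open>V\<^sub>1 \<noteq> V\<^sub>2\<close>. Then any two maximal subgroups meet inside the core of \<open>H\<close>, and counting the elements outside
  this core shows that this is impossible (\<open>maximal_subgroups_not_all_meet_within\<close>).
\<close>

section \<open>Fixed points of actions of p-groups\<close>


lemma (in group) inv_mult_cancel [simp]:
  assumes "x \<in> carrier G" "y \<in> carrier G"
  shows "inv x \<otimes> (x \<otimes> y) = y" "x \<otimes> (inv x \<otimes> y) = y"
  using assms by (simp_all flip: m_assoc)

text \<open>
  The orbits that are not single points have a length divisible by \<open>p\<close>. The action is given by a plain
  function, without the extensionality that \<open>group_action\<close> demands.
\<close>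

lemma p_group_fixed_points_cong:
  assumes "group S" and card_S: "card (carrier S) = p ^ k" and p: "Factorial_Ring.prime p"
    and "finite U"
    and act_closed: "\<And>s x. s \<in> carrier S \<Longrightarrow> x \<in> U \<Longrightarrow> act s x \<in> U"
    and act_one: "\<And>x. x \<in> U \<Longrightarrow> act \<one>\<^bsub>S\<^esub> x = x"
    and act_mult: "\<And>s t x. s \<in> carrier S \<Longrightarrow> t \<in> carrier S \<Longrightarrow> x \<in> U
      \<Longrightarrow> act (s \<otimes>\<^bsub>S\<^esub> t) x = act s (act t x)"
  shows "card {x \<in> U. \<forall>s \<in> carrier S. act s x = x} mod p = card U mod p"
proof -
  interpret S: group S by fact
  let ?\<phi> = "\<lambda>s. restrict (act s) U"
  have inv_act: "act (inv\<^bsub>S\<^esub> s) (act s x) = x" "act s (act (inv\<^bsub>S\<^esub> s) x) = x"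
    if "s \<in> carrier S" "x \<in> U" for s x
    using that act_mult[of "inv\<^bsub>S\<^esub> s" s x] act_mult[of s "inv\<^bsub>S\<^esub> s" x] act_one by simp_all
  have bij: "?\<phi> s \<in> Bij U" if "s \<in> carrier S" for s
  proof -
    have "bij_betw (act s) U U"
      by (rule bij_betw_byWitness[of _ "act (inv\<^bsub>S\<^esub> s)"])
        (use that inv_act act_closed S.inv_closed in auto)
    then show ?thesis
      by (simp add: Bij_def cong: bij_betw_cong)
  qed
  interpret A: group_action S U ?\<phi>
    by (intro group_action.intro group_hom.intro group_hom_axioms.intro \<open>group S\<close> group_BijGroup homI)
      (use bij in \<open>auto simp: BijGroup_def compose_def act_mult act_closed intro!: restrict_ext\<close>)
  let ?O = "orbits S U ?\<phi>" and ?F = "{x \<in> U. \<forall>s \<in> carrier S. act s x = x}"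
  have orbit_eq: "orbit S ?\<phi> x = (\<lambda>s. act s x) ` carrier S" if "x \<in> U" for x
    using that by (auto simp: orbit_def)
  have orbit_sub: "orb \<subseteq> U" if "orb \<in> ?O" for orb
    using that act_closed by (auto simp: orbits_def orbit_eq)
  have fin_O: "finite ?O"
    using \<open>finite U\<close> orbit_sub by (meson PowI finite_Pow_iff finite_subset subsetI)
  have dvd: "p dvd card orb \<or> card orb = 1" if orb: "orb \<in> ?O" for orb
  proof -
    obtain x where x: "x \<in> U" "orb = orbit S ?\<phi> x"
      using orb unfolding orbits_def by blast
    then have "card orb dvd p ^ k"
      using A.orbit_stabilizer_theorem[of x] card_S by (metis dvd_triv_left order_def)
    then obtain i where "card orb = p ^ i"
      using divides_primepow_nat p by auto
    then show ?thesis by (cases i) auto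
  qed
  let ?O1 = "{orb \<in> ?O. card orb = 1}"
  have F_eq: "(\<lambda>x. {x}) ` ?F = ?O1"
  proof (intro equalityI subsetI)
    fix orb assume "orb \<in> (\<lambda>x. {x}) ` ?F"
    then obtain x where x: "x \<in> ?F" "orb = {x}" by auto
    then have "orbit S ?\<phi> x = {x}"
      using S.one_closed by (auto simp: orbit_eq)
    then have "orb \<in> ?O"
      unfolding orbits_def using x by auto
    then show "orb \<in> ?O1" using x by auto
  next
    fix orb assume orb: "orb \<in> ?O1"
    then obtain x where x: "x \<in> U" "orb = orbit S ?\<phi> x"
      unfolding orbits_def by blast
    obtain y where y: "orb = {y}"
      using orb by (metis (mono_tags, lifting) card_1_singletonE mem_Collect_eq)
    have "act s x = y" if "s \<in> carrier S" for s
      using x y that by (auto simp: orbit_eq)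
    moreover have "y = x"
      using calculation[of "\<one>\<^bsub>S\<^esub>"] act_one x by simp
    ultimately show "orb \<in> (\<lambda>x. {x}) ` ?F"
      using x y by auto
  qed
  have "card U = (\<Sum>orb\<in>?O. card orb)"
    using A.disjoint_sum[of "\<lambda>_. 1 :: nat"] \<open>finite U\<close> by simp
  also have "\<dots> mod p = (\<Sum>orb\<in>?O. card orb mod p) mod p"
    by (simp add: mod_sum_eq)
  also have "(\<Sum>orb\<in>?O. card orb mod p) = (\<Sum>orb\<in>?O. if card orb = 1 then 1 else 0)"
    by (rule sum.cong) (use dvd prime_gt_1_nat[OF p] in \<open>auto simp flip: dvd_eq_mod_eq_0\<close>)
  also have "(\<Sum>orb\<in>?O. if card orb = 1 then 1 else 0) = card ?O1"
    using fin_O by (simp add: sum.If_cases Int_def)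
  also have "card ?O1 = card ?F"
    unfolding F_eq[symmetric] by (rule card_image) auto
  finally show ?thesis by simp
qed

text \<open>
  This is the case of a cyclic p-group: the integers modulo \<open>p\<^sup>k\<close> act through the powers of \<open>f\<close>.
\<close>

lemma funpow_prime_power_fixed_point:
  assumes "finite U" and p: "Factorial_Ring.prime p" and ndvd: "\<not> p dvd card U"
    and closed: "\<And>x. x \<in> U \<Longrightarrow> f x \<in> U"
    and period: "\<And>x. x \<in> U \<Longrightarrow> (f ^^ (p ^ k)) x = x"
  obtains x where "x \<in> U" "f x = x"
proof -
  let ?n = "p ^ k"
  let ?Z = "integer_mod_group ?n"
  have n: "?n > 0" using p prime_gt_0_nat by auto
  have closed_pow: "(f ^^ m) x \<in> U" if "x \<in> U" for m x
    using that closed by (induction m) auto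
  have period_mult: "(f ^^ (?n * m)) x = x" if "x \<in> U" for m x
    using that by (induction m) (auto simp: funpow_add period)
  have pow_mod: "(f ^^ (m mod ?n)) x = (f ^^ m) x" if "x \<in> U" for m x
  proof -
    have "(f ^^ m) x = (f ^^ (m mod ?n + ?n * (m div ?n))) x" by simp
    also have "\<dots> = (f ^^ (m mod ?n)) x"
      by (subst funpow_add) (simp add: that period_mult)
    finally show ?thesis by simp
  qed
  have "card {x \<in> U. \<forall>s \<in> carrier ?Z. (f ^^ nat s) x = x} mod p = card U mod p"
  proof (rule p_group_fixed_points_cong[OF group_integer_mod_group _ p \<open>finite U\<close>])
    show "card (carrier ?Z) = p ^ k"
      using n by (simp add: carrier_integer_mod_group nat_power_eq)
    fix s t x assume *: "s \<in> carrier ?Z" "t \<in> carrier ?Z" "x \<in> U"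
    have "nat ((s + t) mod int ?n) = (nat s + nat t) mod ?n"
      using * n by (auto simp: carrier_integer_mod_group nat_mod_distrib nat_add_distrib nat_power_eq split: if_splits)
    then show "(f ^^ nat (s \<otimes>\<^bsub>?Z\<^esub> t)) x = (f ^^ nat s) ((f ^^ nat t) x)"
      using * by (simp add: pow_mod funpow_add)
  qed (use closed_pow in auto)
  then have "{x \<in> U. \<forall>s \<in> carrier ?Z. (f ^^ nat s) x = x} \<noteq> {}"
    using ndvd by (metis card.empty mod_0 mod_eq_0_iff_dvd)
  then obtain x where x: "x \<in> U" "\<And>s. s \<in> carrier ?Z \<Longrightarrow> (f ^^ nat s) x = x" by auto
  have "f x = x"
  proof (cases "?n = 1")
    case True
    then show ?thesis using period[OF x(1)] by (simp del: power_eq_1_iff nat_power_eq_Suc_0_iff)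
  next
    case False
    then have "1 \<in> carrier ?Z" using n by (auto simp: carrier_integer_mod_group)
    from x(2)[OF this] show ?thesis by simp
  qed
  then show thesis using that x by auto
qed

section \<open>Conjugation\<close>

definition conj_by :: "('a, 'b) monoid_scheme \<Rightarrow> 'a \<Rightarrow> 'a \<Rightarrow> 'a" where
  "conj_by G g x = inv\<^bsub>G\<^esub> g \<otimes>\<^bsub>G\<^esub> x \<otimes>\<^bsub>G\<^esub> g"

context group
begin

lemma conj_by_closed [simp, intro]: "g \<in> carrier G \<Longrightarrow> x \<in> carrier G \<Longrightarrow> conj_by G g x \<in> carrier G"
  by (simp add: conj_by_def)

lemma conj_by_mult: "g \<in> carrier G \<Longrightarrow> x \<in> carrier G \<Longrightarrow> y \<in> carrier G
    \<Longrightarrow> conj_by G g (x \<otimes> y) = conj_by G g x \<otimes> conj_by G g y"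
  by (simp add: conj_by_def m_assoc)

lemma conj_by_one [simp]: "g \<in> carrier G \<Longrightarrow> conj_by G g \<one> = \<one>"
  by (simp add: conj_by_def)

lemma conj_by_by_one [simp]: "x \<in> carrier G \<Longrightarrow> conj_by G \<one> x = x"
  by (simp add: conj_by_def)

lemma conj_by_inv: "g \<in> carrier G \<Longrightarrow> x \<in> carrier G
    \<Longrightarrow> conj_by G g (inv x) = inv (conj_by G g x)"
  by (simp add: conj_by_def m_assoc inv_mult_group)

lemma conj_by_by_mult: "g \<in> carrier G \<Longrightarrow> h \<in> carrier G \<Longrightarrow> x \<in> carrier G
    \<Longrightarrow> conj_by G (g \<otimes> h) x = conj_by G h (conj_by G g x)"
  by (simp add: conj_by_def m_assoc inv_mult_group)

lemma conj_by_conj_by: "g \<in> carrier G \<Longrightarrow> h \<in> carrier G \<Longrightarrow> x \<in> carrier G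
    \<Longrightarrow> conj_by G h (conj_by G g x) = conj_by G (conj_by G h g) (conj_by G h x)"
  by (simp add: conj_by_def m_assoc inv_mult_group)

lemma conj_by_inv_cancel [simp]: "g \<in> carrier G \<Longrightarrow> x \<in> carrier G \<Longrightarrow> conj_by G (inv g) (conj_by G g x) = x"
  "g \<in> carrier G \<Longrightarrow> x \<in> carrier G \<Longrightarrow> conj_by G g (conj_by G (inv g) x) = x"
  by (simp_all add: conj_by_def m_assoc)

lemma conj_by_inj: "g \<in> carrier G \<Longrightarrow> x \<in> carrier G \<Longrightarrow> y \<in> carrier G
    \<Longrightarrow> conj_by G g x = conj_by G g y \<longleftrightarrow> x = y"
  by (metis conj_by_inv_cancel(1))

lemma conj_by_commute: "g \<in> carrier G \<Longrightarrow> x \<in> carrier G \<Longrightarrow> g \<otimes> x = x \<otimes> g \<Longrightarrow> conj_by G g x = x"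
  by (metis conj_by_def inv_mult_cancel(1) inv_closed m_assoc)

lemma conj_by_fixed_iff: "g \<in> carrier G \<Longrightarrow> x \<in> carrier G \<Longrightarrow> conj_by G g x = x \<longleftrightarrow> g \<otimes> x = x \<otimes> g"
  by (metis conj_by_commute conj_by_def inv_mult_cancel(2) inv_closed m_assoc m_closed)

lemma conj_by_pow: "g \<in> carrier G \<Longrightarrow> x \<in> carrier G \<Longrightarrow> conj_by G g (x [^] (n::nat)) = conj_by G g x [^] n"
  by (induction n) (simp_all add: conj_by_mult)

lemma conj_by_mem_normal: "N \<lhd> G \<Longrightarrow> g \<in> carrier G \<Longrightarrow> x \<in> N \<Longrightarrow> conj_by G g x \<in> N"
  unfolding conj_by_def by (rule normal.inv_op_closed1)

lemma subgroup_conj_by_mem: "subgroup N G \<Longrightarrow> g \<in> N \<Longrightarrow> x \<in> N \<Longrightarrow> conj_by G g x \<in> N"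
  by (simp add: conj_by_def subgroup.m_closed subgroup.m_inv_closed)

text \<open>
  The map \<open>m \<mapsto> v\<^sup>-\<^sup>1 m u\<close> permutes \<open>M\<close>, its order divides \<open>p\<^sup>k\<close>, and a fixed point \<open>m\<close> satisfies \<open>m u = v m\<close>.
  This replaces the conjugacy of the Sylow subgroups of \<open>M \<langle>v\<rangle>\<close>.
\<close>

lemma prime_power_elements_conjugate:
  assumes "finite M" "subgroup M G" and p: "Factorial_Ring.prime p" and ndvd: "\<not> p dvd card M"
    and u: "u \<in> carrier G" "u [^] (p ^ k) = \<one>"
    and v: "v \<in> carrier G" "v [^] (p ^ k) = \<one>"
    and norm: "\<And>m. m \<in> M \<Longrightarrow> conj_by G v m \<in> M" and mem: "inv v \<otimes> u \<in> M"
  obtains m where "m \<in> M" "u = conj_by G m v"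
proof -
  interpret M: subgroup M G by fact
  let ?f = "\<lambda>m. inv v \<otimes> m \<otimes> u"
  have "?f m \<in> M" if "m \<in> M" for m
  proof -
    have "?f m = conj_by G v m \<otimes> (inv v \<otimes> u)"
      using that u v by (simp add: conj_by_def m_assoc)
    then show ?thesis using that norm mem by simp
  qed
  moreover have "(?f ^^ n) m = inv (v [^] n) \<otimes> m \<otimes> u [^] n" if "m \<in> M" for m n
  proof (induction n)
    case (Suc n)
    then have "(?f ^^ Suc n) m = (inv v \<otimes> inv (v [^] n)) \<otimes> m \<otimes> (u [^] n \<otimes> u)"
      using that u v by (simp add: m_assoc)
    then show ?case
      using u v by (simp add: inv_mult_group)
  qed (use that in auto)
  then have "(?f ^^ (p ^ k)) m = m" if "m \<in> M" for m
    using that u v by simp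
  ultimately obtain m where m: "m \<in> M" "?f m = m"
    using funpow_prime_power_fixed_point[OF \<open>finite M\<close> p ndvd, of ?f k] by blast
  have "m \<otimes> u = v \<otimes> m"
    using m u v by (metis M.mem_carrier inv_mult_cancel(2) inv_closed m_assoc m_closed)
  then have "u = conj_by G m v"
    using m u v by (metis M.mem_carrier conj_by_def inv_mult_cancel(1) inv_closed m_assoc)
  then show thesis using that m by blast
qed

end


section \<open>Complements of abelian normal subgroups\<close>

context group
begin

lemma card_set_mult_subgroups:
  assumes "finite (carrier G)" "subgroup A G" "subgroup B G"
  shows "card (A <#> B) * card (A \<inter> B) = card A * card B"
proof -
  interpret A: subgroup A G by fact
  interpret B: subgroup B G by fact
  let ?f = "\<lambda>(a, b). a \<otimes> b"
  have fin: "finite A" "finite B"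
    using assms(1) A.subset B.subset by (auto intro: finite_subset)
  have image: "?f ` (A \<times> B) = A <#> B"
    by (auto simp: set_mult_def)
  have fibre: "card {x \<in> A \<times> B. ?f x = y} = card (A \<inter> B)" if y: "y \<in> A <#> B" for y
  proof -
    obtain a b where ab: "a \<in> A" "b \<in> B" "y = a \<otimes> b"
      using y by (auto simp: set_mult_def)
    define h where "h z = (a \<otimes> z, inv z \<otimes> b)" for z
    define w where "w x = inv a \<otimes> fst x" for x :: "'a \<times> 'a"
    have w: "w (u, v) \<in> A \<inter> B" "h (w (u, v)) = (u, v)" if uv: "u \<in> A" "v \<in> B" "u \<otimes> v = y" for u v
    proof -
      have "inv a \<otimes> u = b \<otimes> inv v"
        using ab uv by (metis A.mem_carrier B.mem_carrier inv_closed inv_mult_cancel(1) inv_solve_right m_assoc m_closed)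
      then show "w (u, v) \<in> A \<inter> B"
        unfolding w_def using ab uv by (metis A.m_closed A.m_inv_closed B.m_closed B.m_inv_closed IntI fst_conv)
      have "inv (inv a \<otimes> u) \<otimes> b = inv u \<otimes> (a \<otimes> b)"
        using ab uv by (simp add: inv_mult_group m_assoc)
      also have "\<dots> = v"
        using ab uv by (metis A.mem_carrier B.mem_carrier inv_mult_cancel(1))
      finally show "h (w (u, v)) = (u, v)"
        using ab uv by (simp add: h_def w_def)
    qed
    have "bij_betw h (A \<inter> B) {x \<in> A \<times> B. ?f x = y}"
    proof (rule bij_betw_byWitness[of _ w])
      show "\<forall>x \<in> {x \<in> A \<times> B. ?f x = y}. h (w x) = x" using w(2) by auto
      show "w ` {x \<in> A \<times> B. ?f x = y} \<subseteq> A \<inter> B" using w(1) by auto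
    qed (use ab in \<open>auto simp: h_def w_def m_assoc\<close>)
    from bij_betw_same_card[OF this] show ?thesis by simp
  qed
  have "card A * card B = (\<Sum>x\<in>A \<times> B. 1)"
    using fin by (simp add: card_cartesian_product)
  also have "\<dots> = (\<Sum>y\<in>A <#> B. \<Sum>x\<in>{x \<in> A \<times> B. ?f x = y}. 1)"
    unfolding image[symmetric] by (rule sum.image_gen) (use fin in simp)
  also have "\<dots> = card (A <#> B) * card (A \<inter> B)"
    using fibre by simp
  finally show ?thesis by simp
qed

text \<open>
  Choose a transversal \<open>t\<close> of the cosets of \<open>N\<close>. The product \<open>d x\<close> of all \<open>x t(\<sigma>) t(x \<sigma>)\<^sup>-\<^sup>1 \<in> N\<close> is a crossed
  homomorphism from \<open>G\<close> to \<open>N\<close>, and it is \<open>n \<mapsto> n\<^sup>k\<close> on \<open>N\<close>, where \<open>k\<close> is the index of \<open>N\<close>. This power map is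
  bijective, so that the kernel of \<open>d\<close> is a complement.
\<close>

lemma abelian_normal_subgroup_complement:
  assumes fin: "finite (carrier G)" and "N \<lhd> G"
    and comm: "\<And>x y. x \<in> N \<Longrightarrow> y \<in> N \<Longrightarrow> x \<otimes> y = y \<otimes> x"
    and cop: "coprime (card N) (order G div card N)"
  obtains K where "subgroup K G" "N \<inter> K = {\<one>}" "carrier G = N <#> K"
proof -
  interpret N: normal N G by fact
  let ?C = "G\<lparr>carrier := N\<rparr>" and ?R = "rcosets N"
  interpret C: comm_group ?C
    using N.subgroup_is_group[OF is_group] comm
    by (intro group.group_comm_groupI) auto
  have finN: "finite N" and finR: "finite ?R"
    using fin finite_subset[OF N.subset] by (auto simp: RCOSETS_def)
  define t where "t \<sigma> = (SOME x. x \<in> \<sigma>)" for \<sigma> :: "'a set"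
  have t: "t \<sigma> \<in> \<sigma>" "t \<sigma> \<in> carrier G" "N #> t \<sigma> = \<sigma>" if \<sigma>: "\<sigma> \<in> ?R" for \<sigma>
  proof -
    obtain x where x: "x \<in> carrier G" "\<sigma> = N #> x"
      using \<sigma> by (auto simp: RCOSETS_def)
    then show "t \<sigma> \<in> \<sigma>"
      unfolding t_def using rcos_self[OF x(1) N.subgroup_axioms] by (metis someI_ex)
    then show "t \<sigma> \<in> carrier G" "N #> t \<sigma> = \<sigma>"
      using x r_coset_subset_G[OF N.subset x(1)] repr_independence[OF _ x(1) N.subgroup_axioms, of "t \<sigma>"]
      by auto
  qed
  define act where "act x \<sigma> = N #> (x \<otimes> t \<sigma>)" for x \<sigma>
  have act_closed: "act x \<sigma> \<in> ?R" if "x \<in> carrier G" "\<sigma> \<in> ?R" for x \<sigma>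
    using that t(2)[OF that(2)] by (simp add: act_def rcosetsI N.subset)
  have coset_eqI: "N #> x = N #> y" if "x \<in> carrier G" "y \<in> carrier G" "x \<otimes> inv y \<in> N" for x y
  proof -
    have "x = (x \<otimes> inv y) \<otimes> y" using that by (simp add: m_assoc)
    then have "x \<in> N #> y" unfolding r_coset_def using that(3) by blast
    then show ?thesis using repr_independence[OF _ that(2) N.subgroup_axioms] by simp
  qed
  have coset_eqD: "x \<otimes> inv y \<in> N" if "x \<in> carrier G" "y \<in> carrier G" "N #> x = N #> y" for x y
  proof -
    have "x \<in> N #> y" using rcos_self[OF that(1) N.subgroup_axioms] that(3) by simp
    then obtain n where "n \<in> N" "x = n \<otimes> y" unfolding r_coset_def by blast
    then show ?thesis using that by (simp add: m_assoc)
  qed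
  have act_mult: "act (x \<otimes> y) \<sigma> = act x (act y \<sigma>)"
    if "x \<in> carrier G" "y \<in> carrier G" "\<sigma> \<in> ?R" for x y \<sigma>
  proof -
    have \<tau>: "act y \<sigma> \<in> ?R" using that act_closed by simp
    have "N #> (y \<otimes> t \<sigma>) = N #> t (act y \<sigma>)"
      by (subst t(3)[OF \<tau>]) (simp add: act_def)
    then have "(y \<otimes> t \<sigma>) \<otimes> inv (t (act y \<sigma>)) \<in> N"
      using t(2)[OF \<tau>] t(2)[OF that(3)] that by (intro coset_eqD) auto
    then have "x \<otimes> ((y \<otimes> t \<sigma>) \<otimes> inv (t (act y \<sigma>))) \<otimes> inv x \<in> N"
      using that by (simp add: N.inv_op_closed2)
    then have "(x \<otimes> y \<otimes> t \<sigma>) \<otimes> inv (x \<otimes> t (act y \<sigma>)) \<in> N"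
      using that t(2)[OF \<tau>] t(2)[OF that(3)] by (simp add: m_assoc inv_mult_group)
    then have "N #> (x \<otimes> y \<otimes> t \<sigma>) = N #> (x \<otimes> t (act y \<sigma>))"
      using that t(2)[OF \<tau>] t(2)[OF that(3)] by (intro coset_eqI) auto
    then show ?thesis by (simp add: act_def)
  qed
  have act_N: "act n \<sigma> = \<sigma>" if "n \<in> N" "\<sigma> \<in> ?R" for n \<sigma>
    using coset_eqI[of "n \<otimes> t \<sigma>" "t \<sigma>"] t(2,3)[OF that(2)] that by (simp add: act_def m_assoc)
  have act_bij: "bij_betw (act x) ?R ?R" if "x \<in> carrier G" for x
    by (rule bij_betw_byWitness[of _ "act (inv x)"])
      (use that act_closed act_N act_mult[of "inv x" x] act_mult[of x "inv x"] in auto)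
  define f where "f x \<sigma> = x \<otimes> t \<sigma> \<otimes> inv (t (act x \<sigma>))" for x \<sigma>
  have f: "f x \<sigma> \<in> N" if "x \<in> carrier G" "\<sigma> \<in> ?R" for x \<sigma>
  proof -
    have "N #> (x \<otimes> t \<sigma>) = N #> t (act x \<sigma>)"
      by (subst t(3)[OF act_closed[OF that]]) (simp add: act_def)
    then show ?thesis
      unfolding f_def using t(2)[OF that(2)] t(2)[OF act_closed[OF that]] that by (intro coset_eqD) auto
  qed
  define d where "d x = finprod ?C (f x) ?R" for x
  have d_closed: "d x \<in> N" if "x \<in> carrier G" for x
    unfolding d_def using C.finprod_closed[of "f x" ?R] f that by auto
  have conj_prod: "finprod ?C (\<lambda>\<sigma>. x \<otimes> g \<sigma> \<otimes> inv x) A = x \<otimes> finprod ?C g A \<otimes> inv x"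
    if "x \<in> carrier G" "finite A" "\<And>\<sigma>. \<sigma> \<in> A \<Longrightarrow> g \<sigma> \<in> N" for x g and A :: "'a set set"
    using that(2,3)
  proof (induction A rule: finite_induct)
    case (insert \<sigma> A)
    have "finprod ?C g A \<in> N"
      using C.finprod_closed[of g A] insert by auto
    moreover have "finprod ?C (\<lambda>\<sigma>. x \<otimes> g \<sigma> \<otimes> inv x) (insert \<sigma> A)
        = (x \<otimes> g \<sigma> \<otimes> inv x) \<otimes> finprod ?C (\<lambda>\<sigma>. x \<otimes> g \<sigma> \<otimes> inv x) A"
      using C.finprod_insert[of A \<sigma> "\<lambda>\<sigma>. x \<otimes> g \<sigma> \<otimes> inv x"] insert that(1)
      by (auto simp: N.inv_op_closed2)
    moreover have "finprod ?C g (insert \<sigma> A) = g \<sigma> \<otimes> finprod ?C g A"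
      using C.finprod_insert[of A \<sigma> g] insert by auto
    ultimately show ?case
      using insert that(1) by (simp add: m_assoc)
  qed (use that(1) in simp)
  have d_mult: "d (x \<otimes> y) = x \<otimes> d y \<otimes> inv x \<otimes> d x" if "x \<in> carrier G" "y \<in> carrier G" for x y
  proof -
    have "f (x \<otimes> y) \<sigma> = (x \<otimes> f y \<sigma> \<otimes> inv x) \<otimes> f x (act y \<sigma>)" if \<sigma>: "\<sigma> \<in> ?R" for \<sigma>
      using \<sigma> \<open>x \<in> carrier G\<close> \<open>y \<in> carrier G\<close> t(2)[OF \<sigma>]
        t(2)[OF act_closed] act_closed
      by (simp add: f_def act_mult m_assoc inv_mult_group)
    then have "d (x \<otimes> y) = finprod ?C (\<lambda>\<sigma>. (x \<otimes> f y \<sigma> \<otimes> inv x) \<otimes> f x (act y \<sigma>)) ?R"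
      unfolding d_def by (intro C.finprod_cong') (use f that act_closed N.inv_op_closed2 in auto)
    also have "\<dots> = finprod ?C (\<lambda>\<sigma>. x \<otimes> f y \<sigma> \<otimes> inv x) ?R \<otimes> finprod ?C (\<lambda>\<sigma>. f x (act y \<sigma>)) ?R"
      using C.finprod_multf[of "\<lambda>\<sigma>. x \<otimes> f y \<sigma> \<otimes> inv x" ?R "\<lambda>\<sigma>. f x (act y \<sigma>)"] f that act_closed
        N.inv_op_closed2 by auto
    also have "finprod ?C (\<lambda>\<sigma>. x \<otimes> f y \<sigma> \<otimes> inv x) ?R = x \<otimes> d y \<otimes> inv x"
      unfolding d_def using conj_prod[OF that(1) finR] f that by simp
    also have "finprod ?C (\<lambda>\<sigma>. f x (act y \<sigma>)) ?R = finprod ?C (f x) (act y ` ?R)"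
      using act_bij[OF that(2)] f[OF that(1)] act_closed[OF that(2)]
      by (intro C.finprod_reindex[symmetric]) (auto simp: bij_betw_def)
    also have "\<dots> = d x"
      using act_bij[OF that(2)] by (simp add: d_def bij_betw_def)
    finally show ?thesis .
  qed
  let ?k = "card ?R"
  have k: "coprime (card N) ?k"
    using cop lagrange[OF N.subgroup_axioms] finN N.one_closed
    by (metis card_gt_0_iff empty_iff nonzero_mult_div_cancel_right less_numeral_extra(3))
  have d_N: "d n = n [^] ?k" if "n \<in> N" for n
  proof -
    have "d n = finprod ?C (\<lambda>_. n) ?R"
      unfolding d_def using that t act_N
      by (intro C.finprod_cong') (auto simp: f_def m_assoc)
    also have "\<dots> = n [^] ?k"
      using C.finprod_const[of n ?R] that by (simp flip: nat_pow_consistent)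
    finally show ?thesis .
  qed
  have pow_card: "n [^] card N = \<one>" if "n \<in> N" for n
    using C.pow_order_eq_1[of n] that by (simp add: order_def flip: nat_pow_consistent)
  have "?k \<noteq> 0"
    using finR N.subgroup_in_rcosets[OF is_group] by auto
  then obtain e y where e: "?k * e = card N * y + 1"
    using bezout_nat[of ?k "card N"] k by (auto simp: coprime_iff_gcd_eq_1 gcd.commute)
  have pow_ke: "n [^] (?k * e) = n" if "n \<in> N" for n
  proof -
    have "n [^] (?k * e) = (n [^] card N) [^] y \<otimes> n"
      unfolding e using that by (simp add: nat_pow_pow)
    then show ?thesis using pow_card that by simp
  qed
  define K where "K = {x \<in> carrier G. d x = \<one>}"
  have "subgroup K G"
  proof (rule subgroupI)
    have "d \<one> = \<one>" using d_N[of \<one>] by simp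
    then show "K \<noteq> {}" by (auto simp: K_def)
    fix x assume x: "x \<in> K"
    have "\<one> = d (inv x \<otimes> x)" using x \<open>d \<one> = \<one>\<close> by (simp add: K_def)
    also have "\<dots> = inv x \<otimes> d x \<otimes> x \<otimes> d (inv x)"
      using x d_mult[of "inv x" x] by (simp add: K_def)
    also have "\<dots> = d (inv x)"
      using x d_closed[of "inv x"] by (simp add: K_def)
    finally show "inv x \<in> K" using x by (simp add: K_def)
    fix y assume y: "y \<in> K"
    then show "x \<otimes> y \<in> K" using x d_mult[of x y] by (simp add: K_def)
  qed (auto simp: K_def)
  moreover have "N \<inter> K = {\<one>}"
  proof (intro equalityI subsetI)
    fix n assume "n \<in> N \<inter> K"
    then have "n \<in> N" "n [^] ?k = \<one>" using d_N by (auto simp: K_def)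
    then have "n [^] (?k * e) = \<one>" by (simp flip: nat_pow_pow)
    then show "n \<in> {\<one>}" using pow_ke \<open>n \<in> N\<close> by simp
  qed (use \<open>subgroup K G\<close> in \<open>auto simp: subgroup.one_closed\<close>)
  moreover have "carrier G = N <#> K"
  proof (intro equalityI subsetI)
    fix x assume x: "x \<in> carrier G"
    define n where "n = inv (d x) [^] e"
    have dx: "inv (d x) \<in> N" "d x \<in> N" using d_closed[OF x] by auto
    have n: "n \<in> N" unfolding n_def using C.nat_pow_closed[of "inv (d x)" e] dx by (simp flip: nat_pow_consistent)
    have "n [^] ?k = inv (d x)"
      unfolding n_def using pow_ke[OF dx(1)] dx by (simp add: nat_pow_pow mult.commute)
    then have "d (n \<otimes> x) = n \<otimes> d x \<otimes> inv n \<otimes> inv (d x)"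
      using d_mult[of n x] x n d_N by simp
    also have "n \<otimes> d x = d x \<otimes> n" using comm n dx by simp
    finally have "n \<otimes> x \<in> K" using n x dx by (simp add: K_def m_assoc)
    moreover have "x = inv n \<otimes> (n \<otimes> x)" using n x by simp
    ultimately show "x \<in> N <#> K" unfolding set_mult_def using n by blast
  qed (auto simp: set_mult_def K_def)
  ultimately show thesis using that by blast
qed

end


section \<open>Complements of normal Hall subgroups\<close>

lemma (in group) inv_commute:
  assumes "x \<in> carrier G" "y \<in> carrier G" "x \<otimes> y = y \<otimes> x"
  shows "y \<otimes> inv x = inv x \<otimes> y"
proof -
  have "inv x \<otimes> y = inv x \<otimes> (y \<otimes> x) \<otimes> inv x" using assms(1,2) by (simp add: m_assoc)
  also have "\<dots> = inv x \<otimes> (x \<otimes> y) \<otimes> inv x" using assms(3) by simp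
  also have "\<dots> = y \<otimes> inv x" using assms(1,2) by simp
  finally show ?thesis by simp
qed

lemma (in group_hom) card_image_mult_card_kernel:
  assumes A: "subgroup A G"
  shows "card (h ` A) * card {x \<in> A. h x = \<one>\<^bsub>H\<^esub>} = card A"
proof -
  interpret hA: group_hom "G\<lparr>carrier := A\<rparr>" "H\<lparr>carrier := h ` A\<rparr>" h
    by (rule induced_group_hom[OF A])
  let ?k = "kernel (G\<lparr>carrier := A\<rparr>) (H\<lparr>carrier := h ` A\<rparr>) h"
  have "card (carrier (G\<lparr>carrier := A\<rparr> Mod ?k)) = card (h ` A)"
    using iso_same_card[OF hA.FactGroup_iso] by simp
  moreover have "card (rcosets\<^bsub>G\<lparr>carrier := A\<rparr>\<^esub> ?k) * card ?k = card A"
    using hA.G.lagrange[OF hA.subgroup_kernel] by (simp add: order_def)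
  ultimately show ?thesis
    by (simp add: FactGroup_def kernel_def)
qed

lemma (in group_hom) vimage_of_complement:
  assumes N: "N \<subseteq> carrier G" and surj: "h ` carrier G = carrier H"
    and K: "subgroup K H" "h ` N \<inter> K = {\<one>\<^bsub>H\<^esub>}" "carrier H = h ` N <#>\<^bsub>H\<^esub> K"
  shows "subgroup {x \<in> carrier G. h x \<in> K} G"
    and "N \<inter> {x \<in> carrier G. h x \<in> K} = {x \<in> N. h x = \<one>\<^bsub>H\<^esub>}"
    and "carrier G = N <#> {x \<in> carrier G. h x \<in> K}"
proof -
  interpret K: subgroup K H by fact
  show "subgroup {x \<in> carrier G. h x \<in> K} G"
  proof (rule G.subgroupI)
    show "{x \<in> carrier G. h x \<in> K} \<noteq> {}" using K.one_closed hom_one G.one_closed by (metis (mono_tags, lifting) empty_iff mem_Collect_eq)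
  qed auto
  show "N \<inter> {x \<in> carrier G. h x \<in> K} = {x \<in> N. h x = \<one>\<^bsub>H\<^esub>}"
    using K(2) N K.one_closed by (auto simp: subset_iff)
  show "carrier G = N <#> {x \<in> carrier G. h x \<in> K}"
  proof (intro equalityI subsetI)
    fix x assume x: "x \<in> carrier G"
    have "h x \<in> h ` N <#>\<^bsub>H\<^esub> K" using K(3)[THEN equalityD1, THEN subsetD, OF hom_closed[OF x]] .
    then obtain n k where nk: "n \<in> N" "k \<in> K" "h x = h n \<otimes>\<^bsub>H\<^esub> k" unfolding set_mult_def by blast
    then have n: "n \<in> carrier G" using N by auto
    have "h (inv n \<otimes> x) = k"
      using x n nk by simp
    then have "inv n \<otimes> x \<in> {x \<in> carrier G. h x \<in> K}" using nk n x by simp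
    moreover have "x = n \<otimes> (inv n \<otimes> x)" using n x by simp
    ultimately show "x \<in> N <#> {x \<in> carrier G. h x \<in> K}" using nk unfolding set_mult_def by blast
  qed (use N in \<open>auto simp: set_mult_def\<close>)
qed

text \<open>
  The induction for the Schur-Zassenhaus theorem passes to quotients. A quotient group has sets as
  elements, so it is copied to the natural numbers to keep the type fixed.
\<close>

lemma (in normal) quotient_on_nat:
  assumes fin: "finite (carrier G)"
  obtains Q :: "nat monoid" and h where "group_hom G Q h" "h ` carrier G = carrier Q"
    "finite (carrier Q)" "order Q * card H = order G" "\<And>x. x \<in> carrier G \<Longrightarrow> h x = \<one>\<^bsub>Q\<^esub> \<longleftrightarrow> x \<in> H"
proof -
  interpret F: group "G Mod H" by (rule factorgroup_is_group)
  have finF: "finite (carrier (G Mod H))"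
    using fin by (simp add: carrier_FactGroup)
  then obtain e :: "'a set \<Rightarrow> nat" where e: "inj_on e (carrier (G Mod H))"
    using finite_imp_inj_to_nat_seg by metis
  define g where "g = the_inv_into (carrier (G Mod H)) e"
  have g: "g (e x) = x" if "x \<in> carrier (G Mod H)" for x
    using that e by (simp add: g_def the_inv_into_f_f)
  define Q :: "nat monoid" where "Q = \<lparr>carrier = e ` carrier (G Mod H),
    monoid.mult = \<lambda>x y. e (g x \<otimes>\<^bsub>G Mod H\<^esub> g y), monoid.one = e \<one>\<^bsub>G Mod H\<^esub>\<rparr>"
  have hom_e: "e (x \<otimes>\<^bsub>G Mod H\<^esub> y) = e x \<otimes>\<^bsub>Q\<^esub> e y"
    if "x \<in> carrier (G Mod H)" "y \<in> carrier (G Mod H)" for x y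
    using that by (simp add: Q_def g)
  have "group Q"
  proof (rule groupI)
    fix x assume x: "x \<in> carrier Q"
    then obtain a where a: "a \<in> carrier (G Mod H)" "x = e a" by (auto simp: Q_def)
    have "e (inv\<^bsub>G Mod H\<^esub> a) \<otimes>\<^bsub>Q\<^esub> x = \<one>\<^bsub>Q\<^esub>"
      using a F.inv_closed[OF a(1)] F.l_inv[OF a(1)] by (simp add: Q_def g del: mult_FactGroup one_FactGroup)
    moreover have "e (inv\<^bsub>G Mod H\<^esub> a) \<in> carrier Q"
      using F.inv_closed[OF a(1)] by (simp add: Q_def)
    ultimately show "\<exists>y \<in> carrier Q. y \<otimes>\<^bsub>Q\<^esub> x = \<one>\<^bsub>Q\<^esub>" by blast
    show "\<one>\<^bsub>Q\<^esub> \<otimes>\<^bsub>Q\<^esub> x = x"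
      using a F.one_closed F.l_one[OF a(1)] by (simp add: Q_def g del: mult_FactGroup one_FactGroup)
    fix y assume y: "y \<in> carrier Q"
    then obtain b where b: "b \<in> carrier (G Mod H)" "y = e b" by (auto simp: Q_def)
    have ab: "x \<otimes>\<^bsub>Q\<^esub> y = e (a \<otimes>\<^bsub>G Mod H\<^esub> b)" using a b hom_e by simp
    then show "x \<otimes>\<^bsub>Q\<^esub> y \<in> carrier Q" using F.m_closed[OF a(1) b(1)] by (simp add: Q_def)
    fix z assume z: "z \<in> carrier Q"
    then obtain c where c: "c \<in> carrier (G Mod H)" "z = e c" by (auto simp: Q_def)
    show "x \<otimes>\<^bsub>Q\<^esub> y \<otimes>\<^bsub>Q\<^esub> z = x \<otimes>\<^bsub>Q\<^esub> (y \<otimes>\<^bsub>Q\<^esub> z)"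
      using a b c F.m_assoc[OF a(1) b(1) c(1)] F.m_closed hom_e[symmetric] by metis
  qed (use F.one_closed in \<open>auto simp: Q_def\<close>)
  define h where "h x = e (H #> x)" for x
  have carr: "H #> x \<in> carrier (G Mod H)" if "x \<in> carrier G" for x
    using that by (auto simp: carrier_FactGroup)
  have "h \<in> hom G Q"
  proof (rule homI)
    show "h x \<in> carrier Q" if "x \<in> carrier G" for x
      using carr[OF that] by (simp add: h_def Q_def)
    show "h (x \<otimes> y) = h x \<otimes>\<^bsub>Q\<^esub> h y" if "x \<in> carrier G" "y \<in> carrier G" for x y
      using hom_e[OF carr carr, OF that] that by (simp add: h_def rcos_sum)
  qed
  then have "group_hom G Q h"
    by (intro group_hom.intro group_hom_axioms.intro \<open>group Q\<close>) (rule is_group)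
  moreover have "h ` carrier G = carrier Q"
    by (auto simp: h_def Q_def carrier_FactGroup)
  moreover have "finite (carrier Q)" using finF by (simp add: Q_def)
  moreover have "order Q * card H = order G"
  proof -
    have "order Q = card (carrier (G Mod H))" using e by (simp add: order_def Q_def card_image)
    then show ?thesis using lagrange[OF subgroup_axioms] by (simp add: FactGroup_def)
  qed
  moreover have "h x = \<one>\<^bsub>Q\<^esub> \<longleftrightarrow> x \<in> H" if "x \<in> carrier G" for x
  proof -
    have "h x = \<one>\<^bsub>Q\<^esub> \<longleftrightarrow> H #> x = H"
      using e carr[OF that] F.one_closed by (simp add: h_def Q_def inj_on_eq_iff)
    also have "\<dots> \<longleftrightarrow> x \<in> H"
      using that coset_join1[OF _ that subgroup_axioms] coset_join2[OF that subgroup_axioms] by blast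
    finally show ?thesis .
  qed
  ultimately show thesis using that by blast
qed

context group
begin

text \<open>
  The p-group \<open>T\<close> acts on the cosets of \<open>S\<close>. Their number is prime to \<open>p\<close>, hence some coset \<open>S x\<close> is fixed.
\<close>

lemma p_subgroup_conjugate_into:
  assumes fin: "finite (carrier G)" and p: "Factorial_Ring.prime p"
    and S: "subgroup S G" and index: "\<not> p dvd card (rcosets S)"
    and T: "subgroup T G" and card_T: "card T = p ^ k"
  obtains x where "x \<in> carrier G" "\<And>s. s \<in> T \<Longrightarrow> x \<otimes> s \<otimes> inv x \<in> S"
proof -
  interpret S: subgroup S G by fact
  interpret T: subgroup T G by fact
  let ?T = "G\<lparr>carrier := T\<rparr>"
  let ?act = "\<lambda>s C. C #> inv s"
  have "card {C \<in> rcosets S. \<forall>s \<in> carrier ?T. ?act s C = C} mod p = card (rcosets S) mod p"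
  proof (rule p_group_fixed_points_cong[OF T.subgroup_is_group[OF is_group] _ p])
    show "finite (rcosets S)" using fin by (simp add: RCOSETS_def)
    fix s C assume "s \<in> carrier ?T" "C \<in> rcosets S"
    then show "?act s C \<in> rcosets S"
      using S.subset by (auto simp: RCOSETS_def coset_mult_assoc)
  next
    fix C assume "C \<in> rcosets S"
    then show "?act \<one>\<^bsub>?T\<^esub> C = C"
      using S.subset by (auto simp: RCOSETS_def r_coset_subset_G)
  next
    fix s t C assume "s \<in> carrier ?T" "t \<in> carrier ?T" "C \<in> rcosets S"
    then show "?act (s \<otimes>\<^bsub>?T\<^esub> t) C = ?act s (?act t C)"
      using S.subset by (auto simp: RCOSETS_def coset_mult_assoc inv_mult_group m_assoc)
  qed (use card_T in simp)
  then have "card {C \<in> rcosets S. \<forall>s \<in> carrier ?T. ?act s C = C} \<noteq> 0"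
    using index by (metis mod_0 mod_eq_0_iff_dvd)
  then have "{C \<in> rcosets S. \<forall>s \<in> carrier ?T. ?act s C = C} \<noteq> {}"
    by (metis card.empty)
  then obtain x where x: "x \<in> carrier G" "\<And>s. s \<in> T \<Longrightarrow> (S #> x) #> inv s = S #> x"
    unfolding RCOSETS_def by auto
  have "x \<otimes> s \<otimes> inv x \<in> S" if s: "s \<in> T" for s
  proof -
    have "S #> (x \<otimes> s) = S #> x"
      using x(2)[of "inv s"] s x(1) S.subset by (simp add: coset_mult_assoc)
    then have "x \<otimes> s \<in> S #> x"
      using rcos_self[of "x \<otimes> s" S] x s S.subgroup_axioms by simp
    then obtain y where "y \<in> S" "x \<otimes> s = y \<otimes> x" unfolding r_coset_def by blast
    then show ?thesis using x(1) by (simp add: m_assoc)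
  qed
  then show thesis using that x by blast
qed

lemma p_subgroup_centre_nontrivial:
  assumes fin: "finite (carrier G)" and p: "Factorial_Ring.prime p"
    and S: "subgroup S G" "card S = p ^ k" "S \<noteq> {\<one>}"
  obtains z where "z \<in> S" "z \<noteq> \<one>" "\<And>s. s \<in> S \<Longrightarrow> s \<otimes> z = z \<otimes> s"
proof -
  interpret S: subgroup S G by fact
  let ?S = "G\<lparr>carrier := S\<rparr>" and ?act = "\<lambda>s x. s \<otimes> x \<otimes> inv s"
  let ?Z = "{x \<in> S. \<forall>s \<in> carrier ?S. ?act s x = x}"
  have finS: "finite S" using fin S.subset finite_subset by blast
  have "card ?Z mod p = card S mod p"
    by (rule p_group_fixed_points_cong[OF S.subgroup_is_group[OF is_group] _ p finS])
      (use S in \<open>auto simp: m_assoc inv_mult_group\<close>)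
  moreover have "k \<noteq> 0"
    using S finS S.one_closed by (metis card_1_singletonE power_0 singletonD)
  ultimately have "p dvd card ?Z"
    using S by (simp add: mod_eq_0_iff_dvd)
  moreover have "\<one> \<in> ?Z" by simp
  ultimately have "?Z \<noteq> {\<one>}"
    using prime_gt_1_nat[OF p] by (metis is_singletonI is_singleton_altdef nat_dvd_1_iff_1 less_irrefl)
  then obtain z where z: "z \<in> S" "z \<noteq> \<one>" "\<And>s. s \<in> S \<Longrightarrow> s \<otimes> z \<otimes> inv s = z"
    using \<open>\<one> \<in> ?Z\<close> by auto
  have "s \<otimes> z = z \<otimes> s" if "s \<in> S" for s
    using z(1) z(3)[OF that] that by (metis S.mem_carrier inv_closed inv_solve_right m_closed)
  then show thesis using that z by blast
qed


definition sylow_subgroup :: "nat \<Rightarrow> 'a set \<Rightarrow> bool" where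
  "sylow_subgroup p S \<longleftrightarrow> subgroup S G \<and> (\<exists>k. card S = p ^ k) \<and> \<not> p dvd card (rcosets S)"

lemma sylow_subgroup_exists:
  assumes fin: "finite (carrier G)" and p: "Factorial_Ring.prime p"
  obtains S where "sylow_subgroup p S" "p dvd order G \<Longrightarrow> S \<noteq> {\<one>}"
proof -
  have "order G \<noteq> 0" using fin order_gt_0_iff_finite by simp
  then obtain m where m: "order G = p ^ multiplicity p (order G) * m" "\<not> p dvd m"
    using multiplicity_decompose' p by (metis not_prime_unit)
  then obtain S where S: "subgroup S G" "card S = p ^ multiplicity p (order G)"
    using sylow_thm[OF p is_group m(1) fin] by blast
  have "card (rcosets S) = m"
    using lagrange[OF S(1)] m(1) S(2) p by (metis mult.commute mult_cancel2 power_eq_0_iff not_prime_0)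
  moreover have "p dvd card S" if "p dvd order G"
    using that S(2) p \<open>order G \<noteq> 0\<close> by (simp add: prime_multiplicity_gt_zero_iff)
  then have "S \<noteq> {\<one>}" if "p dvd order G" using that p by auto
  ultimately show thesis using that S m(2) by (auto simp: sylow_subgroup_def)
qed

lemma normalizer_of_subgroup:
  assumes "finite (carrier G)" "S \<subseteq> carrier G"
  shows "subgroup {g \<in> carrier G. \<forall>s \<in> S. conj_by G g s \<in> S} G"
proof (rule subgroupI)
  let ?L = "{g \<in> carrier G. \<forall>s \<in> S. conj_by G g s \<in> S}"
  show "?L \<noteq> {}" using assms(2) by (auto intro!: exI[of _ \<one>])
  fix g assume g: "g \<in> ?L"
  have "inj_on (conj_by G g) S"
    using g assms(2) conj_by_inj by (auto simp: inj_on_def subset_iff)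
  then have "conj_by G g ` S = S"
    using g endo_inj_surj[of S "conj_by G g"] finite_subset[OF assms(2,1)] by auto
  then have "conj_by G (inv g) s \<in> S" if s: "s \<in> S" for s
  proof -
    obtain r where "r \<in> S" "s = conj_by G g r" using \<open>conj_by G g ` S = S\<close> s by (metis imageE)
    then show ?thesis using g assms(2) by auto
  qed
  then show "inv g \<in> ?L" using g by simp
  fix h assume h: "h \<in> ?L"
  then show "g \<otimes> h \<in> ?L" using g assms(2) by (auto simp: conj_by_by_mult subset_iff)
qed auto

text \<open>
  For \<open>g \<in> G\<close> the conjugate of \<open>S\<close> by \<open>g\<close> is a p-subgroup of \<open>N\<close>, so some \<open>x \<in> N\<close> conjugates it back into \<open>S\<close>.
\<close>

lemma frattini_argument:
  assumes fin: "finite (carrier G)" and p: "Factorial_Ring.prime p" and N: "N \<lhd> G"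
    and S: "group.sylow_subgroup (G\<lparr>carrier := N\<rparr>) p S"
  shows "carrier G = N <#> {g \<in> carrier G. \<forall>s \<in> S. conj_by G g s \<in> S}"
proof (intro equalityI subsetI)
  interpret N: normal N G by fact
  let ?N = "G\<lparr>carrier := N\<rparr>"
  interpret GN: group ?N by (rule N.subgroup_is_group) (rule is_group)
  obtain k where S_N: "subgroup S ?N" and card_S: "card S = p ^ k" and index: "\<not> p dvd card (rcosets\<^bsub>?N\<^esub> S)"
    using S by (auto simp: GN.sylow_subgroup_def)
  have S_G: "subgroup S G" using S_N incl_subgroup N.subgroup_axioms by blast
  interpret S: subgroup S G by fact
  have SN: "S \<subseteq> N" using S_N subgroup.subset by fastforce
  fix g assume g: "g \<in> carrier G"
  define T where "T = conj_by G g ` S"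
  have T_N: "T \<subseteq> N" using g SN conj_by_mem_normal[OF N] by (auto simp: T_def)
  have "subgroup T G"
  proof (rule subgroupI)
    show "T \<subseteq> carrier G" using T_N N.subset by auto
    show "T \<noteq> {}" using S.one_closed by (metis T_def empty_iff image_is_empty)
    show "inv x \<in> T" if "x \<in> T" for x
      using that g S.m_inv_closed by (auto simp: T_def simp flip: conj_by_inv)
    show "x \<otimes> y \<in> T" if "x \<in> T" "y \<in> T" for x y
      using that g by (auto simp: T_def simp flip: conj_by_mult)
  qed
  then have "subgroup T ?N" using T_N N.subgroup_axioms subgroup_incl by blast
  moreover have "card T = p ^ k"
    unfolding T_def using g card_S by (subst card_image) (auto simp: inj_on_def conj_by_inj)
  moreover have "finite (carrier ?N)" using fin N.subset finite_subset by auto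
  ultimately obtain x where "x \<in> carrier ?N" and x: "\<And>s. s \<in> T \<Longrightarrow> x \<otimes>\<^bsub>?N\<^esub> s \<otimes>\<^bsub>?N\<^esub> inv\<^bsub>?N\<^esub> x \<in> S"
    using GN.p_subgroup_conjugate_into[OF _ p S_N index] by metis
  then have xN: "x \<in> N" by simp
  let ?l = "g \<otimes> inv x"
  have "conj_by G ?l s \<in> S" if "s \<in> S" for s
  proof -
    have "x \<otimes> conj_by G g s \<otimes> inv x \<in> S"
      using x[of "conj_by G g s"] that xN N.subgroup_axioms m_inv_consistent by (simp add: T_def)
    then show ?thesis
      using that g xN by (simp add: conj_by_def m_assoc inv_mult_group)
  qed
  then have "?l \<in> {g \<in> carrier G. \<forall>s \<in> S. conj_by G g s \<in> S}"
    using g xN by simp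
  moreover have "?l \<otimes> x \<otimes> inv ?l \<in> N"
    using g xN by (intro N.inv_op_closed2) auto
  moreover have "g = (?l \<otimes> x \<otimes> inv ?l) \<otimes> ?l"
    using g xN by (simp add: m_assoc inv_mult_group)
  ultimately show "g \<in> N <#> {g \<in> carrier G. \<forall>s \<in> S. conj_by G g s \<in> S}"
    unfolding set_mult_def by blast
qed (use normal_imp_subgroup[OF N] in \<open>auto simp: set_mult_def subgroup.mem_carrier\<close>)

lemma complement_transfer:
  assumes L: "subgroup L G" and N: "subgroup N G" and cov: "carrier G = N <#> L"
    and K: "subgroup K (G\<lparr>carrier := L\<rparr>)" and NL: "N \<inter> L \<inter> K \<subseteq> {\<one>}" and LK: "L = (N \<inter> L) <#> K"
  shows "subgroup K G" "N \<inter> K = {\<one>}" "carrier G = N <#> K"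
proof -
  show K_G: "subgroup K G" using K L incl_subgroup by blast
  have "K \<subseteq> L" using K subgroup.subset by fastforce
  then show "N \<inter> K = {\<one>}"
    using NL subgroup.one_closed[OF N] subgroup.one_closed[OF K_G] by blast
  show "carrier G = N <#> K"
  proof (intro equalityI subsetI)
    fix x assume "x \<in> carrier G"
    then obtain n l where nl: "n \<in> N" "l \<in> L" "x = n \<otimes> l" unfolding cov set_mult_def by blast
    then obtain m k where mk: "m \<in> N" "k \<in> K" "l = m \<otimes> k" using LK unfolding set_mult_def by blast
    have "x = (n \<otimes> m) \<otimes> k"
      using nl mk N K_G by (simp add: m_assoc subgroup.mem_carrier)
    moreover have "n \<otimes> m \<in> N" using nl mk N by (simp add: subgroup.m_closed)
    ultimately show "x \<in> N <#> K" using mk unfolding set_mult_def by blast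
  qed (use N K_G in \<open>auto simp: set_mult_def subgroup.mem_carrier\<close>)
qed

end

text \<open>
  Let \<open>S\<close> be a nontrivial Sylow subgroup of \<open>N\<close> and \<open>L\<close> its normalizer; \<open>G = N L\<close> by the Frattini argument. If
  \<open>L \<noteq> G\<close>, then a complement of \<open>N \<inter> L\<close> in \<open>L\<close> will do. Otherwise the centre \<open>Z\<close> of \<open>S\<close> is a nontrivial abelian
  normal subgroup of \<open>G\<close>. A complement of \<open>N\<close> modulo \<open>Z\<close> has a preimage \<open>K\<close> with \<open>G = N K\<close> and \<open>N \<inter> K = Z\<close>, and the
  abelian case applied to \<open>Z\<close> in \<open>K\<close> gives the result.
\<close>

lemma schur_zassenhaus_step:
  fixes G :: "nat monoid" (structure)
  assumes IH: "\<And>(H :: nat monoid) N. order H < order G \<Longrightarrow> group H \<Longrightarrow> finite (carrier H) \<Longrightarrow> N \<lhd> H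
      \<Longrightarrow> coprime (card N) (order H div card N)
      \<Longrightarrow> \<exists>K. subgroup K H \<and> N \<inter> K = {\<one>\<^bsub>H\<^esub>} \<and> carrier H = N <#>\<^bsub>H\<^esub> K"
    and "group G" and fin: "finite (carrier G)" and N: "N \<lhd> G"
    and cop: "coprime (card N) (order G div card N)"
  shows "\<exists>K. subgroup K G \<and> N \<inter> K = {\<one>} \<and> carrier G = N <#> K"
proof -
  interpret group G by fact
  interpret N: normal N G by fact
  let ?N = "G\<lparr>carrier := N\<rparr>"
  interpret GN: group ?N by (rule N.subgroup_is_group) (rule is_group)
  have finN: "finite N" using fin N.subset finite_subset by auto
  have card_N: "card N > 0" using N.finite_imp_card_positive fin by blast
  have card_N_dvd: "card N dvd order G" using lagrange[OF N.subgroup_axioms] by (metis dvd_triv_right)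
  show ?thesis
  proof (cases "N = {\<one>}")
    case True
    then show ?thesis
      using subgroup_self by (intro exI[of _ "carrier G"]) (auto simp: set_mult_def)
  next
    case False
    then have "card N \<noteq> 1" using N.one_closed by (metis card_1_singletonE singletonD)
    then obtain p where p: "Factorial_Ring.prime p" "p dvd card N" using prime_factor_nat by blast
    have "finite (carrier ?N)" using finN by simp
    then obtain S where S: "GN.sylow_subgroup p S" "S \<noteq> {\<one>}"
      using GN.sylow_subgroup_exists[OF _ p(1)] p(2) by (auto simp: order_def)
    then obtain k where S_N: "subgroup S ?N" and card_S: "card S = p ^ k"
      by (auto simp: GN.sylow_subgroup_def)
    have S_G: "subgroup S G" using S_N incl_subgroup N.subgroup_axioms by blast
    interpret S: subgroup S G by fact
    have SN: "S \<subseteq> N" using S_N subgroup.subset by fastforce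
    define L where "L = {g \<in> carrier G. \<forall>s \<in> S. conj_by G g s \<in> S}"
    have L: "subgroup L G" unfolding L_def using normalizer_of_subgroup fin S.subset by blast
    interpret L: subgroup L G by fact
    have cov: "carrier G = N <#> L"
      unfolding L_def by (rule frattini_argument[OF fin p(1) N S(1)])
    show ?thesis
    proof (cases "L = carrier G")
      case False
      let ?L = "G\<lparr>carrier := L\<rparr>"
      have "group ?L" by (rule L.subgroup_is_group) (rule is_group)
      have "L \<subset> carrier G" using False L.subset by blast
      then have "order ?L < order G" using fin by (simp add: order_def psubset_card_mono)
      moreover have normal: "N \<inter> L \<lhd> ?L" using normal_Int_subgroup[OF L N] by (simp add: Int_commute)
      moreover have "coprime (card (N \<inter> L)) (order ?L div card (N \<inter> L))"
      proof -
        have NL: "subgroup (N \<inter> L) G" using subgroups_Inter_pair N.subgroup_axioms L by blast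
        have "card (N \<inter> L) > 0" using subgroup.finite_imp_card_positive[OF NL fin] .
        moreover have "card (N \<inter> L) dvd card N"
        proof -
          have "subgroup (N \<inter> L) ?N" using subgroup_incl[OF NL N.subgroup_axioms] by simp
          from GN.lagrange[OF this] show ?thesis by (simp add: order_def) (metis dvd_triv_right)
        qed
        moreover have "order ?L div card (N \<inter> L) = order G div card N"
        proof -
          have "order G * card (N \<inter> L) = card N * order ?L"
            using card_set_mult_subgroups[OF fin N.subgroup_axioms L] cov by (simp add: order_def)
          moreover obtain i where i: "order G = card N * i" using card_N_dvd by blast
          ultimately have "order ?L = card (N \<inter> L) * i" using card_N by (simp add: mult.commute)
          then show ?thesis using i card_N \<open>card (N \<inter> L) > 0\<close> by simp
        qed
        ultimately show ?thesis using cop by (metis coprime_divisors dvd_refl)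
      qed
      ultimately obtain K where "subgroup K ?L" "N \<inter> L \<inter> K = {\<one>}" "L = (N \<inter> L) <#> K"
        using IH[of ?L "N \<inter> L"] \<open>group ?L\<close> fin L.subset finite_subset by auto
      then show ?thesis
        using complement_transfer[OF L N.subgroup_axioms cov] by blast
    next
      case True
      define Z where "Z = {z \<in> S. \<forall>s \<in> S. s \<otimes> z = z \<otimes> s}"
      have S_norm: "conj_by G g s \<in> S" if "g \<in> carrier G" "s \<in> S" for g s
      proof -
        have "g \<in> L" using that(1) True by blast
        then show ?thesis using that(2) unfolding L_def by blast
      qed
      have ZS: "Z \<subseteq> S" unfolding Z_def by blast
      then have ZN: "Z \<subseteq> N" using SN by blast
      have Z: "Z \<lhd> G"
      proof (rule normal_invI)
        show Z_sub: "subgroup Z G"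
        proof (rule subgroupI)
          have "\<one> \<in> Z" by (simp add: Z_def)
          then show "Z \<noteq> {}" by blast
          fix z assume z: "z \<in> Z"
          have "s \<otimes> inv z = inv z \<otimes> s" if "s \<in> S" for s
            proof -
            have "z \<in> S" "s \<otimes> z = z \<otimes> s" using z that unfolding Z_def by blast+
            then show ?thesis using that inv_commute[of z s] by (metis S.mem_carrier)
          qed
          then show "inv z \<in> Z" using z S.m_inv_closed unfolding Z_def by blast
          fix w assume w: "w \<in> Z"
          have "s \<otimes> (z \<otimes> w) = z \<otimes> w \<otimes> s" if "s \<in> S" for s
          proof -
            have zw: "z \<in> S" "w \<in> S" "s \<otimes> z = z \<otimes> s" "s \<otimes> w = w \<otimes> s"
              using z w that unfolding Z_def by blast+
            have "s \<otimes> (z \<otimes> w) = (s \<otimes> z) \<otimes> w" using zw(1,2) that by (simp add: m_assoc)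
            also have "\<dots> = z \<otimes> (s \<otimes> w)" using zw(1,2) that by (subst zw(3)) (simp add: m_assoc)
            also have "\<dots> = z \<otimes> w \<otimes> s" using zw(1,2) that by (subst zw(4)) (simp add: m_assoc)
            finally show ?thesis .
          qed
          then show "z \<otimes> w \<in> Z" using z w S.m_closed unfolding Z_def by blast
        qed (use ZS S.subset in blast)
        fix g z assume g: "g \<in> carrier G" and z: "z \<in> Z"
        then have zS: "z \<in> S" unfolding Z_def by blast
        have "s \<otimes> conj_by G (inv g) z = conj_by G (inv g) z \<otimes> s" if "s \<in> S" for s
        proof -
          have "conj_by G g s \<otimes> z = z \<otimes> conj_by G g s" using z S_norm[OF g that] unfolding Z_def by blast
          then have "conj_by G (inv g) (conj_by G g s \<otimes> z) = conj_by G (inv g) (z \<otimes> conj_by G g s)" by simp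
          then show ?thesis using g that zS by (simp add: conj_by_mult)
        qed
        then have "conj_by G (inv g) z \<in> Z" using S_norm[of "inv g" z] g zS inv_closed unfolding Z_def by blast
        then show "g \<otimes> z \<otimes> inv g \<in> Z" using g by (simp add: conj_by_def)
      qed
      interpret Z: normal Z G by fact
      obtain z where "z \<in> S" "z \<noteq> \<one>" "\<And>s. s \<in> S \<Longrightarrow> s \<otimes> z = z \<otimes> s"
        using p_subgroup_centre_nontrivial[OF fin p(1) S_G card_S S(2)] by blast
      then have "z \<in> Z" unfolding Z_def by blast
      then have "Z \<noteq> {\<one>}" using \<open>z \<noteq> \<one>\<close> by blast
      have "card Z > 0" using Z.finite_imp_card_positive fin by blast
      moreover have "card Z \<noteq> 1" using \<open>Z \<noteq> {\<one>}\<close> Z.one_closed by (metis card_1_singletonE singletonD)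
      ultimately have card_Z: "card Z > 1" by simp
      obtain Q :: "nat monoid" and h where Q: "group_hom G Q h" "h ` carrier G = carrier Q"
        "finite (carrier Q)" "order Q * card Z = order G" "\<And>x. x \<in> carrier G \<Longrightarrow> h x = \<one>\<^bsub>Q\<^esub> \<longleftrightarrow> x \<in> Z"
        using Z.quotient_on_nat[OF fin] by metis
      interpret h: group_hom G Q h by (rule Q(1))
      have "order G > 0" using fin order_gt_0_iff_finite by simp
      then have order_Q: "order Q < order G" using Q(4) card_Z by (metis mult_less_cancel1 mult.right_neutral nat_0_less_mult_iff)
      have hN: "h ` N \<lhd> Q"
        using N.surj_hom_normal_subgroup[OF Q(1) Q(2)] .
      have card_hN: "card (h ` N) * card Z = card N"
      proof -
        have "{x \<in> N. h x = \<one>\<^bsub>Q\<^esub>} = Z" using Q(5) ZN by auto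
        then show ?thesis using h.card_image_mult_card_kernel[OF N.subgroup_axioms] by simp
      qed
      have index_hN: "order Q div card (h ` N) = order G div card N"
        using Q(4) card_hN card_Z by (metis div_mult2_eq div_mult_self_is_m mult.commute zero_less_one less_trans)
      obtain K' where K': "subgroup K' Q" "h ` N \<inter> K' = {\<one>\<^bsub>Q\<^esub>}" "carrier Q = h ` N <#>\<^bsub>Q\<^esub> K'"
      proof -
        have "card (h ` N) dvd card N" using card_hN by (metis dvd_triv_left)
        then have "coprime (card (h ` N)) (order Q div card (h ` N))"
          using cop coprime_divisors[OF _ dvd_refl] by (simp add: index_hN)
        from IH[OF order_Q h.H.is_group Q(3) hN this] show ?thesis using that by blast
      qed
      define K where "K = {x \<in> carrier G. h x \<in> K'}"
      have K: "subgroup K G" and NK: "N \<inter> K = Z" and cov: "carrier G = N <#> K"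
        using h.vimage_of_complement[OF N.subset Q(2) K'] Q(5) ZN by (auto simp: K_def)
      interpret K: subgroup K G by fact
      let ?K = "G\<lparr>carrier := K\<rparr>"
      interpret GK: group ?K by (rule K.subgroup_is_group) (rule is_group)
      have ZK: "Z \<subseteq> K" using NK by blast
      have Z_normal: "Z \<lhd> ?K" using normal_Int_subgroup[OF K Z] ZK by (simp add: Int_absorb1 Int_commute inf.absorb2)
      have Z_comm: "x \<otimes>\<^bsub>?K\<^esub> y = y \<otimes>\<^bsub>?K\<^esub> x" if "x \<in> Z" "y \<in> Z" for x y
        using that ZS unfolding Z_def by fastforce
      have Z_coprime: "coprime (card Z) (order ?K div card Z)"
      proof -
        have "order G * card Z = card N * order ?K"
          using card_set_mult_subgroups[OF fin N.subgroup_axioms K] cov NK by (simp add: order_def)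
        moreover obtain i where i: "order G = card N * i" using card_N_dvd by blast
        ultimately have "order ?K = card Z * i" using card_N by (simp add: mult.commute)
        then have "order ?K div card Z = order G div card N" using i card_N card_Z by simp
        moreover have "card Z dvd card N" using card_hN by (metis dvd_triv_right)
        ultimately show ?thesis using cop by (metis coprime_divisors dvd_refl)
      qed
      have "finite (carrier ?K)" using fin K.subset finite_subset by auto
      from GK.abelian_normal_subgroup_complement[OF this Z_normal Z_comm Z_coprime]
      obtain K2 where K2: "subgroup K2 ?K" "Z \<inter> K2 = {\<one>\<^bsub>?K\<^esub>}" "carrier ?K = Z <#>\<^bsub>?K\<^esub> K2" by blast
      have "N \<inter> K \<inter> K2 \<subseteq> {\<one>}" unfolding NK using K2(2) by simp
      moreover have "K = (N \<inter> K) <#> K2" unfolding NK using K2(3) by simp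
      ultimately show ?thesis
        using complement_transfer[OF K N.subgroup_axioms cov K2(1)] by blast
    qed
  qed
qed

lemma schur_zassenhaus_nat:
  fixes G :: "nat monoid"
  assumes "group G" "finite (carrier G)" "N \<lhd> G" "coprime (card N) (order G div card N)"
  shows "\<exists>K. subgroup K G \<and> N \<inter> K = {\<one>\<^bsub>G\<^esub>} \<and> carrier G = N <#>\<^bsub>G\<^esub> K"
  using assms
proof (induction "order G" arbitrary: G N rule: less_induct)
  case less
  show ?case by (rule schur_zassenhaus_step[OF less.hyps less.prems])
qed

theorem (in group) schur_zassenhaus:
  assumes fin: "finite (carrier G)" and N: "N \<lhd> G" and cop: "coprime (card N) (order G div card N)"
  obtains K where "subgroup K G" "N \<inter> K = {\<one>}" "carrier G = N <#> K"
proof -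
  interpret N: normal N G by fact
  interpret one: normal "{\<one>}" G by (rule one_is_normal)
  obtain Q :: "nat monoid" and h where Q: "group_hom G Q h" "h ` carrier G = carrier Q"
    "finite (carrier Q)" "order Q * card {\<one>} = order G"
    "\<And>x. x \<in> carrier G \<Longrightarrow> h x = \<one>\<^bsub>Q\<^esub> \<longleftrightarrow> x \<in> {\<one>}"
    using one.quotient_on_nat[OF fin] by metis
  interpret h: group_hom G Q h by (rule Q(1))
  have inj: "inj_on h (carrier G)" using Q(5) by (intro h.inj_on_one_iff[THEN iffD2]) auto
  have "card (h ` N) = card N"
    using inj_on_subset[OF inj N.subset] by (rule card_image)
  then obtain K' where K': "subgroup K' Q" "h ` N \<inter> K' = {\<one>\<^bsub>Q\<^esub>}" "carrier Q = h ` N <#>\<^bsub>Q\<^esub> K'"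
    using schur_zassenhaus_nat[OF h.H.is_group Q(3) N.surj_hom_normal_subgroup[OF Q(1,2)]] cop Q(4) by auto
  have "{x \<in> N. h x = \<one>\<^bsub>Q\<^esub>} = {\<one>}"
    using Q(5) N.one_closed by auto
  then show thesis
    using that h.vimage_of_complement[OF N.subset Q(2) K'] by simp
qed


section \<open>Maximal subgroups\<close>

context group
begin

definition prime_power_element :: "'a \<Rightarrow> bool" where
  "prime_power_element x \<longleftrightarrow> x \<in> carrier G \<and> (\<exists>p k. Factorial_Ring.prime p \<and> x [^] (p ^ k :: nat) = \<one>)"

text \<open>
  Such a subgroup \<open>T\<close> contains a Sylow subgroup for each prime, so its order is divisible by that of \<open>G\<close>.
\<close>

lemma prime_power_elements_generate:
  assumes fin: "finite (carrier G)" and T: "subgroup T G"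
    and mem: "\<And>x. prime_power_element x \<Longrightarrow> x \<in> T"
  shows "T = carrier G"
proof -
  interpret T: subgroup T G by fact
  have pos: "order G \<noteq> 0" "card T \<noteq> 0"
    using fin order_gt_0_iff_finite T.finite_imp_card_positive by auto
  have "multiplicity p (order G) \<le> multiplicity p (card T)" if p: "Factorial_Ring.prime p" for p :: nat
  proof -
    obtain m where "order G = p ^ multiplicity p (order G) * m"
      using multiplicity_dvd[of p "order G"] by (metis dvdE)
    then obtain S where S: "subgroup S G" "card S = p ^ multiplicity p (order G)"
      using sylow_thm[OF p is_group _ fin] by blast
    interpret S: subgroup S G by fact
    interpret GS: group "G\<lparr>carrier := S\<rparr>" by (rule S.subgroup_is_group) (rule is_group)
    have "x \<in> T" if x: "x \<in> S" for x
    proof (rule mem)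
      have "x [^] (p ^ multiplicity p (order G)) = \<one>"
        using GS.pow_order_eq_1[of x] x S(2) by (simp add: order_def flip: nat_pow_consistent)
      then show "prime_power_element x" using p x by (auto simp: prime_power_element_def)
    qed
    then have "subgroup S (G\<lparr>carrier := T\<rparr>)" using subgroup_incl S(1) T by blast
    then have "card S dvd card T"
      using group.lagrange[OF T.subgroup_is_group[OF is_group]] by (simp add: order_def) (metis dvd_triv_right)
    then show ?thesis
      using S(2) pos p by (metis power_dvd_iff_le_multiplicity not_prime_unit)
  qed
  then have "order G dvd card T" using pos by (intro multiplicity_le_imp_dvd) auto
  then have "card (carrier G) \<le> card T" using pos by (simp add: dvd_imp_le order_def)
  then show ?thesis using T.subset fin by (simp add: card_seteq)
qed

definition maximal_subgroup :: "'a set \<Rightarrow> bool" where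
  "maximal_subgroup V \<longleftrightarrow> subgroup V G \<and> V \<noteq> carrier G
    \<and> (\<forall>W. subgroup W G \<longrightarrow> V \<subseteq> W \<longrightarrow> W = V \<or> W = carrier G)"

lemma proper_subgroup_le_maximal:
  assumes fin: "finite (carrier G)" and A: "subgroup A G" "A \<noteq> carrier G"
  obtains V where "maximal_subgroup V" "A \<subseteq> V"
proof -
  let ?P = "{W. subgroup W G \<and> W \<noteq> carrier G}"
  have "?P \<subseteq> Pow (carrier G)" using subgroup.subset by blast
  then have "finite ?P" using fin by (simp add: finite_subset)
  then obtain V where V: "V \<in> ?P" "A \<subseteq> V" "\<forall>W \<in> ?P. V \<subseteq> W \<longrightarrow> V = W"
    using finite_has_maximal2[of ?P A] A by auto
  then have "maximal_subgroup V" unfolding maximal_subgroup_def by blast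
  then show thesis using that V(2) by blast
qed

lemma conj_by_image_image:
  "g \<in> carrier G \<Longrightarrow> h \<in> carrier G \<Longrightarrow> V \<subseteq> carrier G
    \<Longrightarrow> conj_by G h ` conj_by G g ` V = conj_by G (g \<otimes> h) ` V"
  unfolding image_image by (intro image_cong refl) (auto simp: conj_by_by_mult)

lemma conj_by_image_one: "V \<subseteq> carrier G \<Longrightarrow> conj_by G \<one> ` V = V"
  by (auto simp: subset_iff image_iff)

lemma conj_by_image_inv:
  assumes "g \<in> carrier G" "V \<subseteq> carrier G"
  shows "conj_by G (inv g) ` conj_by G g ` V = V" "conj_by G g ` conj_by G (inv g) ` V = V"
  using assms by (simp_all add: conj_by_image_image conj_by_image_one)

lemma conj_by_image_subgroup:
  assumes g: "g \<in> carrier G" and V: "subgroup V G"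
  shows "subgroup (conj_by G g ` V) G"
proof -
  have "conj_by G g \<in> hom G G" using g by (auto simp: hom_def conj_by_mult)
  then have "group_hom G G (conj_by G g)" by (simp add: group_hom_def group_hom_axioms_def)
  then show ?thesis using V by (rule group_hom.subgroup_img_is_subgroup)
qed

lemma conj_by_image_carrier: "g \<in> carrier G \<Longrightarrow> conj_by G g ` carrier G = carrier G"
proof
  assume g: "g \<in> carrier G"
  show "carrier G \<subseteq> conj_by G g ` carrier G"
  proof
    fix x assume x: "x \<in> carrier G"
    then have "x = conj_by G g (conj_by G (inv g) x)" using g by simp
    then show "x \<in> conj_by G g ` carrier G" using g x by blast
  qed
qed auto

lemma maximal_subgroup_conj_by:
  assumes g: "g \<in> carrier G" and V: "maximal_subgroup V"
  shows "maximal_subgroup (conj_by G g ` V)"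
proof -
  have sub: "V \<subseteq> carrier G" using V subgroup.subset by (auto simp: maximal_subgroup_def)
  have "conj_by G g ` V \<noteq> carrier G"
    using V conj_by_image_inv(1)[OF g sub] conj_by_image_carrier[of "inv g"] g
    by (metis inv_closed maximal_subgroup_def)
  moreover have "W = conj_by G g ` V \<or> W = carrier G"
    if W: "subgroup W G" "conj_by G g ` V \<subseteq> W" for W
  proof -
    have "V \<subseteq> conj_by G (inv g) ` W"
      using image_mono[OF W(2), of "conj_by G (inv g)"] conj_by_image_inv(1)[OF g sub] by simp
    then have "conj_by G (inv g) ` W = V \<or> conj_by G (inv g) ` W = carrier G"
      using V conj_by_image_subgroup[OF _ W(1), of "inv g"] g by (auto simp: maximal_subgroup_def)
    then show ?thesis
      using conj_by_image_inv(2)[OF g subgroup.subset[OF W(1)]] conj_by_image_carrier[OF g] by auto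
  qed
  ultimately show ?thesis
    using V g conj_by_image_subgroup by (auto simp: maximal_subgroup_def)
qed

lemma conj_by_image_fixed_imp_normal:
  assumes V: "subgroup V G" and "\<And>g. g \<in> carrier G \<Longrightarrow> V \<subseteq> conj_by G g ` V"
  shows "V \<lhd> G"
proof (rule normal_invI[OF V])
  fix g x assume g: "g \<in> carrier G" and x: "x \<in> V"
  then obtain y where "y \<in> V" "x = conj_by G g y" using assms(2) by blast
  then show "g \<otimes> x \<otimes> inv g \<in> V"
    using g subgroup.mem_carrier[OF V] by (simp add: conj_by_def m_assoc)
qed

lemma normal_of_normalizer_eq_carrier:
  assumes V: "subgroup V G" and eq: "{g \<in> carrier G. \<forall>s \<in> V. conj_by G g s \<in> V} = carrier G"
  shows "V \<lhd> G"
proof (rule normal_invI[OF V])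
  fix g x assume g: "g \<in> carrier G" and x: "x \<in> V"
  then have "inv g \<in> {g \<in> carrier G. \<forall>s \<in> V. conj_by G g s \<in> V}" unfolding eq by simp
  then have "conj_by G (inv g) x \<in> V" using x by blast
  then show "g \<otimes> x \<otimes> inv g \<in> V" using g by (simp add: conj_by_def)
qed

lemma normalizer_of_maximal_subgroup:
  assumes fin: "finite (carrier G)" and V: "maximal_subgroup V" and nn: "\<not> V \<lhd> G"
  shows "{g \<in> carrier G. \<forall>s \<in> V. conj_by G g s \<in> V} = V"
proof -
  let ?L = "{g \<in> carrier G. \<forall>s \<in> V. conj_by G g s \<in> V}"
  have sub_V: "subgroup V G" using V by (simp add: maximal_subgroup_def)
  have "subgroup ?L G" by (rule normalizer_of_subgroup[OF fin subgroup.subset[OF sub_V]])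
  moreover have "V \<subseteq> ?L" using subgroup_conj_by_mem[OF sub_V] subgroup.subset[OF sub_V] by auto
  moreover have "?L \<noteq> carrier G"
    using normal_of_normalizer_eq_carrier[OF sub_V] nn by blast
  ultimately show ?thesis using V by (auto simp: maximal_subgroup_def)
qed

lemma generate_singleton_proper:
  assumes H: "subgroup H G" "\<not> H \<lhd> G" and x: "x \<in> carrier G"
  shows "generate G {x} \<noteq> carrier G"
proof
  assume gen: "generate G {x} = carrier G"
  have "H \<lhd> G"
  proof (rule normal_invI[OF H(1)])
    fix g h assume g: "g \<in> carrier G" and h: "h \<in> H"
    have "g \<in> generate G {x}" "h \<in> generate G {x}" using g h subgroup.subset[OF H(1)] gen by auto
    then obtain i j :: int where "g = x [^] i" "h = x [^] j" using generate_pow x by auto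
    then have "g \<otimes> h = h \<otimes> g" using x by (simp add: add.commute flip: int_pow_mult)
    then show "g \<otimes> h \<otimes> inv g \<in> H" using g h subgroup.subset[OF H(1)] by (simp add: m_assoc subset_iff)
  qed
  then show False using H(2) by simp
qed

text \<open>
  A maximal subgroup that is not normal is its own normalizer, so its conjugates correspond to its cosets.
\<close>

lemma card_conjugates_of_maximal_subgroup:
  assumes fin: "finite (carrier G)" and V: "maximal_subgroup V" and nn: "\<not> V \<lhd> G"
  shows "card ((\<lambda>g. conj_by G g ` V) ` carrier G) * card V = order G"
proof -
  let ?C = "(\<lambda>g. conj_by G g ` V) ` carrier G"
  let ?L = "{g \<in> carrier G. \<forall>s \<in> V. conj_by G g s \<in> V}"
  have sub_V: "subgroup V G" using V by (simp add: maximal_subgroup_def)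
  interpret V: subgroup V G by fact
  have L: "?L = V" by (rule normalizer_of_maximal_subgroup[OF fin V nn])
  have fibre: "card {y \<in> carrier G. conj_by G y ` V = conj_by G x ` V} = card V"
    if x: "x \<in> carrier G" for x
  proof -
    have "conj_by G y ` V = conj_by G x ` V \<longleftrightarrow> y \<in> V #> x" if y: "y \<in> carrier G" for y
    proof
      assume "conj_by G y ` V = conj_by G x ` V"
      then have "conj_by G (inv x) ` conj_by G y ` V = V"
        using conj_by_image_inv(1)[OF x V.subset] by simp
      then have "conj_by G (y \<otimes> inv x) ` V = V" using x y V.subset by (simp add: conj_by_image_image)
      then have "y \<otimes> inv x \<in> ?L" using x y by blast
      then have "y \<otimes> inv x \<in> V" using L by simp
      moreover have "y = (y \<otimes> inv x) \<otimes> x" using x y by (simp add: m_assoc)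
      ultimately show "y \<in> V #> x" unfolding r_coset_def by blast
    next
      assume "y \<in> V #> x"
      then obtain v where v: "v \<in> V" "y = v \<otimes> x" unfolding r_coset_def by blast
      have "conj_by G v ` V = V"
      proof
        show "conj_by G v ` V \<subseteq> V" using v subgroup_conj_by_mem[OF sub_V] by auto
        show "V \<subseteq> conj_by G v ` V"
        proof
          fix s assume s: "s \<in> V"
          then have "s = conj_by G v (conj_by G (inv v) s)" using v by simp
          then show "s \<in> conj_by G v ` V"
            using s v subgroup_conj_by_mem[OF sub_V, of "inv v" s] by blast
        qed
      qed
      then show "conj_by G y ` V = conj_by G x ` V"
        using v x V.subset conj_by_image_image[of v x V] by simp
    qed
    then have "{y \<in> carrier G. conj_by G y ` V = conj_by G x ` V} = V #> x"
      using r_coset_subset_G[OF V.subset x] by blast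
    then show ?thesis
      using card_rcosets_equal[OF _ V.subset, of "V #> x"] x V.subset by (simp add: rcosetsI)
  qed
  have "order G = (\<Sum>x\<in>carrier G. 1)" by (simp add: order_def)
  also have "\<dots> = (\<Sum>W\<in>?C. \<Sum>x\<in>{x \<in> carrier G. conj_by G x ` V = W}. 1)"
    by (rule sum.image_gen[OF fin])
  also have "\<dots> = (\<Sum>W\<in>?C. card V)"
    by (rule sum.cong) (use fibre in auto)
  finally show ?thesis by simp
qed

text \<open>
  The assumption \<open>meet\<close> is invariant under conjugation, so any two maximal subgroups meet inside the core
  \<open>N\<close> of \<open>H\<close>. Hence the sets \<open>V - N\<close>, for \<open>V\<close> maximal, are disjoint, and each makes up at least half of \<open>V\<close>.
  A maximal subgroup has as many conjugates as its index, so the conjugates of \<open>V\<close> contain, outside \<open>N\<close>,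
  at least half as many elements as \<open>G\<close> has. Two classes of conjugates are therefore too many. If all maximal
  subgroups are conjugate to \<open>H\<close>, then they miss some element outside \<open>N\<close>, although \<open>G\<close> is not cyclic.
\<close>

lemma maximal_subgroups_not_all_meet_within:
  assumes fin: "finite (carrier G)" and H: "maximal_subgroup H"
    and nonnormal: "\<And>V. maximal_subgroup V \<Longrightarrow> \<not> V \<lhd> G"
    and meet: "\<And>V W. maximal_subgroup V \<Longrightarrow> maximal_subgroup W \<Longrightarrow> V \<noteq> W \<Longrightarrow> V \<inter> W \<subseteq> H"
  shows False
proof -
  let ?C = "\<lambda>V. (\<lambda>g. conj_by G g ` V) ` carrier G"
  have subgroup_max: "subgroup V G" if "maximal_subgroup V" for V
    using that by (simp add: maximal_subgroup_def)
  have max_sub: "V \<subseteq> carrier G" if "maximal_subgroup V" for V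
    using subgroup_max[OF that] subgroup.subset by blast
  define N where "N = \<Inter> (?C H)"
  have N: "subgroup N G"
    unfolding N_def using subgroup_max[OF H] conj_by_image_subgroup
    by (intro subgroups_Inter) auto
  have "H \<in> ?C H" using conj_by_image_one[OF max_sub[OF H]] one_closed by (metis imageI)
  then have NH: "N \<subseteq> H" unfolding N_def by blast
  have meet_N: "V \<inter> W \<subseteq> N" if V: "maximal_subgroup V" and W: "maximal_subgroup W" and "V \<noteq> W" for V W
  proof (unfold N_def, intro Inter_greatest)
    fix Hg assume "Hg \<in> ?C H"
    then obtain g where g: "g \<in> carrier G" "Hg = conj_by G g ` H" by blast
    let ?V = "conj_by G (inv g) ` V" and ?W = "conj_by G (inv g) ` W"
    have "conj_by G g ` ?V = V" "conj_by G g ` ?W = W"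
      using conj_by_image_inv(2)[OF g(1)] V W max_sub by auto
    then have "?V \<noteq> ?W" using \<open>V \<noteq> W\<close> by metis
    then have "?V \<inter> ?W \<subseteq> H"
      using meet V W maximal_subgroup_conj_by g(1) by auto
    show "V \<inter> W \<subseteq> Hg"
    proof
      fix x assume x: "x \<in> V \<inter> W"
      then have "conj_by G (inv g) x \<in> H" using \<open>?V \<inter> ?W \<subseteq> H\<close> by blast
      moreover have "x = conj_by G g (conj_by G (inv g) x)" using x max_sub[OF V] g(1) by auto
      ultimately show "x \<in> Hg" unfolding g(2) by blast
    qed
  qed
  have not_sub_N: "\<not> V \<subseteq> N" if V: "maximal_subgroup V" for V
  proof
    assume "V \<subseteq> N"
    then have "V = H" using V H NH unfolding maximal_subgroup_def by blast
    then have "H \<subseteq> conj_by G g ` H" if "g \<in> carrier G" for g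
      using \<open>V \<subseteq> N\<close> that unfolding N_def by blast
    then show False
      using conj_by_image_fixed_imp_normal[OF subgroup_max[OF H]] nonnormal[OF H] by blast
  qed
  have finV: "finite V" if "maximal_subgroup V" for V
    using max_sub[OF that] fin finite_subset by blast
  have half: "card V \<le> 2 * card (V - N)" if V: "maximal_subgroup V" for V
  proof -
    interpret V: subgroup V G by (rule subgroup_max[OF V])
    have VN: "subgroup (V \<inter> N) G" using subgroups_Inter_pair V.subgroup_axioms N by blast
    then have "subgroup (V \<inter> N) (G\<lparr>carrier := V\<rparr>)" using subgroup_incl V.subgroup_axioms by blast
    from group.lagrange[OF V.subgroup_is_group[OF is_group] this]
    obtain i where i: "card V = i * card (V \<inter> N)" by (simp add: order_def) (metis)
    have "card (V \<inter> N) < card V" using not_sub_N[OF V] finV[OF V] by (intro psubset_card_mono) auto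
    then have "i \<noteq> 0" "i \<noteq> 1" using i by (metis mult_0 not_less0, metis mult_1 less_irrefl)
    then have "i \<ge> 2" by simp
    then have "2 * card (V \<inter> N) \<le> card V" using i by simp
    moreover have "card V = card (V - N) + card (V \<inter> N)"
      using card_Diff_subset_Int[of V N] finV[OF V] card_mono[of V "V \<inter> N"] by simp
    ultimately show ?thesis by simp
  qed
  have conj_max: "maximal_subgroup W" if "maximal_subgroup V" "W \<in> ?C V" for V W
    using that maximal_subgroup_conj_by by auto
  have card_conj: "card W = card V" if V: "maximal_subgroup V" and W: "W \<in> ?C V" for V W
  proof -
    obtain g where g: "g \<in> carrier G" "W = conj_by G g ` V" using W by blast
    have "inj_on (conj_by G g) V"
      using max_sub[OF V] g(1) conj_by_inj by (meson inj_onI subsetD)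
    then show ?thesis unfolding g(2) by (rule card_image)
  qed
  have finC: "finite (?C V)" for V using fin by simp
  \<comment> \<open>\<open>U V\<close> is the part outside \<open>N\<close> that the conjugates of \<open>V\<close> cover.\<close>
  define U where "U V = (\<Union>W \<in> ?C V. W - N)" for V
  have card_U: "card (U V) = (\<Sum>W\<in>?C V. card (W - N))" if V: "maximal_subgroup V" for V
    unfolding U_def
  proof (rule card_UN_disjoint[OF finC])
    show "\<forall>W \<in> ?C V. finite (W - N)"
      using finV conj_max[OF V] by blast
    show "\<forall>W1 \<in> ?C V. \<forall>W2 \<in> ?C V. W1 \<noteq> W2 \<longrightarrow> (W1 - N) \<inter> (W2 - N) = {}"
      using conj_max[OF V] meet_N by blast
  qed
  have large_U: "order G \<le> 2 * card (U V)" if V: "maximal_subgroup V" for V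
  proof -
    have "order G = (\<Sum>W\<in>?C V. card V)"
      using card_conjugates_of_maximal_subgroup[OF fin V nonnormal[OF V]] by simp
    also have "\<dots> \<le> (\<Sum>W\<in>?C V. 2 * card (W - N))"
    proof (rule sum_mono)
      fix W assume "W \<in> ?C V"
      then show "card V \<le> 2 * card (W - N)"
        using half[OF conj_max[OF V]] card_conj[OF V] by metis
    qed
    also have "\<dots> = 2 * card (U V)" by (simp add: card_U[OF V] sum_distrib_left)
    finally show ?thesis .
  qed
  have U_sub: "U V \<subseteq> carrier G - N" if V: "maximal_subgroup V" for V
    using conj_max[OF V] max_sub unfolding U_def by fast
  have card_N: "card N > 0" using subgroup.finite_imp_card_positive[OF N fin] .
  have card_rest: "card (carrier G - N) = order G - card N"
    unfolding order_def using N fin by (intro card_Diff_subset) (auto dest: subgroup.subset finite_subset)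
  show False
  proof (cases "\<exists>V. maximal_subgroup V \<and> V \<notin> ?C H")
    case True
    then obtain V where V: "maximal_subgroup V" "V \<notin> ?C H" by blast
    have distinct: "W1 \<noteq> W2" if W1: "W1 \<in> ?C H" and W2: "W2 \<in> ?C V" for W1 W2
    proof
      assume "W1 = W2"
      obtain g where g: "g \<in> carrier G" "W1 = conj_by G g ` H" using W1 by blast
      obtain h where h: "h \<in> carrier G" "W2 = conj_by G h ` V" using W2 by blast
      have "V = conj_by G (inv h) ` W2" using h conj_by_image_inv(1) max_sub[OF V(1)] by simp
      also have "\<dots> = conj_by G (g \<otimes> inv h) ` H"
        using g h \<open>W1 = W2\<close> conj_by_image_image[of g "inv h" H] max_sub[OF H] by simp
      finally show False using V(2) g h by blast
    qed
    have "W1 \<inter> W2 \<subseteq> N" if "W1 \<in> ?C H" "W2 \<in> ?C V" for W1 W2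
      by (rule meet_N[OF conj_max[OF H that(1)] conj_max[OF V(1) that(2)] distinct[OF that]])
    then have "U H \<inter> U V = {}" unfolding U_def by blast
    moreover have "finite (U H)" "finite (U V)"
      using U_sub[OF H] U_sub[OF V(1)] fin by (auto intro: finite_subset)
    ultimately have "card (U H) + card (U V) = card (U H \<union> U V)"
      by (simp add: card_Un_disjoint)
    also have "\<dots> \<le> order G - card N"
      using U_sub[OF H] U_sub[OF V(1)] fin card_rest by (metis Un_least card_mono finite_Diff)
    finally have "card (U H) + card (U V) \<le> order G - card N" .
    moreover have "order G > 0" using fin order_gt_0_iff_finite by blast
    ultimately show False using large_U[OF H] large_U[OF V(1)] card_N by linarith
  next
    case False
    have "carrier G - N \<subseteq> U H"
    proof
      fix x assume x: "x \<in> carrier G - N"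
      \<comment> \<open>A group with a non-normal subgroup is not cyclic, so \<open>x\<close> lies in some maximal subgroup.\<close>
      have "generate G {x} \<noteq> carrier G"
        using generate_singleton_proper[OF subgroup_max[OF H] nonnormal[OF H]] x by simp
      then obtain V where V: "maximal_subgroup V" "generate G {x} \<subseteq> V"
        using proper_subgroup_le_maximal[OF fin generate_is_subgroup, of "{x}"] x by auto
      then have "x \<in> V" using generate.incl[of x "{x}"] by blast
      then show "x \<in> U H" using V(1) False x unfolding U_def by blast
    qed
    then have "U H = carrier G - N" using U_sub[OF H] by blast
    then have "order G - card N = (\<Sum>W\<in>?C H. card (W - N))" using card_U[OF H] card_rest by simp
    also have "\<dots> = (\<Sum>W\<in>?C H. card H - card N)"
    proof (rule sum.cong)
      fix W assume W: "W \<in> ?C H"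
      then have "N \<subseteq> W" unfolding N_def by blast
      then have "card (W - N) = card W - card N"
        using finV[OF conj_max[OF H W]] finite_subset by (metis card_Diff_subset)
      then show "card (W - N) = card H - card N" using card_conj[OF H W] by simp
    qed simp
    also have "\<dots> = order G - card (?C H) * card N"
      using card_conjugates_of_maximal_subgroup[OF fin H nonnormal[OF H]] by (simp add: diff_mult_distrib2)
    finally have "order G - card N = order G - card (?C H) * card N" .
    moreover have "card (?C H) * card N \<le> order G"
      using card_conjugates_of_maximal_subgroup[OF fin H nonnormal[OF H]] NH finV[OF H] card_mono
      by (metis mult_le_mono2)
    moreover have "card N \<le> order G" using N fin subgroup.subset card_mono by (metis order_def)
    ultimately have "card (?C H) * card N = card N" by (metis diff_diff_cancel)
    then have "card (?C H) = 1" using card_N by simp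
    then have "?C H = {H}" using \<open>H \<in> ?C H\<close> by (metis card_1_singletonE singletonD)
    then have "H \<subseteq> conj_by G g ` H" if "g \<in> carrier G" for g using that by blast
    then show False
      using conj_by_image_fixed_imp_normal[OF subgroup_max[OF H]] nonnormal[OF H] by blast
  qed
qed

end


section \<open>Coprime extensions by two copies of a group\<close>

text \<open>
  The elements \<open>i a\<close> and \<open>j c\<close> are known modulo \<open>M\<close> to be related as \<open>\<alpha> a\<close> and \<open>\<phi> c\<close> are. In the application \<open>\<alpha>\<close> and
  \<open>\<phi>\<close> take values in a complement of \<open>M\<close>. The aim is the relation \<open>compatible\<close> for \<open>i\<close> and \<open>j\<close> instead of \<open>\<alpha>\<close>
  and \<open>\<phi>\<close>.
\<close>

locale lifted_pair = group G + P: group P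
  for G (structure) and P :: "('p, 'q) monoid_scheme" +
  fixes M D1 D2 :: "'a set" and i j \<alpha> \<phi> :: "'p \<Rightarrow> 'a"
  assumes finite_M: "finite M" and finite_P: "finite (carrier P)"
    and M_normal: "M \<lhd> G" and coprime_M_P: "coprime (card M) (order P)"
    and i_hom: "i \<in> hom P G" and j_hom: "j \<in> hom P G"
    and \<alpha>_hom: "\<alpha> \<in> hom P G" and \<phi>_hom: "\<phi> \<in> hom P G"
    and \<alpha>_cong: "a \<in> carrier P \<Longrightarrow> inv (i a) \<otimes> \<alpha> a \<in> M"
    and \<phi>_cong: "a \<in> carrier P \<Longrightarrow> inv (j a) \<otimes> \<phi> a \<in> M"
    and compatible: "a \<in> carrier P \<Longrightarrow> c \<in> carrier P \<Longrightarrow> conj_by G (\<alpha> a) (\<phi> c) = \<phi> (conj_by P a c)"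
    and D1: "D1 \<subseteq> M" and D2: "D2 \<subseteq> M" and M_eq: "M \<subseteq> D1 <#> D2"
    and D1_central: "d \<in> D1 \<Longrightarrow> a \<in> carrier P \<Longrightarrow> conj_by G d (i a) = i a"
    and D2_central: "d \<in> D2 \<Longrightarrow> a \<in> carrier P \<Longrightarrow> conj_by G d (j a) = j a"
begin

sublocale M: normal M G by (rule M_normal)
sublocale i: group_hom P G i by unfold_locales (rule i_hom)
sublocale j: group_hom P G j by unfold_locales (rule j_hom)
sublocale \<alpha>: group_hom P G \<alpha> by unfold_locales (rule \<alpha>_hom)
sublocale \<phi>: group_hom P G \<phi> by unfold_locales (rule \<phi>_hom)

definition aligned :: "'p set \<Rightarrow> bool" where
  "aligned C \<longleftrightarrow> (\<exists>m \<in> M. \<forall>c \<in> C. \<phi> c = conj_by G m (j c))"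

lemma j_conj_by: "a \<in> carrier P \<Longrightarrow> c \<in> carrier P \<Longrightarrow> j (conj_by P a c) = conj_by G (j a) (j c)"
  by (simp add: conj_by_def)

text \<open>
  For \<open>a \<noteq> 1\<close> the prime \<open>p\<close> divides the order of \<open>P\<close>, hence not that of \<open>M\<close>; for \<open>a = 1\<close> any prime not dividing the
  order of \<open>M\<close> will do.
\<close>

lemma prime_power_element_coprime:
  assumes "P.prime_power_element a"
  obtains p k where "Factorial_Ring.prime p" "\<not> p dvd card M" "a [^]\<^bsub>P\<^esub> (p ^ k :: nat) = \<one>\<^bsub>P\<^esub>"
proof (cases "a = \<one>\<^bsub>P\<^esub>")
  case True
  obtain p :: nat where p: "Factorial_Ring.prime p" "p > card M" using bigger_prime by blast
  have "card M > 0" using finite_M M.one_closed card_gt_0_iff by blast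
  then have "\<not> p dvd card M" using p(2) nat_dvd_not_less by blast
  then show thesis using that[of p 0] p(1) True by simp
next
  case False
  obtain p k where pk: "Factorial_Ring.prime p" "a \<in> carrier P" "a [^]\<^bsub>P\<^esub> (p ^ k :: nat) = \<one>\<^bsub>P\<^esub>"
    using assms by (auto simp: P.prime_power_element_def)
  then have "P.ord a dvd p ^ k" using P.pow_eq_id by simp
  then obtain l where "P.ord a = p ^ l" using divides_primepow_nat pk(1) by blast
  moreover have "P.ord a \<noteq> 1" using False pk(2) P.ord_eq_1 by blast
  ultimately have "p dvd P.ord a" by (cases l) auto
  then have "p dvd order P" using P.ord_dvd_group_order[OF pk(2)] dvd_trans by blast
  then have "\<not> p dvd card M" using coprime_M_P pk(1) by (metis coprime_common_divisor not_prime_unit)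
  then show thesis using that pk by blast
qed

lemma prime_power_aligned:
  assumes a: "P.prime_power_element a"
  obtains m where "m \<in> M" "\<alpha> a = conj_by G m (i a)"
proof -
  obtain p k where pk: "Factorial_Ring.prime p" "\<not> p dvd card M" "a [^]\<^bsub>P\<^esub> (p ^ k :: nat) = \<one>\<^bsub>P\<^esub>"
    using prime_power_element_coprime[OF a] .
  have aP: "a \<in> carrier P" using a by (simp add: P.prime_power_element_def)
  show thesis
  proof (rule prime_power_elements_conjugate[OF finite_M M.subgroup_axioms pk(1,2)])
    show "\<alpha> a [^] (p ^ k) = \<one>" "i a [^] (p ^ k) = \<one>"
      using pk(3) aP by (simp_all flip: \<alpha>.hom_nat_pow i.hom_nat_pow)
    show "conj_by G (i a) m \<in> M" if "m \<in> M" for m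
      using conj_by_mem_normal[OF M_normal] aP that by simp
  qed (use aP \<alpha>_cong that in auto)
qed

text \<open>
  Here the factorization of \<open>M\<close> enters. If \<open>\<alpha> a = (i a)\<^sup>m\<close> and \<open>\<phi> = j\<^sup>n\<close> on \<open>C\<close>, write \<open>m n\<^sup>-\<^sup>1 = d\<^sub>1 d\<^sub>2\<close>. Since \<open>d\<^sub>1\<close>
  centralizes \<open>i a\<close> and \<open>d\<^sub>2\<close> centralizes \<open>j(C)\<close>, the element \<open>g = d\<^sub>2 n\<close> serves for both.
\<close>

lemma align_both:
  assumes a: "P.prime_power_element a" and C: "C \<subseteq> carrier P" "aligned C"
  obtains g where "g \<in> M" "\<alpha> a = conj_by G g (i a)" "\<And>c. c \<in> C \<Longrightarrow> \<phi> c = conj_by G g (j c)"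
proof -
  have aP: "a \<in> carrier P" using a by (simp add: P.prime_power_element_def)
  obtain m where m: "m \<in> M" "\<alpha> a = conj_by G m (i a)" using prime_power_aligned[OF a] .
  obtain n where n: "n \<in> M" "\<And>c. c \<in> C \<Longrightarrow> \<phi> c = conj_by G n (j c)" using C(2) unfolding aligned_def by blast
  have "m \<otimes> inv n \<in> D1 <#> D2" using m n M_eq by blast
  then obtain d1 d2 where d: "d1 \<in> D1" "d2 \<in> D2" "m \<otimes> inv n = d1 \<otimes> d2" unfolding set_mult_def by blast
  have carr: "m \<in> carrier G" "n \<in> carrier G" "d1 \<in> carrier G" "d2 \<in> carrier G"
    using m n d D1 D2 M.subset by auto
  have "m = m \<otimes> inv n \<otimes> n" using carr by (simp add: m_assoc)
  then have m_eq: "m = d1 \<otimes> (d2 \<otimes> n)" using d carr by (simp add: m_assoc)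
  show thesis
  proof (rule that)
    show "d2 \<otimes> n \<in> M" using d n D2 by blast
    show "\<alpha> a = conj_by G (d2 \<otimes> n) (i a)"
      using m(2) carr aP D1_central[OF d(1) aP] by (simp add: m_eq conj_by_by_mult)
    show "\<phi> c = conj_by G (d2 \<otimes> n) (j c)" if "c \<in> C" for c
      using n(2)[OF that] carr C(1) that D2_central[OF d(2)] by (simp add: conj_by_by_mult subset_iff)
  qed
qed

text \<open>
  After conjugation by a common \<open>g\<close> this is the relation between \<open>\<alpha> a\<close> and \<open>\<phi> c\<close>. Only \<open>c\<close> and its conjugate
  need to lie in \<open>C\<close>, not \<open>a\<close>; this is what makes induction over proper subgroups \<open>C\<close> useful.
\<close>

lemma conj_by_i_j_of_aligned:
  assumes a: "P.prime_power_element a" and C: "C \<subseteq> carrier P" "aligned C"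
    and c: "c \<in> C" "conj_by P a c \<in> C"
  shows "conj_by G (i a) (j c) = j (conj_by P a c)"
proof -
  have aP: "a \<in> carrier P" using a by (simp add: P.prime_power_element_def)
  obtain g where g: "g \<in> M" "\<alpha> a = conj_by G g (i a)" "\<And>c. c \<in> C \<Longrightarrow> \<phi> c = conj_by G g (j c)"
    by (rule align_both[OF a C]) (rule that)
  have carr: "g \<in> carrier G" "c \<in> carrier P" using g(1) c C by auto
  have "conj_by G g (conj_by G (i a) (j c)) = conj_by G (\<alpha> a) (\<phi> c)"
    using carr aP g(2) g(3)[OF c(1)] conj_by_conj_by[of "i a" g "j c"] by simp
  also have "\<dots> = conj_by G g (j (conj_by P a c))"
    using compatible[OF aP carr(2)] g(3)[OF c(2)] by simp
  finally show ?thesis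
    using carr aP by (subst (asm) conj_by_inj) auto
qed

lemma aligning_subgroup:
  assumes g: "g \<in> carrier G"
  shows "subgroup {x \<in> carrier P. \<phi> x = conj_by G g (j x)} P"
proof (rule P.subgroupI)
  show "{x \<in> carrier P. \<phi> x = conj_by G g (j x)} \<noteq> {}"
    using g by (auto intro!: exI[of _ "\<one>\<^bsub>P\<^esub>"])
qed (use g in \<open>auto simp: conj_by_mult conj_by_inv\<close>)

lemma conj_by_i_j_subgroup:
  assumes a: "a \<in> carrier P"
  shows "subgroup {c \<in> carrier P. conj_by G (i a) (j c) = j (conj_by P a c)} P"
proof (rule P.subgroupI)
  show "{c \<in> carrier P. conj_by G (i a) (j c) = j (conj_by P a c)} \<noteq> {}"
    using a by (auto intro!: exI[of _ "\<one>\<^bsub>P\<^esub>"])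
qed (use a in \<open>auto simp: conj_by_mult conj_by_inv P.conj_by_mult P.conj_by_inv\<close>)

text \<open>
  Let \<open>J = j\<^sup>n\<close> agree with \<open>\<phi>\<close> on \<open>V\<close>, and let \<open>c\<close> be an element of prime power order outside \<open>V\<close>. Both \<open>\<phi> c\<close> and \<open>J c\<close>
  induce the same automorphism on \<open>J(V)\<close>. So they differ by an element of the centralizer \<open>M'\<close> of \<open>J(V)\<close> in \<open>M\<close>,
  and are conjugate under \<open>M'\<close>. Such a conjugation does not disturb the agreement on \<open>V\<close>.
\<close>

lemma aligned_of_normal_maximal:
  assumes V: "P.maximal_subgroup V" "V \<lhd> P" "aligned V"
  shows "aligned (carrier P)"
proof -
  have sub_V: "subgroup V P" using V by (simp add: P.maximal_subgroup_def)
  interpret V: subgroup V P by fact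
  obtain n where n: "n \<in> M" "\<And>x. x \<in> V \<Longrightarrow> \<phi> x = conj_by G n (j x)" using V(3) unfolding aligned_def by blast
  have nG: "n \<in> carrier G" using n by simp
  obtain c where c: "P.prime_power_element c" "c \<notin> V"
    using P.prime_power_elements_generate[OF finite_P sub_V] V(1) unfolding P.maximal_subgroup_def by blast
  have cP: "c \<in> carrier P" using c by (simp add: P.prime_power_element_def)
  obtain p k where pk: "Factorial_Ring.prime p" "\<not> p dvd card M" "c [^]\<^bsub>P\<^esub> (p ^ k :: nat) = \<one>\<^bsub>P\<^esub>"
    using prime_power_element_coprime[OF c(1)] .
  define J where "J x = conj_by G n (j x)" for x
  have J_closed: "J x \<in> carrier G" if "x \<in> carrier P" for x using that nG by (simp add: J_def)
  have J_conj: "J (conj_by P y x) = conj_by G (J y) (J x)" if "x \<in> carrier P" "y \<in> carrier P" for x y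
    using that nG by (simp add: J_def j_conj_by conj_by_conj_by[of "j y" n])
  define M' where "M' = {m \<in> M. \<forall>x \<in> V. m \<otimes> J x = J x \<otimes> m}"
  have M'_M: "M' \<subseteq> M" unfolding M'_def by blast
  have M': "subgroup M' G"
  proof (rule subgroupI)
    have "\<one> \<in> M'" unfolding M'_def using J_closed by simp
    then show "M' \<noteq> {}" by blast
    fix m assume m: "m \<in> M'"
    have "inv m \<otimes> J x = J x \<otimes> inv m" if "x \<in> V" for x
    proof -
      have "m \<in> carrier G" "m \<otimes> J x = J x \<otimes> m" using m that M.subset unfolding M'_def by blast+
      then show ?thesis using inv_commute J_closed that by simp
    qed
    then show "inv m \<in> M'" using m M.m_inv_closed unfolding M'_def by blast
    fix m' assume m': "m' \<in> M'"
    have "m \<otimes> m' \<otimes> J x = J x \<otimes> (m \<otimes> m')" if "x \<in> V" for x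
    proof -
      have *: "m \<in> carrier G" "m \<otimes> J x = J x \<otimes> m" using m that M.subset unfolding M'_def by blast+
      have **: "m' \<in> carrier G" "m' \<otimes> J x = J x \<otimes> m'" using m' that M.subset unfolding M'_def by blast+
      have J: "J x \<in> carrier G" using J_closed that by simp
      have "m \<otimes> m' \<otimes> J x = m \<otimes> (J x \<otimes> m')" using *(1) **(1) J by (simp add: m_assoc **(2))
      also have "\<dots> = (J x \<otimes> m) \<otimes> m'" using *(1) **(1) J by (simp flip: m_assoc add: *(2))
      finally show ?thesis using *(1) **(1) J by (simp add: m_assoc)
    qed
    then show "m \<otimes> m' \<in> M'" using m m' M.m_closed unfolding M'_def by blast
  qed (use M'_M M.subset in blast)
  have finM': "finite M'" using M'_M finite_M finite_subset by blast
  have "card M' dvd card M"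
  proof -
    have "subgroup M' (G\<lparr>carrier := M\<rparr>)" using subgroup_incl[OF M' M.subgroup_axioms M'_M] .
    from group.lagrange[OF M.subgroup_is_group[OF is_group] this] show ?thesis
      by (simp add: order_def) (metis dvd_triv_right)
  qed
  then have ndvd: "\<not> p dvd card M'" using pk(2) dvd_trans by blast
  have V_conj: "conj_by P (inv\<^bsub>P\<^esub> c) x \<in> V" if "x \<in> V" for x
    using P.conj_by_mem_normal[OF V(2)] cP that by simp
  have v_conj: "conj_by G (J c) (J (conj_by P (inv\<^bsub>P\<^esub> c) x)) = J x" if "x \<in> V" for x
    using J_conj[of "conj_by P (inv\<^bsub>P\<^esub> c) x" c] that cP by simp
  obtain m where m: "m \<in> M'" "\<phi> c = conj_by G m (J c)"
  proof (rule prime_power_elements_conjugate[OF finM' M' pk(1) ndvd])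
    show "\<phi> c [^] (p ^ k) = \<one>" using pk(3) cP by (simp flip: \<phi>.hom_nat_pow)
    show "J c [^] (p ^ k) = \<one>" using pk(3) cP nG by (simp add: J_def flip: conj_by_pow j.hom_nat_pow)
    show "conj_by G (J c) m \<in> M'" if "m \<in> M'" for m
    proof -
      have mM: "m \<in> M" using that M'_M by blast
      have "conj_by G (J c) m \<otimes> J x = J x \<otimes> conj_by G (J c) m" if x: "x \<in> V" for x
      proof -
        let ?y = "conj_by P (inv\<^bsub>P\<^esub> c) x"
        have "m \<otimes> J ?y = J ?y \<otimes> m" using \<open>m \<in> M'\<close> V_conj[OF x] unfolding M'_def by blast
        then have "conj_by G (J c) (m \<otimes> J ?y) = conj_by G (J c) (J ?y \<otimes> m)" by simp
        then show ?thesis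
          using J_closed cP V_conj[OF x] mM x by (simp add: conj_by_mult v_conj)
      qed
      moreover have "conj_by G (J c) m \<in> M" using conj_by_mem_normal[OF M_normal J_closed[OF cP] mM] .
      ultimately show ?thesis unfolding M'_def by blast
    qed
    show "inv (J c) \<otimes> \<phi> c \<in> M'"
    proof -
      have "inv (J c) \<otimes> \<phi> c = inv n \<otimes> conj_by G (j c) n \<otimes> (inv (j c) \<otimes> \<phi> c)"
        using cP nG by (simp add: J_def conj_by_def m_assoc inv_mult_group)
      also have "\<dots> \<in> M"
        using n(1) conj_by_mem_normal[OF M_normal, of "j c" n] \<phi>_cong[OF cP] cP by simp
      finally have mem: "inv (J c) \<otimes> \<phi> c \<in> M" .
      have "inv (J c) \<otimes> \<phi> c \<otimes> J x = J x \<otimes> (inv (J c) \<otimes> \<phi> c)" if x: "x \<in> V" for x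
      proof -
        let ?y = "conj_by P (inv\<^bsub>P\<^esub> c) x"
        have y: "?y \<in> V" using V_conj[OF x] .
        have Jy: "conj_by G (inv (J c)) (J x) = J ?y"
          using v_conj[OF x] J_closed cP y by (metis V.mem_carrier conj_by_inv_cancel(1))
        have "conj_by G (inv (J c) \<otimes> \<phi> c) (J x) = conj_by G (\<phi> c) (J ?y)"
          using J_closed cP x Jy by (simp add: conj_by_by_mult)
        also have "\<dots> = conj_by G (\<phi> c) (\<phi> ?y)" using n(2)[OF y] by (simp add: J_def)
        also have "\<dots> = \<phi> (conj_by P c ?y)" using cP y by (simp add: conj_by_def)
        also have "\<dots> = J x" using cP x n(2)[OF x] by (simp add: J_def)
        finally show ?thesis
          using J_closed cP x by (subst (asm) conj_by_fixed_iff) auto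
      qed
      then show ?thesis using mem unfolding M'_def by blast
    qed
  qed (use cP J_closed in auto)
  have mG: "m \<in> carrier G" using m(1) M'_M M.subset by blast
  let ?T = "{x \<in> carrier P. \<phi> x = conj_by G (n \<otimes> m) (j x)}"
  have "subgroup ?T P" by (rule aligning_subgroup) (use nG mG in simp)
  moreover have "V \<subseteq> ?T"
  proof
    fix x assume x: "x \<in> V"
    have "m \<otimes> J x = J x \<otimes> m" using m(1) x unfolding M'_def by blast
    then have "conj_by G m (J x) = J x" using conj_by_commute[OF mG] J_closed x by simp
    then show "x \<in> ?T" using n(2)[OF x] x nG mG by (simp add: conj_by_by_mult J_def)
  qed
  moreover have "c \<in> ?T" using m(2) cP nG mG by (simp add: conj_by_by_mult J_def)
  ultimately have "?T = carrier P" using V(1) c(2) unfolding P.maximal_subgroup_def by blast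
  moreover have "n \<otimes> m \<in> M" using n(1) m(1) M'_M by blast
  ultimately show ?thesis unfolding aligned_def by blast
qed

text \<open>
  The induction step for the conjugacy of \<open>\<phi>\<close> and \<open>j\<close>. If it fails, then no maximal subgroup is normal, by the
  previous lemma. Let \<open>H a\<close> consist of the \<open>c\<close> for which \<open>a\<close> and \<open>c\<close> satisfy the wanted relation.
\<close>

lemma aligned_step:
  assumes proper: "\<And>C. subgroup C P \<Longrightarrow> C \<noteq> carrier P \<Longrightarrow> aligned C"
  shows "aligned (carrier P)"
proof (rule ccontr)
  assume not_aligned: "\<not> aligned (carrier P)"
  have "carrier P \<noteq> {\<one>\<^bsub>P\<^esub>}"
  proof
    assume "carrier P = {\<one>\<^bsub>P\<^esub>}"
    then have "aligned (carrier P)" unfolding aligned_def by (intro bexI[of _ \<one>]) auto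
    then show False using not_aligned by simp
  qed
  then obtain V0 where V0: "P.maximal_subgroup V0"
    using P.proper_subgroup_le_maximal[OF finite_P P.triv_subgroup] by metis
  have subgroup_max: "subgroup V P" "V \<noteq> carrier P" if "P.maximal_subgroup V" for V
    using that by (simp_all add: P.maximal_subgroup_def)
  have nonnormal: "\<not> V \<lhd> P" if "P.maximal_subgroup V" for V
    using aligned_of_normal_maximal[OF that] proper[OF subgroup_max[OF that]] not_aligned by blast
  have not_all: "\<exists>x \<in> carrier P. \<phi> x \<noteq> conj_by G g (j x)" if "g \<in> M" for g
    using not_aligned that unfolding aligned_def by blast
  define H where "H a = {c \<in> carrier P. conj_by G (i a) (j c) = j (conj_by P a c)}" for a
  have mem_H: "c \<in> H a" if "P.prime_power_element a" "subgroup C P" "C \<noteq> carrier P" "c \<in> C" "conj_by P a c \<in> C"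
    for a c C
    using conj_by_i_j_of_aligned[OF that(1) subgroup.subset[OF that(2)] proper[OF that(2,3)] that(4,5)]
      subgroup.mem_carrier[OF that(2,4)] by (simp add: H_def)
  show False
  proof (cases "\<forall>a. P.prime_power_element a \<longrightarrow> H a = carrier P")
    case True
    \<comment> \<open>The elements aligned by \<open>g\<close> form a subgroup that \<open>a\<close> normalizes, and that is \<open>V0\<close> by maximality.\<close>
    obtain a where a: "P.prime_power_element a" "a \<notin> V0"
      using P.prime_power_elements_generate[OF finite_P] subgroup_max[OF V0] by blast
    have aP: "a \<in> carrier P" using a by (simp add: P.prime_power_element_def)
    obtain g where g: "g \<in> M" "\<alpha> a = conj_by G g (i a)" "\<And>c. c \<in> V0 \<Longrightarrow> \<phi> c = conj_by G g (j c)"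
      using align_both[OF a(1) subgroup.subset proper] subgroup_max[OF V0] by metis
    have gG: "g \<in> carrier G" using g(1) by simp
    let ?T = "{x \<in> carrier P. \<phi> x = conj_by G g (j x)}"
    have "?T \<noteq> carrier P" using not_all[OF g(1)] by blast
    moreover have "V0 \<subseteq> ?T" using g(3) subgroup.subset[OF subgroup_max(1)[OF V0]] by blast
    ultimately have T: "?T = V0"
      using aligning_subgroup[OF gG] V0 unfolding P.maximal_subgroup_def by blast
    have "conj_by P a x \<in> V0" if "x \<in> V0" for x
    proof -
      have x: "x \<in> carrier P" using subgroup.mem_carrier[OF subgroup_max(1)[OF V0] that] .
      then have "x \<in> H a" using True a(1) by simp
      then have "\<phi> (conj_by P a x) = conj_by G g (j (conj_by P a x))"
        using x aP gG g(2) g(3)[OF that] compatible[OF aP x] conj_by_conj_by[of "i a" g "j x"]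
        by (simp add: H_def)
      then have "conj_by P a x \<in> ?T" using x aP by simp
      then show ?thesis using T by blast
    qed
    then have "a \<in> V0"
      using P.normalizer_of_maximal_subgroup[OF finite_P V0 nonnormal[OF V0]] aP by blast
    then show False using a(2) by simp
  next
    case False
    then obtain a where a: "P.prime_power_element a" "H a \<noteq> carrier P" by blast
    have aP: "a \<in> carrier P" using a by (simp add: P.prime_power_element_def)
    have sub_H: "subgroup (H a) P" unfolding H_def by (rule conj_by_i_j_subgroup[OF aP])
    \<comment> \<open>\<open>H a\<close> contains each proper subgroup that contains \<open>a\<close>, so it is the only maximal subgroup with this
      property.\<close>
    have le_H: "C \<subseteq> H a" if "subgroup C P" "C \<noteq> carrier P" "a \<in> C" for C
      using mem_H[OF a(1) that(1,2)] P.subgroup_conj_by_mem[OF that(1,3)] by blast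
    have normal_le_H: "C \<subseteq> H a" if "C \<lhd> P" "C \<noteq> carrier P" for C
      using mem_H[OF a(1) normal_imp_subgroup[OF that(1)] that(2)] P.conj_by_mem_normal[OF that(1) aP] by blast
    have "generate P {a} \<noteq> carrier P"
      by (rule P.generate_singleton_proper[OF subgroup_max(1)[OF V0] nonnormal[OF V0] aP])
    then have "a \<in> H a"
      using le_H[OF P.generate_is_subgroup, of "{a}"] aP generate.incl[of a "{a}" P] by blast
    then have max_H: "P.maximal_subgroup (H a)"
      using sub_H a(2) le_H unfolding P.maximal_subgroup_def by blast
    have "V1 \<inter> V2 \<subseteq> H a"
      if V: "P.maximal_subgroup V1" "P.maximal_subgroup V2" "V1 \<noteq> V2" for V1 V2
    proof (rule ccontr)
      assume not_le: "\<not> V1 \<inter> V2 \<subseteq> H a"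
      obtain g1 where g1: "g1 \<in> M" "\<alpha> a = conj_by G g1 (i a)" "\<And>c. c \<in> V1 \<Longrightarrow> \<phi> c = conj_by G g1 (j c)"
        using align_both[OF a(1) subgroup.subset proper] subgroup_max[OF V(1)] by metis
      obtain g2 where g2: "g2 \<in> M" "\<alpha> a = conj_by G g2 (i a)" "\<And>c. c \<in> V2 \<Longrightarrow> \<phi> c = conj_by G g2 (j c)"
        using align_both[OF a(1) subgroup.subset proper] subgroup_max[OF V(2)] by metis
      have gG: "g1 \<in> carrier G" "g2 \<in> carrier G" using g1(1) g2(1) by auto
      \<comment> \<open>\<open>?T\<close> is where the two alignments agree. It is normalized by \<open>a\<close> and contains \<open>V1 \<inter> V2\<close>, so \<open>?T\<close> and \<open>a\<close> lie
        in no common proper subgroup, and \<open>?T\<close> is normal. If it is all of \<open>P\<close>, then \<open>g1\<close> aligns \<open>V2\<close> as well.\<close>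
      let ?T = "{x \<in> carrier P. conj_by G (inv g1) (\<phi> x) = conj_by G (inv g2) (\<phi> x)}"
      have sub_T: "subgroup ?T P"
      proof (rule P.subgroupI)
        show "?T \<noteq> {}" using gG by (auto intro!: exI[of _ "\<one>\<^bsub>P\<^esub>"])
      qed (use gG in \<open>auto simp: conj_by_mult conj_by_inv\<close>)
      have V_T: "V1 \<inter> V2 \<subseteq> ?T"
      proof
        fix x assume x: "x \<in> V1 \<inter> V2"
        then have xP: "x \<in> carrier P" using subgroup.mem_carrier[OF subgroup_max(1)[OF V(1)]] by blast
        have "conj_by G (inv g1) (\<phi> x) = j x" using x xP gG by (simp add: g1(3))
        moreover have "conj_by G (inv g2) (\<phi> x) = j x" using x xP gG by (simp add: g2(3))
        ultimately show "x \<in> ?T" using xP by simp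
      qed
      have shift: "conj_by G (inv g) (\<phi> (conj_by P a x)) = conj_by G (i a) (conj_by G (inv g) (\<phi> x))"
        if "g \<in> carrier G" "\<alpha> a = conj_by G g (i a)" "x \<in> carrier P" for g x
        using that aP conj_by_conj_by[of "\<alpha> a" "inv g" "\<phi> x"] by (simp add: compatible[symmetric])
      have T_a: "conj_by P a x \<in> ?T" if "x \<in> ?T" for x
        using that aP shift[OF gG(1) g1(2)] shift[OF gG(2) g2(2)] by simp
      let ?L = "{g \<in> carrier P. \<forall>s \<in> ?T. conj_by P g s \<in> ?T}"
      have sub_L: "subgroup ?L P" by (rule P.normalizer_of_subgroup[OF finite_P subgroup.subset[OF sub_T]])
      have a_L: "a \<in> ?L" using aP T_a by blast
      have T_L: "?T \<subseteq> ?L" using P.subgroup_conj_by_mem[OF sub_T] subgroup.subset[OF sub_T] by blast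
      have "?L = carrier P"
      proof (rule ccontr)
        assume "?L \<noteq> carrier P"
        from V_T T_L le_H[OF sub_L this a_L] have "V1 \<inter> V2 \<subseteq> H a" by (meson subset_trans)
        then show False using not_le by contradiction
      qed
      then have T_normal: "?T \<lhd> P" by (rule P.normal_of_normalizer_eq_carrier[OF sub_T])
      have T: "?T = carrier P"
      proof (rule ccontr)
        assume "?T \<noteq> carrier P"
        from V_T normal_le_H[OF T_normal this] have "V1 \<inter> V2 \<subseteq> H a" by (rule subset_trans)
        then show False using not_le by contradiction
      qed
      let ?S = "{x \<in> carrier P. \<phi> x = conj_by G g1 (j x)}"
      have "V2 \<subseteq> ?S"
      proof
        fix x assume x: "x \<in> V2"
        then have xP: "x \<in> carrier P" using subgroup.mem_carrier[OF subgroup_max(1)[OF V(2)]] by blast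
        then have "x \<in> ?T" using T by blast
        then have "conj_by G (inv g1) (\<phi> x) = j x" using x xP gG by (simp add: g2(3))
        then have "\<phi> x = conj_by G g1 (j x)" using gG xP by (metis \<phi>.hom_closed conj_by_inv_cancel(2))
        then show "x \<in> ?S" using xP by simp
      qed
      moreover have "V1 \<subseteq> ?S" using g1(3) subgroup.subset[OF subgroup_max(1)[OF V(1)]] by blast
      moreover have "?S \<noteq> carrier P" using not_all[OF g1(1)] by blast
      ultimately have "V1 = ?S" "V2 = ?S"
        using aligning_subgroup[OF gG(1)] V(1,2) unfolding P.maximal_subgroup_def by blast+
      then show False using V(3) by simp
    qed
    then show False
      using P.maximal_subgroups_not_all_meet_within[OF finite_P max_H nonnormal] by blast
  qed
qed

text \<open>
  Only \<open>P\<close> shrinks, so the notion of alignment is the same for \<open>C\<close> and for \<open>P\<close>.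
\<close>

lemma lifted_pair_subgroup:
  assumes C: "subgroup C P"
  shows "lifted_pair G (P\<lparr>carrier := C\<rparr>) M D1 D2 i j \<alpha> \<phi>"
proof -
  interpret C: subgroup C P by fact
  have conj: "conj_by (P\<lparr>carrier := C\<rparr>) a c = conj_by P a c" if "a \<in> C" for a c
    using that P.m_inv_consistent[OF C] by (simp add: conj_by_def)
  have "card C dvd order P" using P.lagrange[OF C] by (metis dvd_triv_right)
  then have "coprime (card M) (card C)" using coprime_divisors[OF dvd_refl _ coprime_M_P] by blast
  moreover have "f \<in> hom (P\<lparr>carrier := C\<rparr>) G" if "f \<in> hom P G" for f
    using that C.subset by (auto simp: hom_def)
  moreover have "finite C" using C.subset finite_P finite_subset by blast
  moreover have "group (P\<lparr>carrier := C\<rparr>)" by (rule C.subgroup_is_group) (rule P.is_group)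
  ultimately show ?thesis
    using finite_M M_normal i_hom j_hom \<alpha>_hom \<phi>_hom \<alpha>_cong \<phi>_cong compatible D1 D2 M_eq D1_central D2_central
    by (intro lifted_pair.intro lifted_pair_axioms.intro is_group) (auto simp: order_def conj)
qed

lemma aligned_subgroup:
  assumes "subgroup C P"
  shows "aligned C"
  using assms
proof (induction "card C" arbitrary: C rule: less_induct)
  case less
  interpret C: lifted_pair G "P\<lparr>carrier := C\<rparr>" M D1 D2 i j \<alpha> \<phi>
    by (rule lifted_pair_subgroup[OF less.prems])
  have "aligned A" if "subgroup A (P\<lparr>carrier := C\<rparr>)" "A \<noteq> C" for A
  proof (rule less.hyps)
    have "A \<subset> C" using that subgroup.subset by fastforce
    then show "card A < card C" using C.finite_P by (simp add: psubset_card_mono)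
    show "subgroup A P" using P.incl_subgroup[OF less.prems that(1)] .
  qed
  then show ?case using C.aligned_step by simp
qed

theorem conj_by_i_j:
  assumes "a \<in> carrier P" "c \<in> carrier P"
  shows "conj_by G (i a) (j c) = j (conj_by P a c)"
proof -
  let ?T = "{a \<in> carrier P. \<forall>c \<in> carrier P. conj_by G (i a) (j c) = j (conj_by P a c)}"
  have "subgroup ?T P"
  proof (rule P.subgroupI)
    show "?T \<noteq> {}" by (auto intro!: exI[of _ "\<one>\<^bsub>P\<^esub>"])
    fix a assume a: "a \<in> ?T"
    have "conj_by G (i (inv\<^bsub>P\<^esub> a)) (j c) = j (conj_by P (inv\<^bsub>P\<^esub> a) c)" if c: "c \<in> carrier P" for c
    proof -
      have aP: "a \<in> carrier P" using a by simp
      have "conj_by G (i a) (j (conj_by P (inv\<^bsub>P\<^esub> a) c)) = j c" using a c by simp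
      then have "conj_by G (inv (i a)) (j c) = j (conj_by P (inv\<^bsub>P\<^esub> a) c)"
        using aP c by (metis P.conj_by_closed P.inv_closed conj_by_inv_cancel(1) i.hom_closed j.hom_closed)
      then show ?thesis using aP by simp
    qed
    then show "inv\<^bsub>P\<^esub> a \<in> ?T" using a by simp
    fix b assume b: "b \<in> ?T"
    then show "a \<otimes>\<^bsub>P\<^esub> b \<in> ?T" using a by (simp add: conj_by_by_mult P.conj_by_by_mult)
  qed auto
  moreover have "a \<in> ?T" if "P.prime_power_element a" for a
    using conj_by_i_j_of_aligned[OF that subset_refl aligned_subgroup[OF P.subgroup_self]] that
    by (simp add: P.prime_power_element_def)
  ultimately have "?T = carrier P" by (intro P.prime_power_elements_generate finite_P)
  then show ?thesis using assms by blast
qed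

end


section \<open>Factorized normal subgroups of coprime order\<close>

context group
begin

lemma set_mult_normalizing_subgroup:
  assumes A: "subgroup A G" and B: "subgroup B G"
    and norm: "\<And>a b. a \<in> A \<Longrightarrow> b \<in> B \<Longrightarrow> conj_by G b a \<in> A"
  shows "subgroup (A <#> B) G"
proof (rule subgroupI)
  interpret A: subgroup A G by fact
  interpret B: subgroup B G by fact
  show "A <#> B \<subseteq> carrier G" by (auto simp: set_mult_def)
  have "\<one> \<otimes> \<one> \<in> A <#> B" unfolding set_mult_def using A.one_closed B.one_closed by blast
  then show "A <#> B \<noteq> {}" by blast
  fix x assume "x \<in> A <#> B"
  then obtain a b where ab: "a \<in> A" "b \<in> B" "x = a \<otimes> b" unfolding set_mult_def by blast
  have "inv x = conj_by G b (inv a) \<otimes> inv b"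
    using ab by (simp add: conj_by_def inv_mult_group m_assoc)
  moreover have "conj_by G b (inv a) \<in> A" "inv b \<in> B" using ab norm by auto
  ultimately show "inv x \<in> A <#> B" unfolding set_mult_def by blast
  fix y assume "y \<in> A <#> B"
  then obtain c d where cd: "c \<in> A" "d \<in> B" "y = c \<otimes> d" unfolding set_mult_def by blast
  have "x \<otimes> y = (a \<otimes> conj_by G (inv b) c) \<otimes> (b \<otimes> d)"
    using ab cd by (simp add: conj_by_def m_assoc)
  moreover have "a \<otimes> conj_by G (inv b) c \<in> A" "b \<otimes> d \<in> B" using ab cd norm[OF cd(1), of "inv b"] by auto
  ultimately show "x \<otimes> y \<in> A <#> B" unfolding set_mult_def by blast
qed

text \<open>
  Being described by an equation, a normal Hall subgroup is characteristic.
\<close>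

lemma normal_hall_subgroup_eq_torsion:
  assumes fin: "finite (carrier G)" and N: "N \<lhd> G" and cop: "coprime (card N) (order G div card N)"
    and x: "x \<in> carrier G"
  shows "x \<in> N \<longleftrightarrow> x [^] card N = \<one>"
proof
  interpret N: normal N G by fact
  interpret GN: group "G\<lparr>carrier := N\<rparr>" by (rule N.subgroup_is_group) (rule is_group)
  interpret F: group "G Mod N" by (rule N.factorgroup_is_group)
  show "x [^] card N = \<one>" if "x \<in> N"
    using GN.pow_order_eq_1[of x] that by (simp add: order_def flip: nat_pow_consistent)
  assume pow: "x [^] card N = \<one>"
  have card_N: "card N > 0" using N.finite_imp_card_positive fin by blast
  have index: "order (G Mod N) = order G div card N"
    using lagrange[OF N.subgroup_axioms] card_N by (metis FactGroup_def div_mult_self_is_m order_def partial_object.select_convs(1))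
  have "(N #> x) [^]\<^bsub>G Mod N\<^esub> order (G Mod N) = \<one>\<^bsub>G Mod N\<^esub>"
    using x by (intro F.pow_order_eq_1) (auto simp: carrier_FactGroup)
  then have "N #> (x [^] order (G Mod N)) = N"
    using x by (simp add: N.FactGroup_pow)
  then have mem: "x [^] order (G Mod N) \<in> N"
    using coset_join1[OF _ _ N.subgroup_axioms] x by simp
  obtain e y where e: "card N * e = order (G Mod N) * y + 1"
    using bezout_nat[of "card N" "order (G Mod N)"] card_N cop
    by (auto simp: index coprime_iff_gcd_eq_1)
  have "x [^] (card N * e) = \<one>" using pow x by (simp flip: nat_pow_pow)
  then have "(x [^] order (G Mod N)) [^] y \<otimes> x = \<one>"
    unfolding e using x by (simp add: nat_pow_pow)
  then have "x = inv ((x [^] order (G Mod N)) [^] y)"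
    using x by (metis inv_equality inv_inv nat_pow_closed)
  moreover have "(x [^] order (G Mod N)) [^] y \<in> N"
    using GN.nat_pow_closed[of "x [^] order (G Mod N)" y] mem by (simp flip: nat_pow_consistent)
  ultimately show "x \<in> N" by (metis N.m_inv_closed)
qed

text \<open>
  The hypothesis \<open>twist\<close> makes \<open>U = M j(P) i(P)\<close> a subgroup whose index over \<open>M\<close> divides the square of the order of
  \<open>P\<close>, and makes the lifts of \<open>i\<close> and \<open>j\<close> to a complement of \<open>M\<close> in \<open>U\<close> compatible.
\<close>

theorem coprime_factorization_conj_by:
  fixes P :: "('p, 'q) monoid_scheme"
  assumes fin: "finite (carrier G)" and "group P" and finP: "finite (carrier P)"
    and M: "M \<lhd> G" and cop: "coprime (card M) (order P)"
    and i: "i \<in> hom P G" and j: "j \<in> hom P G"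
    and twist: "\<And>a c. a \<in> carrier P \<Longrightarrow> c \<in> carrier P
      \<Longrightarrow> \<exists>m \<in> M. j c \<otimes> i a = m \<otimes> (i a \<otimes> j (conj_by P a c))"
    and D: "D1 \<subseteq> M" "D2 \<subseteq> M" "M \<subseteq> D1 <#> D2"
    and D1_central: "\<And>d a. d \<in> D1 \<Longrightarrow> a \<in> carrier P \<Longrightarrow> d \<otimes> i a = i a \<otimes> d"
    and D2_central: "\<And>d a. d \<in> D2 \<Longrightarrow> a \<in> carrier P \<Longrightarrow> d \<otimes> j a = j a \<otimes> d"
    and ac: "a \<in> carrier P" "c \<in> carrier P"
  shows "j c \<otimes> i a = i a \<otimes> j (conj_by P a c)"
proof -
  interpret P: group P by fact
  interpret M: normal M G by fact
  interpret i: group_hom P G i by unfold_locales (rule i)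
  interpret j: group_hom P G j by unfold_locales (rule j)
  let ?A = "i ` carrier P" and ?C = "j ` carrier P"
  have A: "subgroup ?A G" and C: "subgroup ?C G" using i.img_is_subgroup j.img_is_subgroup by auto
  have MC: "subgroup (M <#> ?C) G"
    using conj_by_mem_normal[OF M] by (intro set_mult_normalizing_subgroup M.subgroup_axioms C) auto
  have conj_ij: "conj_by G (i a) (j c) \<in> M <#> ?C" if ac': "a \<in> carrier P" "c \<in> carrier P" for a c
  proof -
    obtain m where m: "m \<in> M" "j c \<otimes> i a = m \<otimes> (i a \<otimes> j (conj_by P a c))" using twist[OF ac'] by blast
    have "conj_by G (i a) (j c) = conj_by G (i a) m \<otimes> j (conj_by P a c)"
      using m that by (simp add: conj_by_def m_assoc)
    moreover have "conj_by G (i a) m \<in> M" using conj_by_mem_normal[OF M] m(1) that by simp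
    ultimately show ?thesis using that unfolding set_mult_def by blast
  qed
  have M_MC: "M \<subseteq> M <#> ?C"
  proof
    fix m assume m: "m \<in> M"
    then have "m = m \<otimes> \<one>" by simp
    then show "m \<in> M <#> ?C" using m subgroup.one_closed[OF C] unfolding set_mult_def by blast
  qed
  define U where "U = (M <#> ?C) <#> ?A"
  have U: "subgroup U G"
    unfolding U_def
  proof (rule set_mult_normalizing_subgroup[OF MC A])
    fix x y assume "x \<in> M <#> ?C" "y \<in> ?A"
    then obtain m c a where x: "m \<in> M" "c \<in> carrier P" "x = m \<otimes> j c" and y: "a \<in> carrier P" "y = i a"
      unfolding set_mult_def by blast
    have "conj_by G (i a) m \<in> M <#> ?C"
      using subsetD[OF M_MC conj_by_mem_normal[OF M _ x(1)]] y(1) by simp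
    then have "conj_by G (i a) m \<otimes> conj_by G (i a) (j c) \<in> M <#> ?C"
      using conj_ij[OF y(1) x(2)] subgroup.m_closed[OF MC] x y by simp
    then show "conj_by G y x \<in> M <#> ?C" using x y by (simp add: conj_by_mult)
  qed
  interpret U: subgroup U G by (rule U)
  let ?U = "G\<lparr>carrier := U\<rparr>"
  interpret GU: group ?U by (rule U.subgroup_is_group) (rule is_group)
  have MC_U: "M <#> ?C \<subseteq> U"
  proof
    fix m assume m: "m \<in> M <#> ?C"
    then have "m = m \<otimes> \<one>" using subgroup.mem_carrier[OF MC] by simp
    then show "m \<in> U" using m subgroup.one_closed[OF A] unfolding U_def set_mult_def by blast
  qed
  have i_U: "i a \<in> U" if "a \<in> carrier P" for a
  proof -
    have "i a = \<one> \<otimes> i a" using that by simp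
    then show ?thesis using that subgroup.one_closed[OF MC] unfolding U_def set_mult_def by blast
  qed
  have j_U: "j c \<in> U" if "c \<in> carrier P" for c
  proof -
    have "j c = \<one> \<otimes> j c" using that by simp
    then have "j c \<in> M <#> ?C" using that M.one_closed unfolding set_mult_def by blast
    then show ?thesis using MC_U by blast
  qed
  have M_U: "M \<subseteq> U" using M_MC MC_U by blast
  have normal_U: "M \<lhd> ?U" using normal_Int_subgroup[OF U M] M_U by (simp add: Int_absorb2)
  have card_M: "card M > 0" using M.finite_imp_card_positive fin by blast
  have cop_U: "coprime (card M) (order ?U div card M)"
  proof -
    let ?x = "card (M \<inter> ?C)" and ?y = "card ((M <#> ?C) \<inter> ?A)"
    have "card (M <#> ?C) * ?x = card M * card ?C"
      by (rule card_set_mult_subgroups[OF fin M.subgroup_axioms C])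
    moreover have "card U * ?y = card (M <#> ?C) * card ?A"
      unfolding U_def by (rule card_set_mult_subgroups[OF fin MC A])
    ultimately have "card U * ?y * ?x = card M * (card ?C * card ?A)"
      by (metis mult.assoc mult.commute)
    moreover obtain q where q: "card U = q * card M"
      using GU.lagrange[of M] normal_imp_subgroup[OF normal_U] by (simp add: order_def) (metis)
    ultimately have "card M * (q * ?y * ?x) = card M * (card ?C * card ?A)" by (simp add: ac_simps)
    then have "q * (?y * ?x) = card ?C * card ?A" using card_M by simp
    then have "q dvd card ?C * card ?A" by (metis dvd_triv_left)
    moreover have "card ?C dvd order P" "card ?A dvd order P"
      using i.card_image_mult_card_kernel[OF P.subgroup_self] j.card_image_mult_card_kernel[OF P.subgroup_self]
      by (metis order_def dvd_triv_left)+
    ultimately have "q dvd order P * order P" by (meson dvd_trans mult_dvd_mono)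
    then have "coprime (card M) q" using cop coprime_divisors[OF dvd_refl, of q "order P * order P" "card M"] by simp
    then show ?thesis using q card_M by (simp add: order_def)
  qed
  have "finite (carrier ?U)" using fin U.subset finite_subset by auto
  from GU.schur_zassenhaus[OF this normal_U cop_U] obtain K
    where K: "subgroup K ?U" "M \<inter> K = {\<one>}" "U = M <#> K" by auto
  have K_G: "subgroup K G" using incl_subgroup[OF U K(1)] .
  interpret K: subgroup K G by (rule K_G)
  have K_unique: "x = y" if "x \<in> K" "y \<in> K" "M #> x = M #> y" for x y
  proof -
    have "x \<in> M #> y" using rcos_self[OF _ M.subgroup_axioms, of x] that by simp
    then obtain m where m: "m \<in> M" "x = m \<otimes> y" unfolding r_coset_def by blast
    then have "m = x \<otimes> inv y" using that by (simp add: m_assoc)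
    moreover have "x \<otimes> inv y \<in> K" using that by simp
    ultimately have "m \<in> M \<inter> K" using m by simp
    then show ?thesis using K(2) m that by simp
  qed
  \<comment> \<open>\<open>r\<close> is the retraction of \<open>U\<close> onto \<open>K\<close> with kernel \<open>M\<close>.\<close>
  define r where "r x = (SOME k. k \<in> K \<and> M #> k = M #> x)" for x
  have r: "r x \<in> K" "M #> r x = M #> x" if x: "x \<in> U" for x
  proof -
    obtain m k where mk: "m \<in> M" "k \<in> K" "x = m \<otimes> k" using x K(3) unfolding set_mult_def by blast
    then have "x \<in> M #> k" unfolding r_coset_def by blast
    then have "M #> k = M #> x" using repr_independence[OF _ _ M.subgroup_axioms] mk by simp
    then have "\<exists>k. k \<in> K \<and> M #> k = M #> x" using mk by blast
    then have "r x \<in> K \<and> M #> r x = M #> x" unfolding r_def by (rule someI_ex)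
    then show "r x \<in> K" "M #> r x = M #> x" by auto
  qed
  have r_carrier: "r x \<in> carrier G" if "x \<in> U" for x using r(1)[OF that] by simp
  have r_mult: "r (x \<otimes> y) = r x \<otimes> r y" if "x \<in> U" "y \<in> U" for x y
  proof (rule K_unique)
    show "M #> r (x \<otimes> y) = M #> (r x \<otimes> r y)"
      using r[OF that(1)] r[OF that(2)] r(2)[of "x \<otimes> y"] that r_carrier
      by (simp flip: M.rcos_sum)
  qed (use that r in auto)
  have r_mod: "inv x \<otimes> r x \<in> M" if x: "x \<in> U" for x
  proof -
    have "r x \<in> M #> x" using rcos_self[OF r_carrier[OF x] M.subgroup_axioms] r(2)[OF x] by simp
    then obtain m where m: "m \<in> M" "r x = m \<otimes> x" unfolding r_coset_def by blast
    then have "inv x \<otimes> r x = conj_by G x m" using x by (simp add: conj_by_def m_assoc)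
    then show ?thesis using conj_by_mem_normal[OF M] m x by simp
  qed
  have r_i: "(\<lambda>a. r (i a)) \<in> hom P G" and r_j: "(\<lambda>a. r (j a)) \<in> hom P G"
    using r_carrier i_U j_U r_mult by (auto simp: hom_def)
  have compat: "conj_by G (r (i a)) (r (j c)) = r (j (conj_by P a c))"
    if ac': "a \<in> carrier P" "c \<in> carrier P" for a c
  proof -
    have U_mem: "i a \<in> U" "j c \<in> U" "j (conj_by P a c) \<in> U" using that i_U j_U by auto
    obtain m where m: "m \<in> M" "j c \<otimes> i a = m \<otimes> (i a \<otimes> j (conj_by P a c))" using twist[OF ac'] by blast
    have mU: "m \<in> U" using m(1) M_U by blast
    have "M #> m = M" using coset_join2[OF _ M.subgroup_axioms m(1)] m(1) by simp
    then have "M #> r m = M #> \<one>" using r(2)[OF mU] M.subset by simp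
    then have "r m = \<one>" by (rule K_unique[OF r(1)[OF mU] K.one_closed])
    then have "r (j c) \<otimes> r (i a) = r (i a) \<otimes> r (j (conj_by P a c))"
      using arg_cong[OF m(2), of r] mU U_mem r_carrier
      by (simp add: r_mult)
    then show ?thesis
      using U_mem r_carrier by (simp add: conj_by_def m_assoc)
  qed
  interpret lifted_pair G P M D1 D2 i j "\<lambda>a. r (i a)" "\<lambda>a. r (j a)"
  proof (unfold_locales)
    show "finite M" using fin M.subset finite_subset by blast
    have D_carr: "D1 \<subseteq> carrier G" "D2 \<subseteq> carrier G" using D M.subset by blast+
    show "conj_by G d (i a) = i a" if "d \<in> D1" "a \<in> carrier P" for d a
      using that D_carr D1_central by (intro conj_by_commute) auto
    show "conj_by G d (j a) = j a" if "d \<in> D2" "a \<in> carrier P" for d a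
      using that D_carr D2_central by (intro conj_by_commute) auto
  qed (use assms r_i r_j compat r_mod i_U j_U in auto)
  have "conj_by G (i a) (j c) = j (conj_by P a c)" by (rule conj_by_i_j[OF ac])
  then have "i a \<otimes> conj_by G (i a) (j c) = i a \<otimes> j (conj_by P a c)" by simp
  then show ?thesis using ac by (simp add: conj_by_def m_assoc)
qed

end


section \<open>Ideals and the holomorph of a skew brace\<close>

context skew_brace
begin

lemma a_closed [simp, intro]: "a \<in> carrier B \<Longrightarrow> b \<in> carrier B \<Longrightarrow> a \<oplus> b \<in> carrier B"
  using add.m_closed by simp

lemma zero_closed [simp, intro]: "\<zero> \<in> carrier B"
  using add.one_closed by simp

lemma a_inv_closed [simp, intro]: "a \<in> carrier B \<Longrightarrow> \<ominus> a \<in> carrier B"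
  using add.inv_closed by (simp add: a_inv_def)

lemma a_assoc: "a \<in> carrier B \<Longrightarrow> b \<in> carrier B \<Longrightarrow> c \<in> carrier B \<Longrightarrow> a \<oplus> b \<oplus> c = a \<oplus> (b \<oplus> c)"
  using add.m_assoc by simp

lemma a_unit [simp]: "a \<in> carrier B \<Longrightarrow> \<zero> \<oplus> a = a" "a \<in> carrier B \<Longrightarrow> a \<oplus> \<zero> = a"
  using add.l_one add.r_one by simp_all

lemma a_inverse [simp]: "a \<in> carrier B \<Longrightarrow> \<ominus> a \<oplus> a = \<zero>" "a \<in> carrier B \<Longrightarrow> a \<oplus> \<ominus> a = \<zero>"
  using add.l_inv add.r_inv by (simp_all add: a_inv_def)

lemma a_cancel [simp]:
  "a \<in> carrier B \<Longrightarrow> b \<in> carrier B \<Longrightarrow> \<ominus> a \<oplus> (a \<oplus> b) = b"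
  "a \<in> carrier B \<Longrightarrow> b \<in> carrier B \<Longrightarrow> a \<oplus> (\<ominus> a \<oplus> b) = b"
  by (simp_all flip: a_assoc)

lemma a_inv_a_inv [simp]: "a \<in> carrier B \<Longrightarrow> \<ominus> (\<ominus> a) = a"
  using add.inv_inv by (simp add: a_inv_def)

lemma a_inv_add: "a \<in> carrier B \<Longrightarrow> b \<in> carrier B \<Longrightarrow> \<ominus> (a \<oplus> b) = \<ominus> b \<oplus> \<ominus> a"
  using add.inv_mult_group by (simp add: a_inv_def)

lemma a_left_cancel: "a \<in> carrier B \<Longrightarrow> b \<in> carrier B \<Longrightarrow> c \<in> carrier B \<Longrightarrow> a \<oplus> b = a \<oplus> c \<longleftrightarrow> b = c"
  by (metis a_cancel(1))

lemma a_inv_unique: "a \<in> carrier B \<Longrightarrow> b \<in> carrier B \<Longrightarrow> a \<oplus> b = \<zero> \<Longrightarrow> b = \<ominus> a"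
  by (metis a_cancel(1) a_inv_closed a_unit(2))

text \<open>
  This is the action \<open>\<lambda>\<close> of the multiplicative group on the additive group.
\<close>

definition lam :: "'a \<Rightarrow> 'a \<Rightarrow> 'a" where
  "lam a b = \<ominus> a \<oplus> a \<otimes> b"

lemma lam_closed [simp, intro]: "a \<in> carrier B \<Longrightarrow> b \<in> carrier B \<Longrightarrow> lam a b \<in> carrier B"
  by (simp add: lam_def)

lemma mult_eq_add_lam: "a \<in> carrier B \<Longrightarrow> b \<in> carrier B \<Longrightarrow> a \<otimes> b = a \<oplus> lam a b"
  by (simp add: lam_def)

lemma lam_add:
  "a \<in> carrier B \<Longrightarrow> b \<in> carrier B \<Longrightarrow> c \<in> carrier B \<Longrightarrow> lam a (b \<oplus> c) = lam a b \<oplus> lam a c"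
  by (simp add: lam_def brace_distrib a_minus_def a_assoc)

lemma lam_zero [simp]:
  assumes a: "a \<in> carrier B"
  shows "lam a \<zero> = \<zero>"
proof -
  have "lam a \<zero> \<oplus> lam a \<zero> = lam a \<zero> \<oplus> \<zero>"
    using lam_add[OF a, of \<zero> \<zero>] a by simp
  then show ?thesis using a by (subst (asm) a_left_cancel) auto
qed

lemma one_eq_zero: "\<one> = \<zero>"
proof -
  have "\<one> \<otimes> \<zero> = \<one> \<oplus> lam \<one> \<zero>" by (rule mult_eq_add_lam) auto
  then show ?thesis by simp
qed

lemma lam_one [simp]: "b \<in> carrier B \<Longrightarrow> lam \<one> b = b"
proof -
  assume "b \<in> carrier B"
  moreover have "\<ominus> \<zero> = \<zero>" using a_inv_unique[of \<zero> \<zero>] by simp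
  ultimately show ?thesis by (simp add: lam_def) (simp add: one_eq_zero)
qed

lemma lam_mult:
  assumes "a \<in> carrier B" "b \<in> carrier B" "c \<in> carrier B"
  shows "lam (a \<otimes> b) c = lam a (lam b c)"
proof -
  have "(a \<otimes> b) \<oplus> lam (a \<otimes> b) c = a \<otimes> (b \<otimes> c)"
    using assms by (simp add: m_assoc flip: mult_eq_add_lam)
  also have "\<dots> = a \<oplus> (lam a b \<oplus> lam a (lam b c))"
    using assms mult_eq_add_lam[of b c] mult_eq_add_lam[of a "b \<oplus> lam b c"] by (simp add: lam_add)
  also have "\<dots> = (a \<otimes> b) \<oplus> lam a (lam b c)"
    using assms by (simp add: mult_eq_add_lam a_assoc)
  finally show ?thesis using assms by (subst (asm) a_left_cancel) auto
qed

lemma lam_inv [simp]: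
  "a \<in> carrier B \<Longrightarrow> b \<in> carrier B \<Longrightarrow> lam (inv a) (lam a b) = b"
  "a \<in> carrier B \<Longrightarrow> b \<in> carrier B \<Longrightarrow> lam a (lam (inv a) b) = b"
  by (simp_all flip: lam_mult)

lemma lam_a_inv: "a \<in> carrier B \<Longrightarrow> b \<in> carrier B \<Longrightarrow> lam a (\<ominus> b) = \<ominus> lam a b"
  using lam_add[of a b "\<ominus> b"] by (intro a_inv_unique) auto

lemma lam_self_inv: "a \<in> carrier B \<Longrightarrow> lam a (inv a) = \<ominus> a"
  using mult_eq_add_lam[of a "inv a"] by (intro a_inv_unique) (auto simp: one_eq_zero)

lemma brace_star_eq: "brace_star B a b = lam a b \<oplus> \<ominus> b"
  by (simp add: brace_star_def lam_def a_minus_def)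

lemma lam_hom: "a \<in> carrier B \<Longrightarrow> group_hom (add_monoid B) (add_monoid B) (lam a)"
  by unfold_locales (auto simp: hom_def lam_add)

definition left_ideal :: "'a set \<Rightarrow> bool" where
  "left_ideal I \<longleftrightarrow> subgroup I (add_monoid B) \<and> (\<forall>a \<in> carrier B. \<forall>x \<in> I. lam a x \<in> I)"

definition brace_ideal :: "'a set \<Rightarrow> bool" where
  "brace_ideal I \<longleftrightarrow> left_ideal I \<and> I \<lhd> add_monoid B \<and> I \<lhd> B"

lemma additive_subgroupD:
  assumes "subgroup I (add_monoid B)"
  shows "I \<subseteq> carrier B" "\<zero> \<in> I" "x \<in> I \<Longrightarrow> y \<in> I \<Longrightarrow> x \<oplus> y \<in> I" "x \<in> I \<Longrightarrow> \<ominus> x \<in> I"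
  using subgroup.subset[OF assms] subgroup.one_closed[OF assms] subgroup.m_closed[OF assms]
    subgroup.m_inv_closed[OF assms] by (auto simp: a_inv_def)

lemma additive_normalD:
  assumes "I \<lhd> add_monoid B" "a \<in> carrier B" "x \<in> I"
  shows "a \<oplus> x \<oplus> \<ominus> a \<in> I" "\<ominus> a \<oplus> x \<oplus> a \<in> I"
  using normal.inv_op_closed2[OF assms(1)] normal.inv_op_closed1[OF assms(1)] assms(2,3)
  by (simp_all add: a_inv_def)

text \<open>
  This follows from \<open>x \<circ> y = x + \<lambda>\<^sub>x y\<close> and \<open>x\<^sup>-\<^sup>1 = \<lambda>\<^sub>y (-x)\<close>, where \<open>y\<close> is the multiplicative inverse of \<open>x\<close>.
\<close>

lemma left_ideal_subgroup:
  assumes I: "left_ideal I"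
  shows "subgroup I B"
proof -
  have lam: "\<And>a x. a \<in> carrier B \<Longrightarrow> x \<in> I \<Longrightarrow> lam a x \<in> I" and sub: "subgroup I (add_monoid B)"
    using I by (auto simp: left_ideal_def)
  note I = additive_subgroupD[OF sub]
  show ?thesis
  proof (rule subgroupI)
    show "I \<noteq> {}" using I(2) by blast
    fix x assume x: "x \<in> I"
    then have "inv x = lam (inv x) (\<ominus> x)" using I(1) by (metis inv_closed lam_self_inv lam_inv(1) subsetD)
    then show "inv x \<in> I" using x I lam[of "inv x" "\<ominus> x"] by auto
    fix y assume "y \<in> I"
    then show "x \<otimes> y \<in> I" using x I lam by (metis mult_eq_add_lam subsetD)
  qed (rule I(1))
qed

text \<open>
  The map \<open>\<lambda>\<^sub>c\<close> permutes the generators: \<open>\<lambda>\<^sub>c (a * b) = (c a c\<^sup>-\<^sup>1) * \<lambda>\<^sub>c b\<close>. Normality follows from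
  \<open>b + a * c - b = -(a * b) + a * (b + c)\<close>.
\<close>

lemma star_square_left_ideal: "left_ideal (star_square B)"
  and star_square_additive_normal: "star_square B \<lhd> add_monoid B"
  and star_mem_star_square: "a \<in> carrier B \<Longrightarrow> b \<in> carrier B \<Longrightarrow> lam a b \<oplus> \<ominus> b \<in> star_square B"
proof -
  let ?S = "{brace_star B a b | a b. a \<in> carrier B \<and> b \<in> carrier B}"
  let ?D = "generate (add_monoid B) ?S"
  have S: "?S \<subseteq> carrier (add_monoid B)" by (auto simp: brace_star_eq)
  have D: "subgroup ?D (add_monoid B)" by (rule add.generate_is_subgroup[OF S])
  have mem: "lam a b \<oplus> \<ominus> b \<in> ?D" if "a \<in> carrier B" "b \<in> carrier B" for a b
    using that generate.incl[of "brace_star B a b" ?S "add_monoid B"] by (auto simp: brace_star_eq)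
  then show "a \<in> carrier B \<Longrightarrow> b \<in> carrier B \<Longrightarrow> lam a b \<oplus> \<ominus> b \<in> star_square B"
    by (simp add: star_square_def)
  have hom_D: "h x \<in> ?D"
    if h: "group_hom (add_monoid B) (add_monoid B) h" "\<And>s. s \<in> ?S \<Longrightarrow> h s \<in> ?D" and x: "x \<in> ?D" for h x
  proof -
    have "h ` ?D = generate (add_monoid B) (h ` ?S)"
      by (rule group_hom.generate_img[OF h(1) S, symmetric])
    also have "\<dots> \<subseteq> ?D"
      using h(2) by (intro add.generate_subgroup_incl D) auto
    finally show ?thesis using x by blast
  qed
  have "lam c x \<in> ?D" if c: "c \<in> carrier B" and "x \<in> ?D" for c x
  proof (rule hom_D[OF lam_hom[OF c] _ that(2)])
    fix s assume "s \<in> ?S"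
    then obtain a b where ab: "a \<in> carrier B" "b \<in> carrier B" "s = lam a b \<oplus> \<ominus> b" by (auto simp: brace_star_eq)
    have "lam c s = lam (c \<otimes> a \<otimes> inv c) (lam c b) \<oplus> \<ominus> lam c b"
      using ab c by (simp add: lam_add lam_a_inv lam_mult)
    then show "lam c s \<in> ?D" using mem[of "c \<otimes> a \<otimes> inv c" "lam c b"] ab c by simp
  qed
  then show "left_ideal (star_square B)" using D by (auto simp: left_ideal_def star_square_def)
  show "star_square B \<lhd> add_monoid B"
    unfolding star_square_def
  proof (rule add.normal_invI[OF D])
    fix b x assume b: "b \<in> carrier (add_monoid B)" and x: "x \<in> ?D"
    let ?h = "\<lambda>x. b \<oplus> x \<oplus> \<ominus> b"
    have "group_hom (add_monoid B) (add_monoid B) ?h"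
      using b by unfold_locales (auto simp: hom_def a_assoc)
    moreover have "?h s \<in> ?D" if "s \<in> ?S" for s
    proof -
      obtain a c where ac: "a \<in> carrier B" "c \<in> carrier B" "s = lam a c \<oplus> \<ominus> c"
        using \<open>s \<in> ?S\<close> by (auto simp: brace_star_eq)
      have "?h s = \<ominus> (lam a b \<oplus> \<ominus> b) \<oplus> (lam a (b \<oplus> c) \<oplus> \<ominus> (b \<oplus> c))"
        using ac b by (simp add: lam_add a_assoc a_inv_add)
      then show ?thesis
        using additive_subgroupD(3,4)[OF D] mem ac b by simp
    qed
    ultimately have "?h x \<in> ?D" using hom_D x by blast
    then show "b \<otimes>\<^bsub>add_monoid B\<^esub> x \<otimes>\<^bsub>add_monoid B\<^esub> inv\<^bsub>add_monoid B\<^esub> b \<in> ?D"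
      by (simp add: a_inv_def)
  qed
qed

text \<open>
  Modulo \<open>B * B\<close> the maps \<open>\<lambda>\<^sub>x\<close> are trivial, so that both operations coincide there and additive normality
  becomes multiplicative normality. The elements \<open>u\<close>, \<open>v\<close> and \<open>w\<close> are the error terms of this computation.
\<close>

lemma star_square_ideal: "brace_ideal (star_square B)"
proof -
  let ?D = "star_square B"
  have sub: "subgroup ?D (add_monoid B)" using star_square_left_ideal by (simp add: left_ideal_def)
  note D = additive_subgroupD[OF sub]
  have "?D \<lhd> B"
  proof (rule normal_invI[OF left_ideal_subgroup[OF star_square_left_ideal]])
    fix x d assume x: "x \<in> carrier B" and d: "d \<in> ?D"
    have dB: "d \<in> carrier B" using d D(1) by blast
    define u where "u = lam x d"
    define v where "v = lam (x \<otimes> d) (inv x) \<oplus> \<ominus> (inv x)"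
    define w where "w = lam x (inv x) \<oplus> \<ominus> (inv x)"
    have mem: "u \<in> ?D" "v \<in> ?D" "w \<in> ?D"
      using star_square_left_ideal star_mem_star_square x d dB by (auto simp: u_def v_def w_def left_ideal_def)
    then have carr: "u \<in> carrier B" "v \<in> carrier B" "w \<in> carrier B" using D(1) by auto
    have "w \<oplus> inv x = \<ominus> x" using x by (simp add: w_def a_assoc lam_self_inv)
    then have inv_x: "inv x = \<ominus> w \<oplus> \<ominus> x" using x carr by (metis a_cancel(1) inv_closed)
    have "x \<otimes> d \<otimes> inv x = x \<oplus> u \<oplus> v \<oplus> inv x"
      using x dB mult_eq_add_lam[of "x \<otimes> d" "inv x"] mult_eq_add_lam[of x d] by (simp add: u_def v_def a_assoc)
    also have "\<dots> = x \<oplus> (u \<oplus> v \<oplus> \<ominus> w) \<oplus> \<ominus> x"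
      using x carr by (subst inv_x) (simp add: a_assoc)
    also have "\<dots> \<in> ?D"
      using mem D(3,4) by (intro additive_normalD(1)[OF star_square_additive_normal x]) auto
    finally show "x \<otimes> d \<otimes> inv x \<in> ?D" .
  qed
  then show ?thesis
    using star_square_left_ideal star_square_additive_normal by (simp add: brace_ideal_def)
qed

text \<open>
  The semidirect product of the additive group by the multiplicative group, acting through \<open>lam\<close>.
\<close>

definition holomorph :: "('a \<times> 'a) monoid" where
  "holomorph = \<lparr>carrier = carrier B \<times> carrier B,
    monoid.mult = \<lambda>x y. (fst x \<oplus> lam (snd x) (fst y), snd x \<otimes> snd y), monoid.one = (\<zero>, \<one>)\<rparr>"

lemma holomorph_simps [simp]:
  "carrier holomorph = carrier B \<times> carrier B" "\<one>\<^bsub>holomorph\<^esub> = (\<zero>, \<one>)"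
  "(x, t) \<otimes>\<^bsub>holomorph\<^esub> (y, u) = (x \<oplus> lam t y, t \<otimes> u)"
  by (simp_all add: holomorph_def)

lemma group_holomorph: "group holomorph"
proof (rule groupI)
  fix x assume "x \<in> carrier holomorph"
  then obtain s t where st: "x = (s, t)" "s \<in> carrier B" "t \<in> carrier B" by auto
  then show "\<one>\<^bsub>holomorph\<^esub> \<otimes>\<^bsub>holomorph\<^esub> x = x" by simp
  have "(\<ominus> lam (inv t) s, inv t) \<otimes>\<^bsub>holomorph\<^esub> x = \<one>\<^bsub>holomorph\<^esub>" using st by simp
  then show "\<exists>y \<in> carrier holomorph. y \<otimes>\<^bsub>holomorph\<^esub> x = \<one>\<^bsub>holomorph\<^esub>"
    using st by (intro bexI[of _ "(\<ominus> lam (inv t) s, inv t)"]) auto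
qed (auto simp: a_assoc m_assoc lam_add lam_mult)

lemma ideal_times_ideal_normal:
  assumes I: "brace_ideal I"
  shows "I \<times> I \<lhd> holomorph"
proof -
  interpret Hol: group holomorph by (rule group_holomorph)
  have sub: "subgroup I (add_monoid B)" and lam: "\<And>a x. a \<in> carrier B \<Longrightarrow> x \<in> I \<Longrightarrow> lam a x \<in> I"
    and add_normal: "I \<lhd> add_monoid B" and normal: "I \<lhd> B"
    using I by (auto simp: brace_ideal_def left_ideal_def)
  note I = additive_subgroupD[OF sub]
  interpret N: normal I B by (rule normal)
  have inv_hol: "inv\<^bsub>holomorph\<^esub> (s, t) = (\<ominus> lam (inv t) s, inv t)" if "s \<in> carrier B" "t \<in> carrier B" for s t
    using that by (intro Hol.inv_equality) auto
  show ?thesis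
  proof (rule Hol.normal_invI)
    show "subgroup (I \<times> I) holomorph"
    proof (rule Hol.subgroupI)
      show "I \<times> I \<noteq> {}" using I(2) by blast
      fix x assume "x \<in> I \<times> I"
      then obtain s t where st: "x = (s, t)" "s \<in> I" "t \<in> I" by auto
      then have carr: "s \<in> carrier B" "t \<in> carrier B" using I(1) by blast+
      have "\<ominus> lam (inv t) s \<in> I" "inv t \<in> I"
        using I(4)[OF lam[OF inv_closed[OF carr(2)] st(2)]] N.m_inv_closed[OF st(3)] by blast+
      then show "inv\<^bsub>holomorph\<^esub> x \<in> I \<times> I" using st(1) carr by (simp add: inv_hol)
      fix y assume "y \<in> I \<times> I"
      then obtain v u where vu: "y = (v, u)" "v \<in> I" "u \<in> I" by auto
      show "x \<otimes>\<^bsub>holomorph\<^esub> y \<in> I \<times> I"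
        using st(1) vu(1) I(3)[OF st(2) lam[OF carr(2) vu(2)]] N.m_closed[OF st(3) vu(3)] by simp
    qed (use I(1) in auto)
    fix g x assume g: "g \<in> carrier holomorph" and x: "x \<in> I \<times> I"
    obtain y u where yu: "g = (y, u)" "y \<in> carrier B" "u \<in> carrier B" using g by auto
    obtain s t where st: "x = (s, t)" "s \<in> I" "t \<in> I" using x by auto
    have carr: "s \<in> carrier B" "t \<in> carrier B" using st I(1) by auto
    define t' where "t' = u \<otimes> t \<otimes> inv u"
    have t': "t' \<in> I" "t' \<in> carrier B" unfolding t'_def using st yu N.inv_op_closed2 by auto
    have star: "lam t' y \<oplus> \<ominus> y \<in> I"
    proof -
      have "inv y \<otimes> t' \<otimes> y \<in> I" using yu t' N.inv_op_closed1 by simp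
      moreover have "t' \<otimes> y = y \<otimes> (inv y \<otimes> t' \<otimes> y)" using yu t' by (simp add: m_assoc)
      ultimately obtain z where z: "z \<in> I" "t' \<otimes> y = y \<otimes> z" by blast
      have zB: "z \<in> carrier B" using z I(1) by blast
      have "t' \<oplus> lam t' y = y \<oplus> lam y z" using z(2) yu t' zB by (simp flip: mult_eq_add_lam)
      then have "lam t' y = \<ominus> t' \<oplus> (y \<oplus> lam y z)" using yu t' zB by (metis a_cancel(1) lam_closed)
      then have "lam t' y \<oplus> \<ominus> y = \<ominus> t' \<oplus> (y \<oplus> lam y z \<oplus> \<ominus> y)"
        using yu t' zB by (simp add: a_assoc)
      also have "\<dots> \<in> I"
        using t' I(3,4) additive_normalD(1)[OF add_normal yu(2) lam[OF yu(2) z(1)]] by simp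
      finally show ?thesis .
    qed
    \<comment> \<open>The pair \<open>(s', t')\<close> is \<open>g x g\<^sup>-\<^sup>1\<close>, found by solving \<open>g x = (s', t') g\<close>.\<close>
    define s' where "s' = y \<oplus> lam u s \<oplus> \<ominus> y \<oplus> \<ominus> (lam t' y \<oplus> \<ominus> y)"
    have s': "s' \<in> I"
      unfolding s'_def using star I(3,4) additive_normalD(1)[OF add_normal yu(2) lam[OF yu(3) st(2)]] by blast
    have "g \<otimes>\<^bsub>holomorph\<^esub> x = (s', t') \<otimes>\<^bsub>holomorph\<^esub> g"
      using yu st carr t' by (simp add: s'_def a_assoc a_inv_add) (simp add: t'_def m_assoc)
    moreover have "(s', t') \<in> carrier holomorph" using s' t' I(1) by auto
    ultimately have "g \<otimes>\<^bsub>holomorph\<^esub> x \<otimes>\<^bsub>holomorph\<^esub> inv\<^bsub>holomorph\<^esub> g = (s', t')"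
      using g by (metis Hol.inv_closed Hol.m_assoc Hol.r_inv Hol.r_one)
    then show "g \<otimes>\<^bsub>holomorph\<^esub> x \<otimes>\<^bsub>holomorph\<^esub> inv\<^bsub>holomorph\<^esub> g \<in> I \<times> I"
      using s' t' by simp
  qed
qed

end


section \<open>The action of a normal subgroup of coprime order on itself\<close>

text \<open>
  Apply \<open>coprime_factorization_conj_by\<close> to the quotient of the holomorph by \<open>N \<times> N\<close>, with \<open>i a\<close> and \<open>j c\<close> the classes
  of \<open>(a, a)\<close> and \<open>(0, c)\<close>. For \<open>d \<in> D\<close> and \<open>a \<in> P\<close> the multiplicative commutator of \<open>d\<close> and \<open>a\<close> lies in
  \<open>P \<inter> D \<subseteq> N\<close>, so that \<open>(d, d)\<close> centralizes \<open>i(P)\<close> and \<open>(0, d)\<close> centralizes \<open>j(P)\<close> modulo \<open>N \<times> N\<close>. Finally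
  \<open>(s, t) = (s, s) (0, s\<^sup>-\<^sup>1 t)\<close> is the factorization of \<open>D \<times> D\<close>.
\<close>

theorem (in skew_brace) lam_trivial_modulo_ideal:
  assumes fin: "finite (carrier B)" and D: "brace_ideal D" and N: "brace_ideal N" and "N \<subseteq> D"
    and star: "\<And>a b. a \<in> carrier B \<Longrightarrow> b \<in> carrier B \<Longrightarrow> lam a b \<oplus> \<ominus> b \<in> D"
    and P: "P \<lhd> B" and PD: "P \<inter> D \<subseteq> N" and cop: "coprime (card D div card N) (card P)"
    and ac: "a \<in> P" "c \<in> P"
  shows "lam c a \<oplus> \<ominus> a \<in> N"
proof -
  interpret P: normal P B by (rule P)
  let ?P = "B\<lparr>carrier := P\<rparr>"
  interpret GP: group ?P by (rule P.subgroup_is_group) (rule is_group)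
  interpret Hol: group holomorph by (rule group_holomorph)
  interpret NN: normal "N \<times> N" holomorph by (rule ideal_times_ideal_normal[OF N])
  interpret DD: normal "D \<times> D" holomorph by (rule ideal_times_ideal_normal[OF D])
  let ?G = "holomorph Mod (N \<times> N)"
  define q where "q x = (N \<times> N) #>\<^bsub>holomorph\<^esub> x" for x
  interpret G: group ?G by (rule NN.factorgroup_is_group)
  interpret q: group_hom holomorph ?G q
    unfolding q_def by unfold_locales (rule NN.r_coset_hom_Mod)
  have q_surj: "q ` carrier holomorph = carrier ?G"
    by (auto simp: q_def carrier_FactGroup)
  have q_one: "q x = \<one>\<^bsub>?G\<^esub> \<longleftrightarrow> x \<in> N \<times> N" if "x \<in> carrier holomorph" for x
    using that Hol.coset_join1[OF _ that NN.subgroup_axioms] Hol.coset_join2[OF that NN.subgroup_axioms]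
    by (auto simp: q_def)
  have DB: "D \<subseteq> carrier B" and NB: "N \<subseteq> carrier B" and zero_D: "\<zero> \<in> D" "\<one> \<in> D" and zero_N: "\<zero> \<in> N"
    using D N additive_subgroupD(1,2) one_eq_zero by (auto simp: brace_ideal_def left_ideal_def)
  interpret D: normal D B using D by (simp add: brace_ideal_def)
  define M where "M = q ` (D \<times> D)"
  have fin_G: "finite (carrier ?G)" using fin by (simp flip: q_surj)
  have M_normal: "M \<lhd> ?G"
    unfolding M_def by (rule DD.surj_hom_normal_subgroup[OF q.group_hom_axioms q_surj])
  have card_M: "card M = (card D div card N) * (card D div card N)"
  proof -
    have "{x \<in> D \<times> D. q x = \<one>\<^bsub>?G\<^esub>} = N \<times> N"
      using q_one DB \<open>N \<subseteq> D\<close> by auto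
    then have eq: "card M * (card N * card N) = card D * card D"
      using q.card_image_mult_card_kernel[OF DD.subgroup_axioms] by (simp add: M_def card_cartesian_product)
    have "subgroup N (B\<lparr>carrier := D\<rparr>)"
      using N \<open>N \<subseteq> D\<close> subgroup_incl[OF _ D.subgroup_axioms] by (simp add: brace_ideal_def normal_imp_subgroup)
    from group.lagrange[OF D.subgroup_is_group[OF is_group] this]
    obtain k where k: "card D = k * card N" by (simp add: order_def) metis
    have "card N > 0" using zero_N NB fin by (metis card_gt_0_iff empty_iff finite_subset)
    then show ?thesis using eq k by (simp add: ac_simps)
  qed
  have conj_P: "conj_by ?P a c = inv a \<otimes> c \<otimes> a" if "a \<in> P" for a c
    using that by (simp add: conj_by_def m_inv_consistent[OF P.subgroup_axioms])
  have twist: "q (\<zero>, c) \<otimes>\<^bsub>?G\<^esub> q (a, a)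
      = q (lam c a \<oplus> \<ominus> a, \<one>) \<otimes>\<^bsub>?G\<^esub> (q (a, a) \<otimes>\<^bsub>?G\<^esub> q (\<zero>, conj_by ?P a c))"
    if "a \<in> P" "c \<in> P" for a c
  proof -
    have carr: "a \<in> carrier B" "c \<in> carrier B" using that by auto
    have "(\<zero>, c) \<otimes>\<^bsub>holomorph\<^esub> (a, a)
        = (lam c a \<oplus> \<ominus> a, \<one>) \<otimes>\<^bsub>holomorph\<^esub> ((a, a) \<otimes>\<^bsub>holomorph\<^esub> (\<zero>, inv a \<otimes> c \<otimes> a))"
      using carr by (simp add: a_assoc m_assoc)
    moreover have mem: "(\<zero>, c) \<in> carrier holomorph" "(a, a) \<in> carrier holomorph"
      "(lam c a \<oplus> \<ominus> a, \<one>) \<in> carrier holomorph" "(\<zero>, inv a \<otimes> c \<otimes> a) \<in> carrier holomorph"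
      using carr by simp_all
    ultimately show ?thesis
      unfolding conj_P[OF that(1)]
      using q.hom_mult[OF mem(1,2)] q.hom_mult[OF mem(3) Hol.m_closed[OF mem(2,4)]] q.hom_mult[OF mem(2,4)]
      by metis
  qed
  have exact: "q (\<zero>, c) \<otimes>\<^bsub>?G\<^esub> q (a, a) = q (a, a) \<otimes>\<^bsub>?G\<^esub> q (\<zero>, conj_by ?P a c)"
  proof (rule G.coprime_factorization_conj_by[where P = ?P and M = M and i = "\<lambda>a. q (a, a)" and j = "\<lambda>c. q (\<zero>, c)"
        and ?D1.0 = "q ` (\<lambda>d. (d, d)) ` D" and ?D2.0 = "q ` (\<lambda>d. (\<zero>, d)) ` D"])
    show "finite (carrier ?G)" "group ?P" "M \<lhd> ?G" by (fact fin_G GP.is_group M_normal)+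
    show "finite (carrier ?P)" using fin P.subset finite_subset by auto
    show "coprime (card M) (order ?P)" using cop by (simp add: card_M order_def)
    have diag_hom: "q (a \<otimes> b, a \<otimes> b) = q (a, a) \<otimes>\<^bsub>?G\<^esub> q (b, b)" if "a \<in> carrier B" "b \<in> carrier B" for a b
      using that q.hom_mult[of "(a, a)" "(b, b)"] by (simp add: mult_eq_add_lam del: q.hom_mult)
    have snd_hom: "q (\<zero>, a \<otimes> b) = q (\<zero>, a) \<otimes>\<^bsub>?G\<^esub> q (\<zero>, b)" if "a \<in> carrier B" "b \<in> carrier B" for a b
      using that q.hom_mult[of "(\<zero>, a)" "(\<zero>, b)"] by (simp del: q.hom_mult)
    show "(\<lambda>a. q (a, a)) \<in> hom ?P ?G" "(\<lambda>c. q (\<zero>, c)) \<in> hom ?P ?G"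
      using diag_hom snd_hom q.hom_closed by (auto simp: hom_def simp del: q.hom_mult)
    show "q ` (\<lambda>d. (d, d)) ` D \<subseteq> M" "q ` (\<lambda>d. (\<zero>, d)) ` D \<subseteq> M"
      using zero_D by (auto simp: M_def)
    show "M \<subseteq> q ` (\<lambda>d. (d, d)) ` D <#>\<^bsub>?G\<^esub> q ` (\<lambda>d. (\<zero>, d)) ` D"
    proof
      fix y assume "y \<in> M"
      then obtain s t where st: "y = q (s, t)" "s \<in> D" "t \<in> D" by (auto simp: M_def)
      then have carr: "s \<in> carrier B" "t \<in> carrier B" using DB by auto
      have "(s, t) = (s, s) \<otimes>\<^bsub>holomorph\<^esub> (\<zero>, inv s \<otimes> t)" using carr by simp
      then have "y = q (s, s) \<otimes>\<^bsub>?G\<^esub> q (\<zero>, inv s \<otimes> t)"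
        using st(1) carr q.hom_mult[of "(s, s)" "(\<zero>, inv s \<otimes> t)"] by simp
      moreover have "inv s \<otimes> t \<in> D" using st by simp
      ultimately show "y \<in> q ` (\<lambda>d. (d, d)) ` D <#>\<^bsub>?G\<^esub> q ` (\<lambda>d. (\<zero>, d)) ` D"
        using st(2) unfolding set_mult_def by blast
    qed
    have commute: "f d \<otimes>\<^bsub>?G\<^esub> f a = f a \<otimes>\<^bsub>?G\<^esub> f d"
      if f_mult: "\<And>x y. x \<in> carrier B \<Longrightarrow> y \<in> carrier B \<Longrightarrow> f (x \<otimes> y) = f x \<otimes>\<^bsub>?G\<^esub> f y"
        and f_closed: "\<And>x. x \<in> carrier B \<Longrightarrow> f x \<in> carrier ?G"
        and f_N: "\<And>x. x \<in> N \<Longrightarrow> f x = \<one>\<^bsub>?G\<^esub>" and d: "d \<in> D" and a: "a \<in> P" for f d a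
    proof -
      have carr: "d \<in> carrier B" "a \<in> carrier B" using d a DB by auto
      define x where "x = d \<otimes> a \<otimes> inv d \<otimes> inv a"
      have "x \<in> P" unfolding x_def using carr a by (simp add: P.inv_op_closed2)
      moreover have "x = d \<otimes> (a \<otimes> inv d \<otimes> inv a)" using carr by (simp add: x_def m_assoc)
      then have "x \<in> D" using carr d by (simp add: D.inv_op_closed2)
      ultimately have x: "x \<in> N" "x \<in> carrier B" using PD DB by auto
      have "d \<otimes> a = x \<otimes> (a \<otimes> d)" using carr by (simp add: x_def m_assoc)
      then have "f d \<otimes>\<^bsub>?G\<^esub> f a = f x \<otimes>\<^bsub>?G\<^esub> (f a \<otimes>\<^bsub>?G\<^esub> f d)"
        using f_mult carr x(2) by (metis m_closed)
      also have "\<dots> = f a \<otimes>\<^bsub>?G\<^esub> f d"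
        unfolding f_N[OF x(1)] by (rule G.l_one[OF G.m_closed[OF f_closed[OF carr(2)] f_closed[OF carr(1)]]])
      finally show ?thesis .
    qed
    show "d \<otimes>\<^bsub>?G\<^esub> q (a, a) = q (a, a) \<otimes>\<^bsub>?G\<^esub> d" if "d \<in> q ` (\<lambda>d. (d, d)) ` D" "a \<in> carrier ?P" for d a
    proof -
      obtain e where e: "d = q (e, e)" "e \<in> D" using \<open>d \<in> _\<close> by blast
      show ?thesis unfolding e(1)
        using that(2) NB e(2) q.hom_closed q_one
        by (intro commute[of "\<lambda>x. q (x, x)"] diag_hom) (auto simp: subset_iff)
    qed
    show "d \<otimes>\<^bsub>?G\<^esub> q (\<zero>, a) = q (\<zero>, a) \<otimes>\<^bsub>?G\<^esub> d" if "d \<in> q ` (\<lambda>d. (\<zero>, d)) ` D" "a \<in> carrier ?P" for d a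
    proof -
      obtain e where e: "d = q (\<zero>, e)" "e \<in> D" using \<open>d \<in> _\<close> by blast
      show ?thesis unfolding e(1)
        using that(2) NB e(2) q.hom_closed q_one zero_N
        by (intro commute[of "\<lambda>x. q (\<zero>, x)"] snd_hom) (auto simp: subset_iff)
    qed
    show "\<exists>m \<in> M. q (\<zero>, c) \<otimes>\<^bsub>?G\<^esub> q (a, a) = m \<otimes>\<^bsub>?G\<^esub> (q (a, a) \<otimes>\<^bsub>?G\<^esub> q (\<zero>, conj_by ?P a c))"
      if "a \<in> carrier ?P" "c \<in> carrier ?P" for a c
    proof (rule bexI)
      show "q (\<zero>, c) \<otimes>\<^bsub>?G\<^esub> q (a, a)
          = q (lam c a \<oplus> \<ominus> a, \<one>) \<otimes>\<^bsub>?G\<^esub> (q (a, a) \<otimes>\<^bsub>?G\<^esub> q (\<zero>, conj_by ?P a c))"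
        using that by (intro twist) auto
      show "q (lam c a \<oplus> \<ominus> a, \<one>) \<in> M"
        using that star zero_D by (auto simp: M_def)
    qed
    show "a \<in> carrier ?P" "c \<in> carrier ?P" using ac by simp_all
  qed
  have carr: "a \<in> carrier B" "c \<in> carrier B" using ac by auto
  let ?z = "q (a, a) \<otimes>\<^bsub>?G\<^esub> q (\<zero>, conj_by ?P a c)"
  have z: "?z \<in> carrier ?G"
    using carr by (intro G.m_closed q.hom_closed) (auto simp: conj_P[OF ac(1)])
  have x: "(lam c a \<oplus> \<ominus> a, \<one>) \<in> carrier holomorph" using carr by simp
  have "q (lam c a \<oplus> \<ominus> a, \<one>) \<otimes>\<^bsub>?G\<^esub> ?z = \<one>\<^bsub>?G\<^esub> \<otimes>\<^bsub>?G\<^esub> ?z"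
    using exact twist[OF ac] G.l_one[OF z] by metis
  then have "q (lam c a \<oplus> \<ominus> a, \<one>) = \<one>\<^bsub>?G\<^esub>"
    using G.right_cancel[OF z q.hom_closed[OF x] G.one_closed] by blast
  then show ?thesis using q_one[OF x] by simp
qed

section \<open>The largest divisor that is a pi-number\<close>

lemma pi_part_props:
  assumes n: "n > 0"
  shows pi_part_dvd: "pi_part \<pi> n dvd n" and pi_number_pi_part: "pi_number \<pi> (pi_part \<pi> n)"
    and pi_part_ge: "pi_number \<pi> d \<Longrightarrow> d dvd n \<Longrightarrow> d \<le> pi_part \<pi> n"
proof -
  let ?S = "{d. pi_number \<pi> d \<and> d dvd n}"
  have fin: "finite ?S" by (rule finite_subset[of _ "{..n}"]) (use n in \<open>auto dest: dvd_imp_le\<close>)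
  moreover have "1 \<in> ?S" by (auto simp: pi_number_def)
  ultimately have "Max ?S \<in> ?S" by (intro Max_in) auto
  then show "pi_part \<pi> n dvd n" "pi_number \<pi> (pi_part \<pi> n)" by (auto simp: pi_part_def)
  show "d \<le> pi_part \<pi> n" if "pi_number \<pi> d" "d dvd n"
    unfolding pi_part_def by (rule Max_ge[OF fin]) (use that in simp)
qed

lemma coprime_pi_number_cofactor:
  assumes n: "n > 0" and m: "pi_number \<pi> m"
  shows "coprime m (n div pi_part \<pi> n)"
proof (rule ccontr)
  let ?k = "pi_part \<pi> n"
  assume "\<not> coprime m (n div ?k)"
  then have "gcd m (n div ?k) \<noteq> 1" by (simp add: coprime_iff_gcd_eq_1)
  then obtain p where p: "Factorial_Ring.prime p" "p dvd gcd m (n div ?k)" using prime_factor_nat by blast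
  then have pm: "p \<in> \<pi>" using m by (auto simp: pi_number_def)
  have pos: "?k > 0" using pi_number_pi_part[OF n] by (simp add: pi_number_def)
  have "?k * p dvd ?k * (n div ?k)" using p(2) by (intro mult_dvd_mono) auto
  then have "?k * p dvd n" using pi_part_dvd[OF n, of \<pi>] by simp
  moreover have "pi_number \<pi> (?k * p)"
    using pi_number_pi_part[OF n, of \<pi>] p(1) pm prime_gt_0_nat[OF p(1)]
    by (auto simp: pi_number_def prime_dvd_mult_iff dest: primes_dvd_imp_eq)
  ultimately have "?k * p \<le> ?k" by (rule pi_part_ge[OF n, rotated])
  then show False using pos prime_gt_1_nat[OF p(1)] by simp
qed

lemma pi_number_dvd: "pi_number \<pi> n \<Longrightarrow> d dvd n \<Longrightarrow> pi_number \<pi> d"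
  unfolding pi_number_def by (metis dvd_0_left dvd_trans gr0I)

lemma dvd_pi_part:
  assumes n: "n > 0" and d: "pi_number \<pi> d" "d dvd n"
  shows "d dvd pi_part \<pi> n"
proof -
  have "n = pi_part \<pi> n * (n div pi_part \<pi> n)" using pi_part_dvd[OF n] by simp
  then have "d dvd pi_part \<pi> n * (n div pi_part \<pi> n)" using d(2) by metis
  then show ?thesis using coprime_pi_number_cofactor[OF n d(1)] by (simp add: coprime_dvd_mult_left_iff)
qed

section \<open>Normal Hall subgroups and Hall sub-skew braces\<close>

text \<open>
  The hypothesis on \<open>P1\<close> makes it the set of elements of \<open>B * B\<close> killed by its order. So it is invariant under
  the automorphisms \<open>\<lambda>\<^sub>a\<close> and under additive conjugation. As a subgroup of \<open>(B, \<circ>)\<close> of \<open>\<pi>\<close>-order it lies in \<open>P\<close>, and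
  comparing orders gives \<open>P1 = P \<inter> (B * B)\<close>, which is multiplicatively normal.
\<close>

theorem (in skew_brace) normal_hall_subgroup_sub_skew_brace:
  assumes fin: "finite (carrier B)"
    and hall_P: "hall_subgroup \<pi> P B" and P: "P \<lhd> B"
    and hall_P1: "hall_subgroup \<pi> P1 ((add_monoid B)\<lparr>carrier := star_square B\<rparr>)"
    and P1: "P1 \<lhd> (add_monoid B)\<lparr>carrier := star_square B\<rparr>"
  shows "hall_sub_skew_brace \<pi> P B"
proof -
  interpret P: normal P B by (rule P)
  let ?D = "star_square B"
  let ?AD = "(add_monoid B)\<lparr>carrier := ?D\<rparr>"
  have D: "brace_ideal ?D" by (rule star_square_ideal)
  have D_add: "subgroup ?D (add_monoid B)" and D_mult: "subgroup ?D B"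
    and D_lam: "\<And>a x. a \<in> carrier B \<Longrightarrow> x \<in> ?D \<Longrightarrow> lam a x \<in> ?D" and D_normal: "?D \<lhd> add_monoid B"
    using D by (auto simp: brace_ideal_def left_ideal_def normal_imp_subgroup)
  note D_sub = additive_subgroupD[OF D_add]
  interpret AD: group ?AD using subgroup.subgroup_is_group[OF D_add add.is_group] .
  have fin_D: "finite ?D" using D_sub(1) fin finite_subset by blast
  have card_D: "card ?D > 0" using D_sub(2) fin_D by (metis card_gt_0_iff empty_iff)
  have order_AD: "order ?AD = card ?D" by (simp add: order_def)
  have card_P1: "card P1 = pi_part \<pi> (card ?D)" using hall_P1 unfolding hall_subgroup_def order_AD by blast
  have order_B: "order B > 0" using fin order_gt_0_iff_finite by simp
  have card_P: "card P = pi_part \<pi> (order B)" using hall_P by (simp add: hall_subgroup_def)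
  have pi_P: "pi_number \<pi> (card P)" and pi_P1: "pi_number \<pi> (card P1)"
    using pi_number_pi_part card_P card_P1 order_B card_D by simp_all
  have card_D_dvd: "card ?D dvd order B" using lagrange[OF D_mult] by (metis dvd_triv_right)
  have card_P1_dvd: "card P1 dvd card ?D" using pi_part_dvd card_P1 card_D by simp
  have P1_dvd_P: "card P1 dvd card P"
    unfolding card_P using dvd_pi_part[OF order_B pi_P1] card_P1_dvd card_D_dvd dvd_trans by blast
  have P1_D: "P1 \<subseteq> ?D" using normal_imp_subgroup[OF P1] subgroup.subset by fastforce
  have P1_B: "P1 \<subseteq> carrier B" using P1_D D_sub(1) by blast
  have P1_iff: "x \<in> P1 \<longleftrightarrow> x [^]\<^bsub>add_monoid B\<^esub> card P1 = \<zero>" if "x \<in> ?D" for x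
  proof -
    have "coprime (card P1) (order ?AD div card P1)"
      using coprime_pi_number_cofactor[OF card_D pi_P1] unfolding order_AD card_P1 .
    then have "x \<in> P1 \<longleftrightarrow> x [^]\<^bsub>?AD\<^esub> card P1 = \<one>\<^bsub>?AD\<^esub>"
      using fin_D that by (intro AD.normal_hall_subgroup_eq_torsion P1) simp_all
    then show ?thesis
      unfolding add.nat_pow_consistent[of x "card P1" ?D] by simp
  qed
  have P1_invariant: "h x \<in> P1"
    if h: "group_hom (add_monoid B) (add_monoid B) h" and "h x \<in> ?D" "x \<in> P1" for h x
  proof -
    interpret h: group_hom "add_monoid B" "add_monoid B" h by (rule h)
    have "x [^]\<^bsub>add_monoid B\<^esub> card P1 = \<zero>" using P1_iff P1_D that by blast
    then have "h x [^]\<^bsub>add_monoid B\<^esub> card P1 = \<zero>"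
      using h.hom_nat_pow[of x "card P1"] h.hom_one P1_B that(3) by auto
    then show ?thesis using P1_iff that by blast
  qed
  have P1_add: "subgroup P1 (add_monoid B)"
    using add.incl_subgroup[OF D_add normal_imp_subgroup[OF P1]] .
  have "lam a x \<in> P1" if "a \<in> carrier B" "x \<in> P1" for a x
    using P1_invariant[OF lam_hom] D_lam P1_D that by blast
  then have P1_left: "left_ideal P1" using P1_add by (auto simp: left_ideal_def)
  have P1_add_normal: "P1 \<lhd> add_monoid B"
  proof (rule add.normal_invI[OF P1_add])
    fix b x assume b: "b \<in> carrier (add_monoid B)" and x: "x \<in> P1"
    have "group_hom (add_monoid B) (add_monoid B) (\<lambda>x. b \<oplus> x \<oplus> \<ominus> b)"
      using b by unfold_locales (auto simp: hom_def a_assoc)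
    moreover have "b \<oplus> x \<oplus> \<ominus> b \<in> ?D" using additive_normalD(1)[OF D_normal] b x P1_D by auto
    ultimately have "b \<oplus> x \<oplus> \<ominus> b \<in> P1" using P1_invariant x by blast
    then show "b \<otimes>\<^bsub>add_monoid B\<^esub> x \<otimes>\<^bsub>add_monoid B\<^esub> inv\<^bsub>add_monoid B\<^esub> b \<in> P1" by (simp add: a_inv_def)
  qed
  have P1_mult: "subgroup P1 B" by (rule left_ideal_subgroup[OF P1_left])
  have P1_P: "P1 \<subseteq> P"
  proof
    fix x assume x: "x \<in> P1"
    interpret GP1: group "B\<lparr>carrier := P1\<rparr>" using subgroup.subgroup_is_group[OF P1_mult is_group] .
    have "x [^] card P1 = \<one>"
      using GP1.pow_order_eq_1[of x] x by (simp add: order_def flip: nat_pow_consistent)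
    moreover obtain k where "card P = card P1 * k" using P1_dvd_P by blast
    ultimately have "x [^] card P = \<one>" using x P1_B by (auto simp flip: nat_pow_pow)
    moreover have "coprime (card P) (order B div card P)"
      using coprime_pi_number_cofactor[OF order_B pi_P] by (simp add: card_P)
    ultimately show "x \<in> P" using normal_hall_subgroup_eq_torsion[OF fin P] x P1_B by blast
  qed
  have P1_eq: "P1 = P \<inter> ?D"
  proof (rule card_seteq)
    show "finite (P \<inter> ?D)" using fin_D by simp
    show "P1 \<subseteq> P \<inter> ?D" using P1_P P1_D by blast
    have PD: "subgroup (P \<inter> ?D) B" using subgroups_Inter_pair P.subgroup_axioms D_mult by blast
    have dvd: "card (P \<inter> ?D) dvd card A" if "subgroup A B" "P \<inter> ?D \<subseteq> A" for A
      using group.lagrange[OF subgroup.subgroup_is_group[OF that(1) is_group] subgroup_incl[OF PD that]]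
      by (simp add: order_def) (metis dvd_triv_right)
    have "pi_number \<pi> (card (P \<inter> ?D))" using pi_number_dvd[OF pi_P dvd[OF P.subgroup_axioms]] by blast
    then show "card (P \<inter> ?D) \<le> card P1"
      unfolding card_P1 using pi_part_ge[OF card_D] dvd[OF D_mult] by blast
  qed
  have "?D \<lhd> B" using D by (simp add: brace_ideal_def)
  then have "P1 \<lhd> B"
    unfolding P1_eq by (rule normal_subgroup_intersect[OF P])
  then have P1_ideal: "brace_ideal P1"
    using P1_left P1_add_normal by (simp add: brace_ideal_def)
  have cop: "coprime (card ?D div card P1) (card P)"
    using coprime_pi_number_cofactor[OF card_D pi_P] by (simp add: card_P1 coprime_commute)
  have lam_P: "lam c a \<in> P" if "a \<in> P" "c \<in> P" for a c
  proof -
    have carr: "a \<in> carrier B" "c \<in> carrier B" using that by auto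
    have "lam c a \<oplus> \<ominus> a \<in> P1"
      using lam_trivial_modulo_ideal[OF fin D P1_ideal P1_D star_mem_star_square P _ cop that] P1_eq by blast
    then have "\<ominus> a \<oplus> (lam c a \<oplus> \<ominus> a) \<oplus> a \<in> P1"
      by (rule additive_normalD(2)[OF P1_add_normal carr(1)])
    then have x: "\<ominus> a \<oplus> lam c a \<in> P1" using carr by (simp add: a_assoc)
    then have "lam (inv a) (\<ominus> a \<oplus> lam c a) \<in> P1"
      using P1_left carr by (simp add: left_ideal_def)
    then have "a \<otimes> lam (inv a) (\<ominus> a \<oplus> lam c a) \<in> P" using P1_P that by blast
    then show ?thesis using carr by (simp add: mult_eq_add_lam)
  qed
  have "subgroup P (add_monoid B)"
  proof (rule add.subgroupI)
    show "P \<subseteq> carrier (add_monoid B)" using P.subset by simp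
    show "P \<noteq> {}" using P.one_closed by blast
    fix a assume a: "a \<in> P"
    have "\<ominus> a \<in> P" using lam_P[of "inv a" a] lam_self_inv[of a] a by simp
    then show "inv\<^bsub>add_monoid B\<^esub> a \<in> P" by (simp add: a_inv_def)
    fix b assume b: "b \<in> P"
    have "a \<otimes> lam (inv a) b \<in> P" using a b lam_P by blast
    then show "a \<otimes>\<^bsub>add_monoid B\<^esub> b \<in> P" using a b by (simp add: mult_eq_add_lam)
  qed
  then show ?thesis
    using P.subgroup_axioms card_P by (simp add: hall_sub_skew_brace_def sub_skew_brace_def)
qed

theorem theorem12:
  fixes B :: "('a, 'b) ring_scheme" and \<pi> :: "nat set" and P P\<^sub>1 :: "'a set"
  assumes "\<forall>p\<in>\<pi>. Factorial_Ring.prime p"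
    and "skew_brace B"
    and "finite (carrier B)"
    and "hall_subgroup \<pi> P B"
    and "P \<lhd> B"
    and "hall_subgroup \<pi> P\<^sub>1 ((add_monoid B)\<lparr>carrier := star_square B\<rparr>)"
    and "P\<^sub>1 \<lhd> (add_monoid B)\<lparr>carrier := star_square B\<rparr>"
  shows "hall_sub_skew_brace \<pi> P B"
  using assms by (intro skew_brace.normal_hall_subgroup_sub_skew_brace)

end
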